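(* Let $\mathsf V$ be the variety of all $\ell$-groups (respectively, the variety of representable $\ell$-groups, or the variety of Abelian $\ell$-groups). For any partially ordered group $G$, the minimal spectrum $\mathrm{Min}\,F_{\mathsf V}(G)$ is homeomorphic to the space $\mathscr{R}(\eta[G])$ of right orders (respectively, in both the representable and the Abelian case, to the space $\mathscr{O}(\eta[G])$ of orders) on $\eta[G]$, where $\eta\colon G\to F_{\mathsf V}(G)$ is the universal map.
   Context: A partially ordered group is a group $G$ (identity $\mathrm{e}$) with a partial order such that $a\le b$ implies $sat\le sbt$; $G^+=\{a\mid a\ge \mathrm{e}\}$. An $\ell$-group is a partially ordered group whose order is a lattice; it is representable if it is a subdirect product of totally ordered groups, and Abelian if its group is Abelian. An $\ell$-homomorphism is a group and lattice homomorphism; a positive homomorphism is an order-preserving group homomorphism. $F_{\mathsf V}(G)$, with positive homomorphism $\eta\colon G\to F_{\mathsf V}(G)$, is the free $\ell$-group over $G$ in $\mathsf V$: $F_{\mathsf V}(G)\in\mathsf V$ and for each positive homomorphism $p\colon G\to H$ with $H\in\mathsf V$ there is exactly one $\ell$-homomorphism $h$ with $h\circ\eta=p$. The group image $\eta[G]$ is partially ordered by the restriction of the order of $F_{\mathsf V}(G)$. For an $\ell$-group $H$, a convex $\ell$-subgroup is an order-convex sublattice subgroup $\mathfrak k$; cosets are ordered by $\mathfrak kx\le\mathfrak ky$ iff $x\le ty$ for some $t\in\mathfrak k$; $\mathfrak k$ is prime if it is proper and $H/\mathfrak k$ is totally ordered. $\mathrm{Spec}\,H$ is the set of prime subgroups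 with open sets $\{\mathfrak p\mid A\not\subseteq\mathfrak p\}$, $A\subseteq H$. $\mathrm{Min}\,H$ is the subspace of inclusion-minimal prime subgroups. For a partially ordered group $K$, a right order on $K$ is a right-invariant total order on $K$ extending the partial order of $K$ and different from $K\times K$ (so a trivial group has none), identified with its positive cone $C=\{a\mid \mathrm{e}\le a\}$. An order is a right order that is also left invariant. $\mathscr{R}(K)$ is the set of right orders with the topology having as subbase the sets $\{C\in\mathscr R(K)\mid a\in C\}$ and $\{C\in\mathscr R(K)\mid a\notin C\}$, $a\in K$; $\mathscr{O}(K)\subseteq\mathscr R(K)$ is the subspace of orders. *)

theory Defs
  imports "HOL-Analysis.Analysis" "HOL-Algebra.Lattice" "HOL-Algebra.Coset" "HOL-Algebra.Product_Groups"
begin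

section \<open>Partially ordered groups and l-groups\<close>

record 'a ogroup = "'a monoid" +
  ole :: "'a \<Rightarrow> 'a \<Rightarrow> bool" (infixl \<open>\<preceq>\<index>\<close> 50)

text \<open>The underlying ordered set, in the format of HOL-Algebra's order theory.\<close>

definition order_of :: "('a, 'b) ogroup_scheme \<Rightarrow> 'a gorder" where
  "order_of G = \<lparr>carrier = carrier G, eq = (=), le = ole G\<rparr>"

locale po_group = group G + ord: partial_order "order_of G"
  for G :: "('a, 'b) ogroup_scheme" (structure) +
  assumes mult_mono:
    "\<lbrakk>a \<in> carrier G; b \<in> carrier G; s \<in> carrier G; t \<in> carrier G; a \<preceq> b\<rbrakk>
      \<Longrightarrow> s \<otimes> a \<otimes> t \<preceq> s \<otimes> b \<otimes> t"

locale l_group = po_group G + ord: Lattice.lattice "order_of G"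
  for G :: "('a, 'b) ogroup_scheme" (structure)

locale to_group = po_group G + ord: total_order "order_of G"
  for G :: "('a, 'b) ogroup_scheme" (structure)

definition pos_hom :: "('a, 'c) ogroup_scheme \<Rightarrow> ('b, 'd) ogroup_scheme \<Rightarrow> ('a \<Rightarrow> 'b) set" where
  "pos_hom G H = {h \<in> hom G H. \<forall>x\<in>carrier G. \<forall>y\<in>carrier G. x \<preceq>\<^bsub>G\<^esub> y \<longrightarrow> h x \<preceq>\<^bsub>H\<^esub> h y}"

definition l_hom :: "('a, 'c) ogroup_scheme \<Rightarrow> ('b, 'd) ogroup_scheme \<Rightarrow> ('a \<Rightarrow> 'b) set" where
  "l_hom G H = {h \<in> hom G H. \<forall>x\<in>carrier G. \<forall>y\<in>carrier G.
      h (x \<squnion>\<^bsub>order_of G\<^esub> y) = h x \<squnion>\<^bsub>order_of H\<^esub> h y \<and>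
      h (x \<sqinter>\<^bsub>order_of G\<^esub> y) = h x \<sqinter>\<^bsub>order_of H\<^esub> h y}"

definition product_ogroup :: "'i set \<Rightarrow> ('i \<Rightarrow> ('b, 'c) ogroup_scheme) \<Rightarrow> ('i \<Rightarrow> 'b) ogroup" where
  "product_ogroup I T =
    monoid.extend (product_group I T) \<lparr>ole = (\<lambda>f g. \<forall>i\<in>I. f i \<preceq>\<^bsub>T i\<^esub> g i)\<rparr>"

text \<open>
  In a subdirect representation of \<open>G\<close> each factor is isomorphic to the quotient of \<open>G\<close> by the
  kernel of the corresponding projection, and repeated kernels may be dropped. Hence factors with
  elements of type \<open>'a set\<close> (cosets), indexed by elements of type \<open>'a set\<close> (kernels), cover
  subdirect representations of arbitrary index and element types.
\<close>

definition representable :: "'a ogroup \<Rightarrow> bool" where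
  "representable G \<longleftrightarrow> l_group G \<and>
    (\<exists>(I :: 'a set set) (T :: 'a set \<Rightarrow> 'a set ogroup) \<phi>.
      (\<forall>i\<in>I. to_group (T i)) \<and>
      \<phi> \<in> l_hom G (product_ogroup I T) \<and> inj_on \<phi> (carrier G) \<and>
      (\<forall>i\<in>I. (\<lambda>x. \<phi> x i) ` carrier G = carrier (T i)))"

definition abelian_l_group :: "'a ogroup \<Rightarrow> bool" where
  "abelian_l_group G \<longleftrightarrow> l_group G \<and> comm_group G"

text \<open>
  A predicate passed as an argument cannot be used at two element types, so the three varieties
  are named by a datatype.
\<close>

datatype l_variety = All_Lgroups | Representable_Lgroups | Abelian_Lgroups

fun in_variety :: "l_variety \<Rightarrow> 'a ogroup \<Rightarrow> bool" where
  "in_variety All_Lgroups H \<longleftrightarrow> l_group H"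
| "in_variety Representable_Lgroups H \<longleftrightarrow> representable H"
| "in_variety Abelian_Lgroups H \<longleftrightarrow> abelian_l_group H"


section \<open>The free l-group over a partially ordered group\<close>

text \<open>
  The universal property quantifies over l-groups \<open>H\<close> with elements of the single type
  \<open>('g + 'f) list set\<close>. This is equivalent to quantifying over all types. The type contains copies of
  \<open>F\<close> and of every l-group generated by an image of \<open>G\<close> (such a group has at most
  \<open>|'g list|\<close> elements). Applied to copies of \<open>F\<close> and of its l-subgroup generated by
  \<open>\<eta> ` carrier G\<close>, the property shows that \<open>\<eta> ` carrier G\<close> generates \<open>F\<close>, whence uniqueness of
  extensions into arbitrary \<open>H\<close>. Existence for arbitrary \<open>H\<close> follows because a positive
  homomorphism \<open>p\<close> into \<open>H\<close> factors through the l-subgroup generated by \<open>p ` carrier G\<close>, and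
  all three varieties are closed under l-subgroups.
  Uniqueness of \<open>h\<close> is meant on \<open>carrier F\<close>, hence the use of \<open>extensional\<close>.
\<close>

definition free_l_group_over :: "l_variety \<Rightarrow> 'g ogroup \<Rightarrow> 'f ogroup \<Rightarrow> ('g \<Rightarrow> 'f) \<Rightarrow> bool" where
  "free_l_group_over V G F \<eta> \<longleftrightarrow>
    in_variety V F \<and> \<eta> \<in> pos_hom G F \<and>
    (\<forall>(H :: ('g + 'f) list set ogroup) p. in_variety V H \<and> p \<in> pos_hom G H \<longrightarrow>
      (\<exists>!h. h \<in> l_hom F H \<and> h \<in> extensional (carrier F) \<and> (\<forall>g\<in>carrier G. h (\<eta> g) = p g)))"

definition group_image :: "('g \<Rightarrow> 'f) \<Rightarrow> 'g ogroup \<Rightarrow> 'f ogroup \<Rightarrow> 'f ogroup" where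
  "group_image \<eta> G F = F\<lparr>carrier := \<eta> ` carrier G\<rparr>"


section \<open>Spectra\<close>

definition convex_l_subgroup :: "'a set \<Rightarrow> 'a ogroup \<Rightarrow> bool" where
  "convex_l_subgroup k H \<longleftrightarrow> subgroup k H \<and>
    (\<forall>x\<in>k. \<forall>y\<in>k. x \<squnion>\<^bsub>order_of H\<^esub> y \<in> k \<and> x \<sqinter>\<^bsub>order_of H\<^esub> y \<in> k) \<and>
    (\<forall>x\<in>k. \<forall>y\<in>k. \<forall>z\<in>carrier H. x \<preceq>\<^bsub>H\<^esub> z \<and> z \<preceq>\<^bsub>H\<^esub> y \<longrightarrow> z \<in> k)"

text \<open>The ordered set of right cosets; \<open>k\<close> need not be normal.\<close>

definition coset_order :: "'a ogroup \<Rightarrow> 'a set \<Rightarrow> 'a set gorder" where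
  "coset_order H k =
    \<lparr>carrier = rcosets\<^bsub>H\<^esub> k, eq = (=),
     le = (\<lambda>c d. \<exists>x\<in>carrier H. \<exists>y\<in>carrier H. c = k #>\<^bsub>H\<^esub> x \<and> d = k #>\<^bsub>H\<^esub> y \<and>
            (\<exists>t\<in>k. x \<preceq>\<^bsub>H\<^esub> t \<otimes>\<^bsub>H\<^esub> y))\<rparr>"

definition Spec :: "'a ogroup \<Rightarrow> 'a set set" where
  "Spec H = {p. convex_l_subgroup p H \<and> p \<noteq> carrier H \<and> total_order (coset_order H p)}"

text \<open>
  The generating family is closed under arbitrary unions and finite intersections, so its members
  are exactly the open sets.
\<close>

definition spec_space :: "'a ogroup \<Rightarrow> 'a set topology" where
  "spec_space H = topology_generated_by {{p \<in> Spec H. \<not> A \<subseteq> p} | A. A \<subseteq> carrier H}"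

definition minimal_primes :: "'a ogroup \<Rightarrow> 'a set set" where
  "minimal_primes H = {p \<in> Spec H. \<forall>q\<in>Spec H. q \<subseteq> p \<longrightarrow> q = p}"

definition min_space :: "'a ogroup \<Rightarrow> 'a set topology" where
  "min_space H = subtopology (spec_space H) (minimal_primes H)"


section \<open>Spaces of right orders and of orders\<close>

definition right_order_rel :: "'a ogroup \<Rightarrow> 'a rel \<Rightarrow> bool" where
  "right_order_rel K r \<longleftrightarrow>
    linear_order_on (carrier K) r \<and>
    (\<forall>a b. \<forall>t\<in>carrier K. (a, b) \<in> r \<longrightarrow> (a \<otimes>\<^bsub>K\<^esub> t, b \<otimes>\<^bsub>K\<^esub> t) \<in> r) \<and>
    (\<forall>a\<in>carrier K. \<forall>b\<in>carrier K. a \<preceq>\<^bsub>K\<^esub> b \<longrightarrow> (a, b) \<in> r) \<and>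
    r \<noteq> carrier K \<times> carrier K"

definition order_rel :: "'a ogroup \<Rightarrow> 'a rel \<Rightarrow> bool" where
  "order_rel K r \<longleftrightarrow> right_order_rel K r \<and>
    (\<forall>a b. \<forall>s\<in>carrier K. (a, b) \<in> r \<longrightarrow> (s \<otimes>\<^bsub>K\<^esub> a, s \<otimes>\<^bsub>K\<^esub> b) \<in> r)"

definition positive_cone :: "'a ogroup \<Rightarrow> 'a rel \<Rightarrow> 'a set" where
  "positive_cone K r = {a \<in> carrier K. (\<one>\<^bsub>K\<^esub>, a) \<in> r}"

definition right_orders :: "'a ogroup \<Rightarrow> 'a set set" where
  "right_orders K = {positive_cone K r | r. right_order_rel K r}"

definition orders :: "'a ogroup \<Rightarrow> 'a set set" where
  "orders K = {positive_cone K r | r. order_rel K r}"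

definition right_order_space :: "'a ogroup \<Rightarrow> 'a set topology" where
  "right_order_space K = topology_generated_by
    ({{C \<in> right_orders K. a \<in> C} | a. a \<in> carrier K} \<union>
     {{C \<in> right_orders K. a \<notin> C} | a. a \<in> carrier K})"

definition order_space :: "'a ogroup \<Rightarrow> 'a set topology" where
  "order_space K = subtopology (right_order_space K) (orders K)"

end

(*
A right preorder on a group is the same as its positive cone, and prime subgroups p of an l-group F
correspond to the meet-closed cones {x. p <= p x} of total right preorders containing F+.  Let K be
a subgroup that generates F as a lattice.  Modulo a prime, every lattice term over K reduces to an
element of K after finitely many comparisons, so a prime cone is determined, together with its
inclusions and up to finite data, by its trace on K.  Every prime cone contains the cone of a right
order on F (refine the preorder lexicographically until it is antisymmetric, using ultrafilters of
F+); in representable l-groups, where x /\ y = e implies g x g^-1 /\ y = e, that cone can be taken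
normal.  Conversely the free extension F -> Aut(K, <=) of the right regular action, or F -> (K, <=)
for a two-sided order, realises each (right) order on K as the trace of a prime cone.  Hence the
minimal primes are exactly the primes whose trace is antisymmetric, and taking traces is a
homeomorphism.
*)
theory Submission
  imports Defs
begin

section \<open>Lattice-ordered groups\<close>

text \<open>The antisymmetric cone found inside a prime cone of \<open>F\<close> is in general not
  closed under meets, as an antisymmetric prime cone would make \<open>F\<close> totally ordered. So
  it does not yield a smaller prime by itself, and minimality of a prime cannot be applied to it.
  The detour through \<open>K\<close> repairs this: the trace of that cone on \<open>K\<close> is a
  right order, freeness lifts it to a prime cone, and the lift lies below the given prime cone
  because inclusions can be tested on \<open>K\<close>. Antisymmetry also accounts for the topology.
  In the spectrum only the failure of nonnegativity is visibly an open condition; on minimal primes,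
  for \<open>a\<close> in \<open>K\<close> other than the identity, nonnegativity of
  \<open>a\<close> is the failure of nonnegativity of its inverse, hence open as well. In the other
  direction the finite data attached to an element of \<open>F\<close> provide a basic open set of
  orders. The Abelian case needs no separate treatment, since representability and commutativity
  both enter the construction of normal cones only through orthogonality being preserved by
  conjugation.\<close>

lemma order_of_simps [simp]:
  "carrier (order_of G) = carrier G" "le (order_of G) = ole G" "eq (order_of G) = (=)"
  by (simp_all add: order_of_def)

section \<open>Translation and inversion in partially ordered groups\<close>

context po_group
begin

lemma ole_refl: "x \<in> carrier G \<Longrightarrow> x \<preceq> x"
  using ord.le_refl[of x] by simp

lemma ole_trans:
  "\<lbrakk>x \<preceq> y; y \<preceq> z; x \<in> carrier G; y \<in> carrier G; z \<in> carrier G\<rbrakk> \<Longrightarrow> x \<preceq> z"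
  using ord.le_trans[of x y z] by simp

lemma ole_antisym: "\<lbrakk>x \<preceq> y; y \<preceq> x; x \<in> carrier G; y \<in> carrier G\<rbrakk> \<Longrightarrow> x = y"
  using ord.le_antisym[of x y] by simp

lemma mult_left_mono:
  "\<lbrakk>x \<preceq> y; x \<in> carrier G; y \<in> carrier G; z \<in> carrier G\<rbrakk> \<Longrightarrow> z \<otimes> x \<preceq> z \<otimes> y"
  using mult_mono[of x y z \<one>] by simp

lemma mult_right_mono:
  "\<lbrakk>x \<preceq> y; x \<in> carrier G; y \<in> carrier G; z \<in> carrier G\<rbrakk> \<Longrightarrow> x \<otimes> z \<preceq> y \<otimes> z"
  using mult_mono[of x y \<one> z] by simp

lemma mult_mono_both:
  assumes "x \<preceq> y" "u \<preceq> v" "x \<in> carrier G" "y \<in> carrier G" "u \<in> carrier G" "v \<in> carrier G"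
  shows "x \<otimes> u \<preceq> y \<otimes> v"
  using mult_right_mono[of x y u] mult_left_mono[of u v y] ole_trans assms by (meson m_closed)

lemma mult_left_le_iff:
  assumes "x \<in> carrier G" "y \<in> carrier G" "z \<in> carrier G"
  shows "z \<otimes> x \<preceq> z \<otimes> y \<longleftrightarrow> x \<preceq> y"
  using assms mult_left_mono[of "z \<otimes> x" "z \<otimes> y" "inv z"] mult_left_mono
  by (auto simp: m_assoc[symmetric])

lemma mult_right_le_iff:
  assumes "x \<in> carrier G" "y \<in> carrier G" "z \<in> carrier G"
  shows "x \<otimes> z \<preceq> y \<otimes> z \<longleftrightarrow> x \<preceq> y"
  using assms mult_right_mono[of "x \<otimes> z" "y \<otimes> z" "inv z"] mult_right_mono
  by (auto simp: m_assoc)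

lemma le_mult_inv_iff:
  assumes "x \<in> carrier G" "y \<in> carrier G"
  shows "\<one> \<preceq> y \<otimes> inv x \<longleftrightarrow> x \<preceq> y"
  using assms mult_right_le_iff[of \<one> "y \<otimes> inv x" x] by (simp add: m_assoc)

lemma inv_le_inv_iff:
  assumes "x \<in> carrier G" "y \<in> carrier G"
  shows "inv x \<preceq> inv y \<longleftrightarrow> y \<preceq> x"
  using assms mult_right_le_iff[of "inv x" "inv y" y] mult_left_le_iff[of "inv x \<otimes> y" \<one> x]
  by (simp add: m_assoc[symmetric])

lemma one_le_inv_iff:
  assumes "x \<in> carrier G" shows "\<one> \<preceq> inv x \<longleftrightarrow> x \<preceq> \<one>"
  using inv_le_inv_iff[of \<one> x] assms by simp

lemma one_le_mult:
  "\<lbrakk>\<one> \<preceq> x; \<one> \<preceq> y; x \<in> carrier G; y \<in> carrier G\<rbrakk> \<Longrightarrow> \<one> \<preceq> x \<otimes> y"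
  using mult_mono_both[of \<one> x \<one> y] by simp

lemma one_le_conj:
  assumes "\<one> \<preceq> x" "x \<in> carrier G" "g \<in> carrier G"
  shows "\<one> \<preceq> g \<otimes> x \<otimes> inv g"
  using mult_mono[of \<one> x g "inv g"] assms by simp

end

section \<open>Ordered groups from elementary order axioms\<close>

lemma po_groupI:
  fixes G (structure)
  assumes "group G"
    and "\<And>x. x \<in> carrier G \<Longrightarrow> x \<preceq> x"
    and "\<And>x y. \<lbrakk>x \<in> carrier G; y \<in> carrier G; x \<preceq> y; y \<preceq> x\<rbrakk> \<Longrightarrow> x = y"
    and "\<And>x y z. \<lbrakk>x \<in> carrier G; y \<in> carrier G; z \<in> carrier G; x \<preceq> y; y \<preceq> z\<rbrakk> \<Longrightarrow> x \<preceq> z"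
    and "\<And>a b s t. \<lbrakk>a \<in> carrier G; b \<in> carrier G; s \<in> carrier G; t \<in> carrier G; a \<preceq> b\<rbrakk>
      \<Longrightarrow> s \<otimes> a \<otimes> t \<preceq> s \<otimes> b \<otimes> t"
  shows "po_group G"
proof -
  interpret group G by fact
  have "partial_order (order_of G)"
  proof unfold_locales
    fix x y z w
    assume "x \<in> carrier (order_of G)" "y \<in> carrier (order_of G)" "z \<in> carrier (order_of G)"
      "x \<sqsubseteq>\<^bsub>order_of G\<^esub> y" "y \<sqsubseteq>\<^bsub>order_of G\<^esub> z"
    then show "x \<sqsubseteq>\<^bsub>order_of G\<^esub> z" using assms(4)[of x y z] by simp
  next
    fix x y
    assume "x \<in> carrier (order_of G)" "y \<in> carrier (order_of G)"
      "x \<sqsubseteq>\<^bsub>order_of G\<^esub> y" "y \<sqsubseteq>\<^bsub>order_of G\<^esub> x"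
    then show "x .=\<^bsub>order_of G\<^esub> y" using assms(3)[of x y] by simp
  qed (simp_all add: assms(2))
  then show ?thesis
    by (intro po_group.intro po_group_axioms.intro assms(5) is_group)
qed

lemma l_groupI:
  fixes G (structure)
  assumes "po_group G"
    and "\<And>x y. \<lbrakk>x \<in> carrier G; y \<in> carrier G\<rbrakk> \<Longrightarrow>
      \<exists>z\<in>carrier G. x \<preceq> z \<and> y \<preceq> z \<and> (\<forall>u\<in>carrier G. x \<preceq> u \<and> y \<preceq> u \<longrightarrow> z \<preceq> u)"
    and "\<And>x y. \<lbrakk>x \<in> carrier G; y \<in> carrier G\<rbrakk> \<Longrightarrow>
      \<exists>z\<in>carrier G. z \<preceq> x \<and> z \<preceq> y \<and> (\<forall>u\<in>carrier G. u \<preceq> x \<and> u \<preceq> y \<longrightarrow> u \<preceq> z)"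
  shows "l_group G"
proof -
  interpret po_group G by fact
  show ?thesis
  proof unfold_locales
    fix x y assume "x \<in> carrier (order_of G)" "y \<in> carrier (order_of G)"
    then have xy: "x \<in> carrier G" "y \<in> carrier G" by auto
    show "\<exists>s. least (order_of G) s (Upper (order_of G) {x, y})"
    proof -
      obtain z where "z \<in> carrier G" "x \<preceq> z" "y \<preceq> z"
        and "\<forall>u\<in>carrier G. x \<preceq> u \<and> y \<preceq> u \<longrightarrow> z \<preceq> u"
        using assms(2)[OF xy] by blast
      then have "least (order_of G) z (Upper (order_of G) {x, y})"
        using xy by (auto simp: least_def Upper_def)
      then show ?thesis ..
    qed
    show "\<exists>s. greatest (order_of G) s (Lower (order_of G) {x, y})"
    proof -
      obtain z where "z \<in> carrier G" "z \<preceq> x" "z \<preceq> y"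
        and "\<forall>u\<in>carrier G. u \<preceq> x \<and> u \<preceq> y \<longrightarrow> u \<preceq> z"
        using assms(3)[OF xy] by blast
      then have "greatest (order_of G) z (Lower (order_of G) {x, y})"
        using xy by (auto simp: greatest_def Lower_def)
      then show ?thesis ..
    qed
  qed
qed

lemma to_groupI:
  fixes G (structure)
  assumes "po_group G"
    and "\<And>x y. \<lbrakk>x \<in> carrier G; y \<in> carrier G\<rbrakk> \<Longrightarrow> x \<preceq> y \<or> y \<preceq> x"
  shows "to_group G"
proof -
  interpret po_group G by fact
  show ?thesis by unfold_locales (use assms(2) in auto)
qed

lemma (in to_group) ole_total: "\<lbrakk>x \<in> carrier G; y \<in> carrier G\<rbrakk> \<Longrightarrow> x \<preceq> y \<or> y \<preceq> x"
  using ord.total_order_total by simp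

lemma (in to_group) l_group: "l_group G"
proof (rule l_groupI[OF po_group_axioms])
  fix x y assume xy: "x \<in> carrier G" "y \<in> carrier G"
  show "\<exists>z\<in>carrier G. x \<preceq> z \<and> y \<preceq> z \<and> (\<forall>u\<in>carrier G. x \<preceq> u \<and> y \<preceq> u \<longrightarrow> z \<preceq> u)"
    using ole_total[OF xy] xy ole_refl by blast
  show "\<exists>z\<in>carrier G. z \<preceq> x \<and> z \<preceq> y \<and> (\<forall>u\<in>carrier G. u \<preceq> x \<and> u \<preceq> y \<longrightarrow> u \<preceq> z)"
    using ole_total[OF xy] xy ole_refl by blast
qed

section \<open>Lattice operations, negative parts and orthogonality\<close>

context l_group
begin

abbreviation lsup :: "'a \<Rightarrow> 'a \<Rightarrow> 'a" (infixl \<open>\<curlyvee>\<close> 65)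
  where "x \<curlyvee> y \<equiv> x \<squnion>\<^bsub>order_of G\<^esub> y"

abbreviation linf :: "'a \<Rightarrow> 'a \<Rightarrow> 'a" (infixl \<open>\<curlywedge>\<close> 70)
  where "x \<curlywedge> y \<equiv> x \<sqinter>\<^bsub>order_of G\<^esub> y"

lemma sup_closed: "\<lbrakk>x \<in> carrier G; y \<in> carrier G\<rbrakk> \<Longrightarrow> x \<curlyvee> y \<in> carrier G"
  using ord.join_closed[of x y] by simp

lemma inf_closed: "\<lbrakk>x \<in> carrier G; y \<in> carrier G\<rbrakk> \<Longrightarrow> x \<curlywedge> y \<in> carrier G"
  using ord.meet_closed[of x y] by simp

lemma sup_ge1: "\<lbrakk>x \<in> carrier G; y \<in> carrier G\<rbrakk> \<Longrightarrow> x \<preceq> x \<curlyvee> y"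
  using ord.join_left[of x y] by simp

lemma sup_ge2: "\<lbrakk>x \<in> carrier G; y \<in> carrier G\<rbrakk> \<Longrightarrow> y \<preceq> x \<curlyvee> y"
  using ord.join_right[of x y] by simp

lemma sup_least:
  "\<lbrakk>x \<preceq> z; y \<preceq> z; x \<in> carrier G; y \<in> carrier G; z \<in> carrier G\<rbrakk> \<Longrightarrow> x \<curlyvee> y \<preceq> z"
  using ord.join_le[of x z y] by simp

lemma inf_le1: "\<lbrakk>x \<in> carrier G; y \<in> carrier G\<rbrakk> \<Longrightarrow> x \<curlywedge> y \<preceq> x"
  using ord.meet_left[of x y] by simp

lemma inf_le2: "\<lbrakk>x \<in> carrier G; y \<in> carrier G\<rbrakk> \<Longrightarrow> x \<curlywedge> y \<preceq> y"
  using ord.meet_right[of x y] by simp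

lemma inf_greatest:
  "\<lbrakk>z \<preceq> x; z \<preceq> y; x \<in> carrier G; y \<in> carrier G; z \<in> carrier G\<rbrakk> \<Longrightarrow> z \<preceq> x \<curlywedge> y"
  using ord.meet_le[of z x y] by simp

lemma sup_eqI:
  assumes "x \<in> carrier G" "y \<in> carrier G" "z \<in> carrier G" "x \<preceq> z" "y \<preceq> z"
    and "\<And>u. \<lbrakk>u \<in> carrier G; x \<preceq> u; y \<preceq> u\<rbrakk> \<Longrightarrow> z \<preceq> u"
  shows "x \<curlyvee> y = z"
  using assms by (intro ole_antisym) (auto simp: sup_closed sup_ge1 sup_ge2 sup_least)

lemma inf_eqI:
  assumes "x \<in> carrier G" "y \<in> carrier G" "z \<in> carrier G" "z \<preceq> x" "z \<preceq> y"
    and "\<And>u. \<lbrakk>u \<in> carrier G; u \<preceq> x; u \<preceq> y\<rbrakk> \<Longrightarrow> u \<preceq> z"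
  shows "x \<curlywedge> y = z"
  using assms by (intro ole_antisym) (auto simp: inf_closed inf_le1 inf_le2 inf_greatest)

lemma sup_commute: "x \<curlyvee> y = y \<curlyvee> x"
  by (simp add: join_def insert_commute)

lemma inf_commute: "x \<curlywedge> y = y \<curlywedge> x"
  by (simp add: meet_def insert_commute)

lemma sup_absorb2: "\<lbrakk>x \<preceq> y; x \<in> carrier G; y \<in> carrier G\<rbrakk> \<Longrightarrow> x \<curlyvee> y = y"
  by (rule sup_eqI) (auto simp: ole_refl)

lemma inf_absorb1: "\<lbrakk>x \<preceq> y; x \<in> carrier G; y \<in> carrier G\<rbrakk> \<Longrightarrow> x \<curlywedge> y = x"
  by (rule inf_eqI) (auto simp: ole_refl)

lemma le_iff_inf: "\<lbrakk>x \<in> carrier G; y \<in> carrier G\<rbrakk> \<Longrightarrow> x \<preceq> y \<longleftrightarrow> x \<curlywedge> y = x"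
  using inf_absorb1 inf_le2 by metis

lemma mult_sup_distrib_left:
  assumes "x \<in> carrier G" "y \<in> carrier G" "z \<in> carrier G"
  shows "z \<otimes> (x \<curlyvee> y) = (z \<otimes> x) \<curlyvee> (z \<otimes> y)"
proof (rule sup_eqI[symmetric])
  fix u assume u: "u \<in> carrier G" "z \<otimes> x \<preceq> u" "z \<otimes> y \<preceq> u"
  have "x \<preceq> inv z \<otimes> u" "y \<preceq> inv z \<otimes> u"
    using u assms mult_left_le_iff[of _ "inv z \<otimes> u" z] by (auto simp: m_assoc[symmetric])
  then have "x \<curlyvee> y \<preceq> inv z \<otimes> u" using assms u by (simp add: sup_least)
  then show "z \<otimes> (x \<curlyvee> y) \<preceq> u"
    using u assms mult_left_le_iff[of "x \<curlyvee> y" "inv z \<otimes> u" z]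
    by (auto simp: m_assoc[symmetric] sup_closed)
qed (use assms in \<open>auto simp: sup_closed sup_ge1 sup_ge2 mult_left_le_iff\<close>)

lemma mult_sup_distrib_right:
  assumes "x \<in> carrier G" "y \<in> carrier G" "z \<in> carrier G"
  shows "(x \<curlyvee> y) \<otimes> z = (x \<otimes> z) \<curlyvee> (y \<otimes> z)"
proof (rule sup_eqI[symmetric])
  fix u assume u: "u \<in> carrier G" "x \<otimes> z \<preceq> u" "y \<otimes> z \<preceq> u"
  have "x \<preceq> u \<otimes> inv z" "y \<preceq> u \<otimes> inv z"
    using u assms mult_right_le_iff[of _ "u \<otimes> inv z" z] by (auto simp: m_assoc)
  then have "x \<curlyvee> y \<preceq> u \<otimes> inv z" using assms u by (simp add: sup_least)
  then show "(x \<curlyvee> y) \<otimes> z \<preceq> u"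
    using u assms mult_right_le_iff[of "x \<curlyvee> y" "u \<otimes> inv z" z]
    by (auto simp: m_assoc sup_closed)
qed (use assms in \<open>auto simp: sup_closed sup_ge1 sup_ge2 mult_right_le_iff\<close>)

lemma inv_sup:
  assumes "x \<in> carrier G" "y \<in> carrier G"
  shows "inv (x \<curlyvee> y) = inv x \<curlywedge> inv y"
proof (rule inf_eqI[symmetric])
  fix u assume u: "u \<in> carrier G" "u \<preceq> inv x" "u \<preceq> inv y"
  then have "x \<curlyvee> y \<preceq> inv u"
    using assms inv_le_inv_iff[of "inv u"] by (intro sup_least) auto
  then show "u \<preceq> inv (x \<curlyvee> y)"
    using assms u inv_le_inv_iff[of "inv u" "x \<curlyvee> y"] by (auto simp: sup_closed)
qed (use assms in \<open>auto simp: sup_closed sup_ge1 sup_ge2 inv_le_inv_iff\<close>)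

lemma inv_inf:
  assumes "x \<in> carrier G" "y \<in> carrier G"
  shows "inv (x \<curlywedge> y) = inv x \<curlyvee> inv y"
  using inv_sup[of "inv x" "inv y"] assms
  by (metis inf_closed inv_closed inv_inv sup_closed)

text \<open>Inversion reverses products and exchanges joins with meets, so this is the dual of
  \<open>mult_sup_distrib_right\<close>.\<close>

lemma mult_inf_distrib_left:
  assumes "x \<in> carrier G" "y \<in> carrier G" "z \<in> carrier G"
  shows "z \<otimes> (x \<curlywedge> y) = (z \<otimes> x) \<curlywedge> (z \<otimes> y)"
proof -
  have "inv (z \<otimes> (x \<curlywedge> y)) = inv ((z \<otimes> x) \<curlywedge> (z \<otimes> y))"
    using assms by (simp add: inv_mult_group inv_inf inf_closed mult_sup_distrib_right)
  then show ?thesis using assms inv_inj inf_closed by (auto dest: inj_onD)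
qed

lemma mult_inf_distrib_right:
  assumes "x \<in> carrier G" "y \<in> carrier G" "z \<in> carrier G"
  shows "(x \<curlywedge> y) \<otimes> z = (x \<otimes> z) \<curlywedge> (y \<otimes> z)"
proof -
  have "inv ((x \<curlywedge> y) \<otimes> z) = inv ((x \<otimes> z) \<curlywedge> (y \<otimes> z))"
    using assms by (simp add: inv_mult_group inv_inf inf_closed mult_sup_distrib_left)
  then show ?thesis using assms inv_inj inf_closed by (auto dest: inj_onD)
qed

text \<open>The negative part \<open>x\<^sup>-\<close>, normalised to lie above the identity.\<close>

definition npart :: "'a \<Rightarrow> 'a" where "npart x = inv x \<curlyvee> \<one>"

lemma npart_closed [simp]: "x \<in> carrier G \<Longrightarrow> npart x \<in> carrier G"
  by (simp add: npart_def sup_closed)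

lemma one_le_npart: "x \<in> carrier G \<Longrightarrow> \<one> \<preceq> npart x"
  by (simp add: npart_def sup_ge2)

lemma npart_eq_one_iff: "x \<in> carrier G \<Longrightarrow> npart x = \<one> \<longleftrightarrow> \<one> \<preceq> x"
  using sup_absorb2[of "inv x" \<one>] sup_ge1[of "inv x" \<one>] inv_le_inv_iff[of x \<one>]
  by (auto simp: npart_def)

text \<open>The identity \<open>x \<otimes> npart x = npart (inv x)\<close> makes both entries right
  multiples of \<open>npart x\<close>. The meet is therefore
  \<open>(\<one> \<curlywedge> x) \<otimes> npart x\<close>, and
  \<open>\<one> \<curlywedge> x\<close> is the inverse of \<open>npart x\<close>.\<close>

lemma npart_inv_orthogonal:
  assumes "x \<in> carrier G" shows "npart x \<curlywedge> npart (inv x) = \<one>"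
proof -
  let ?a = "npart x"
  have xa: "x \<otimes> ?a = npart (inv x)"
    using assms by (simp add: npart_def mult_sup_distrib_left sup_commute)
  have ia: "inv ?a = \<one> \<curlywedge> x"
    using assms inv_sup[of "inv x" \<one>] inf_commute[of x \<one>] by (simp add: npart_def)
  have "?a \<curlywedge> npart (inv x) = (\<one> \<otimes> ?a) \<curlywedge> (x \<otimes> ?a)"
    using assms xa by simp
  also have "\<dots> = (\<one> \<curlywedge> x) \<otimes> ?a" using assms by (simp only: mult_inf_distrib_right one_closed npart_closed)
  also have "\<dots> = \<one>" using assms ia[symmetric] by simp
  finally show ?thesis .
qed

text \<open>The factors appear in reversed order because \<open>npart\<close> is built from
  inverses. With this bound, orthogonality to \<open>npart x\<close> and to \<open>npart y\<close>
  is inherited by \<open>npart (x \<otimes> y)\<close>.\<close>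

lemma npart_mult_le:
  assumes "x \<in> carrier G" "y \<in> carrier G"
  shows "npart (x \<otimes> y) \<preceq> npart y \<otimes> npart x"
proof -
  have "inv (x \<otimes> y) \<preceq> npart y \<otimes> npart x"
    using assms by (simp add: inv_mult_group npart_def mult_mono_both sup_ge1 sup_closed)
  moreover have "\<one> \<preceq> npart y \<otimes> npart x"
    using assms by (simp add: one_le_mult one_le_npart)
  ultimately show ?thesis
    unfolding npart_def[of "x \<otimes> y"] using assms by (intro sup_least) auto
qed

lemma npart_conj:
  assumes "x \<in> carrier G" "g \<in> carrier G"
  shows "npart (g \<otimes> x \<otimes> inv g) = g \<otimes> npart x \<otimes> inv g"
  using assms
  by (simp add: npart_def mult_sup_distrib_left mult_sup_distrib_right sup_closed inv_mult_group m_assoc)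

text \<open>Since \<open>\<one> \<preceq> b\<close>, the meet lies below both
  \<open>w \<otimes> b\<close> and \<open>a \<otimes> b\<close>, hence below
  \<open>(w \<curlywedge> a) \<otimes> b = b\<close>. Being below \<open>w\<close> too, it lies
  below \<open>w \<curlywedge> b\<close>.\<close>

lemma orthogonal_mult:
  assumes "w \<curlywedge> a = \<one>" "w \<curlywedge> b = \<one>" "\<one> \<preceq> a" "\<one> \<preceq> b" "\<one> \<preceq> w"
    and c: "w \<in> carrier G" "a \<in> carrier G" "b \<in> carrier G"
  shows "w \<curlywedge> (a \<otimes> b) = \<one>"
proof -
  let ?z = "w \<curlywedge> (a \<otimes> b)"
  have z: "?z \<in> carrier G" using c by (simp add: inf_closed)
  have 1: "\<one> \<preceq> ?z" using assms by (intro inf_greatest) (auto simp: one_le_mult)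
  have "w \<preceq> w \<otimes> b" using mult_left_mono[of \<one> b w] assms by simp
  then have "?z \<preceq> w \<otimes> b" using inf_le1[of w "a \<otimes> b"] c ole_trans[of ?z w "w \<otimes> b"] z by simp
  then have "?z \<preceq> (w \<otimes> b) \<curlywedge> (a \<otimes> b)" using z c by (intro inf_greatest) (auto simp: inf_le2)
  also have "(w \<otimes> b) \<curlywedge> (a \<otimes> b) = b" using c assms mult_inf_distrib_right[of w a b] by simp
  finally have "?z \<preceq> w \<curlywedge> b" using z c by (intro inf_greatest) (auto simp: inf_le1)
  then show ?thesis using 1 assms z by (intro ole_antisym) auto
qed

lemma orthogonal_antimono:
  assumes "w \<curlywedge> a = \<one>" "w' \<preceq> w" "a' \<preceq> a" "\<one> \<preceq> w'" "\<one> \<preceq> a'"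
    and "w \<in> carrier G" "a \<in> carrier G" "w' \<in> carrier G" "a' \<in> carrier G"
  shows "w' \<curlywedge> a' = \<one>"
proof (rule ole_antisym)
  have "w' \<curlywedge> a' \<preceq> w \<curlywedge> a"
    using assms by (meson inf_closed inf_greatest inf_le1 inf_le2 ole_trans)
  then show "w' \<curlywedge> a' \<preceq> \<one>" using assms by simp
qed (use assms in \<open>auto simp: inf_greatest inf_closed\<close>)

end


section \<open>Cones of total right preorders and prime subgroups\<close>

lemma (in group) cancel_left_inv:
  assumes "x \<in> carrier G" "y \<in> carrier G"
  shows "inv x \<otimes> (x \<otimes> y) = y" "x \<otimes> (inv x \<otimes> y) = y"
  using assms by (simp_all add: m_assoc[symmetric])

definition total_cone :: "('a, 'b) ogroup_scheme \<Rightarrow> 'a set \<Rightarrow> bool" where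
  "total_cone G P \<longleftrightarrow> P \<subseteq> carrier G \<and> (\<forall>x\<in>carrier G. \<one>\<^bsub>G\<^esub> \<preceq>\<^bsub>G\<^esub> x \<longrightarrow> x \<in> P) \<and>
    (\<forall>x\<in>P. \<forall>y\<in>P. x \<otimes>\<^bsub>G\<^esub> y \<in> P) \<and> (\<forall>x\<in>carrier G. x \<in> P \<or> inv\<^bsub>G\<^esub> x \<in> P)"

definition normal_cone :: "('a, 'b) ogroup_scheme \<Rightarrow> 'a set \<Rightarrow> bool" where
  "normal_cone G P \<longleftrightarrow> (\<forall>x\<in>P. \<forall>g\<in>carrier G. g \<otimes>\<^bsub>G\<^esub> x \<otimes>\<^bsub>G\<^esub> inv\<^bsub>G\<^esub> g \<in> P)"

definition antisym_cone :: "('a, 'b) ogroup_scheme \<Rightarrow> 'a set \<Rightarrow> bool" where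
  "antisym_cone G P \<longleftrightarrow> (\<forall>x\<in>P. inv\<^bsub>G\<^esub> x \<in> P \<longrightarrow> x = \<one>\<^bsub>G\<^esub>)"

definition prime_cone :: "('a, 'b) ogroup_scheme \<Rightarrow> 'a set \<Rightarrow> bool" where
  "prime_cone G P \<longleftrightarrow> total_cone G P \<and> (\<forall>x\<in>P. \<forall>y\<in>P. x \<sqinter>\<^bsub>order_of G\<^esub> y \<in> P)"

text \<open>The class of the identity in the preorder with cone \<open>P\<close>; for a proper prime
  cone this is the corresponding prime subgroup.\<close>

definition cone_units :: "('a, 'b) ogroup_scheme \<Rightarrow> 'a set \<Rightarrow> 'a set" where
  "cone_units G P = {x \<in> P. inv\<^bsub>G\<^esub> x \<in> P}"

text \<open>For a subgroup \<open>p\<close>, an element \<open>t\<close> of \<open>p\<close> below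
  \<open>x\<close> amounts to an \<open>s\<close> in \<open>p\<close> with
  \<open>\<one> \<preceq> s \<otimes> x\<close>: the coset of \<open>x\<close> lies above that of
  the identity.\<close>

definition up_cone :: "('a, 'b) ogroup_scheme \<Rightarrow> 'a set \<Rightarrow> 'a set" where
  "up_cone G p = {x \<in> carrier G. \<exists>t\<in>p. t \<preceq>\<^bsub>G\<^esub> x}"

lemma coset_order_le:
  "c \<sqsubseteq>\<^bsub>coset_order H k\<^esub> d \<longleftrightarrow> (\<exists>x\<in>carrier H. \<exists>y\<in>carrier H.
    c = k #>\<^bsub>H\<^esub> x \<and> d = k #>\<^bsub>H\<^esub> y \<and> (\<exists>t\<in>k. x \<preceq>\<^bsub>H\<^esub> t \<otimes>\<^bsub>H\<^esub> y))"
  by (simp add: coset_order_def)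

lemma total_coneD:
  assumes "total_cone G P"
  shows "x \<in> P \<Longrightarrow> x \<in> carrier G"
    and "\<lbrakk>x \<in> carrier G; \<one>\<^bsub>G\<^esub> \<preceq>\<^bsub>G\<^esub> x\<rbrakk> \<Longrightarrow> x \<in> P"
    and "\<lbrakk>x \<in> P; y \<in> P\<rbrakk> \<Longrightarrow> x \<otimes>\<^bsub>G\<^esub> y \<in> P"
    and "x \<in> carrier G \<Longrightarrow> x \<in> P \<or> inv\<^bsub>G\<^esub> x \<in> P"
  using assms unfolding total_cone_def by blast+

lemma prime_coneD:
  assumes "prime_cone G P"
  shows "total_cone G P" and "\<lbrakk>x \<in> P; y \<in> P\<rbrakk> \<Longrightarrow> x \<sqinter>\<^bsub>order_of G\<^esub> y \<in> P"
  using assms by (auto simp: prime_cone_def)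

lemma (in po_group) total_cone_upward:
  assumes "total_cone G P" "x \<in> P" "x \<preceq> y" "y \<in> carrier G"
  shows "y \<in> P"
proof -
  note D = total_coneD[OF assms(1)]
  have x: "x \<in> carrier G" using D(1) assms(2) .
  then have "y \<otimes> inv x \<in> P" using assms le_mult_inv_iff[of x y] by (intro D(2)) auto
  then have "(y \<otimes> inv x) \<otimes> x \<in> P" using assms(2) by (rule D(3))
  then show ?thesis using x assms by (simp add: m_assoc)
qed

lemma (in po_group) total_cone_one: "total_cone G P \<Longrightarrow> \<one> \<in> P"
  using total_coneD(2)[of G P \<one>] by (simp add: ole_refl)

text \<open>The correspondence \<open>r \<mapsto> positive_cone K r\<close> between right orders and cones has inverse
  \<open>C \<mapsto> {(a, b). b a\<^sup>-\<^sup>1 \<in> C}\<close>.\<close>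

context
  fixes G :: "'a ogroup" (structure)
  assumes po_group: "po_group G"
begin

interpretation po_group G by (fact po_group)

lemma right_order_relD:
  assumes r: "right_order_rel G r"
  defines "C \<equiv> positive_cone G r"
  shows "total_cone G C" "antisym_cone G C" "C \<noteq> carrier G"
    and "\<And>a b. (a, b) \<in> r \<longleftrightarrow> a \<in> carrier G \<and> b \<in> carrier G \<and> b \<otimes> inv a \<in> C"
proof -
  have lin: "linear_order_on (carrier G) r" and
    inv_r: "\<And>a b t. \<lbrakk>t \<in> carrier G; (a, b) \<in> r\<rbrakk> \<Longrightarrow> (a \<otimes> t, b \<otimes> t) \<in> r" and
    ext: "\<And>a b. \<lbrakk>a \<in> carrier G; b \<in> carrier G; a \<preceq> b\<rbrakk> \<Longrightarrow> (a, b) \<in> r" and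
    ne: "r \<noteq> carrier G \<times> carrier G"
    using r by (auto simp: right_order_rel_def)
  have sub: "r \<subseteq> carrier G \<times> carrier G" and "refl_on (carrier G) r" and tr: "trans r" and an: "antisym r"
    and tot: "total_on (carrier G) r"
    using lin by (auto simp: linear_order_on_def partial_order_on_def preorder_on_def)
  then have re: "\<And>x. x \<in> carrier G \<Longrightarrow> (x, x) \<in> r" by (auto simp: refl_on_def)
  have cmp: "\<And>x y. \<lbrakk>x \<in> carrier G; y \<in> carrier G\<rbrakk> \<Longrightarrow> (x, y) \<in> r \<or> (y, x) \<in> r"
    using tot re by (metis total_on_def)
  show iff: "(a, b) \<in> r \<longleftrightarrow> a \<in> carrier G \<and> b \<in> carrier G \<and> b \<otimes> inv a \<in> C" for a b
  proof
    assume ab: "(a, b) \<in> r"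
    then have c: "a \<in> carrier G" "b \<in> carrier G" using sub by auto
    then show "a \<in> carrier G \<and> b \<in> carrier G \<and> b \<otimes> inv a \<in> C"
      using inv_r[OF _ ab, of "inv a"] by (simp add: C_def positive_cone_def)
  next
    assume c: "a \<in> carrier G \<and> b \<in> carrier G \<and> b \<otimes> inv a \<in> C"
    then have "(\<one>, b \<otimes> inv a) \<in> r" by (simp add: C_def positive_cone_def)
    from inv_r[OF _ this, of a] c show "(a, b) \<in> r" by (simp add: m_assoc)
  qed
  show "total_cone G C"
    unfolding total_cone_def
  proof (intro conjI ballI impI)
    show "C \<subseteq> carrier G" by (auto simp: C_def positive_cone_def)
    show "x \<in> C" if "x \<in> carrier G" "\<one> \<preceq> x" for x
      using ext[of \<one> x] that by (simp add: C_def positive_cone_def)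
    show "x \<otimes> y \<in> C" if "x \<in> C" "y \<in> C" for x y
    proof -
      have c: "x \<in> carrier G" "y \<in> carrier G" "(\<one>, x) \<in> r" "(\<one>, y) \<in> r"
        using that by (auto simp: C_def positive_cone_def)
      have "(y, x \<otimes> y) \<in> r" using inv_r[OF c(2,3)] c by simp
      then show ?thesis using tr c by (auto simp: C_def positive_cone_def dest: transD)
    qed
    show "x \<in> C \<or> inv x \<in> C" if "x \<in> carrier G" for x
      using cmp[of \<one> x] inv_r[of "inv x" x \<one>] that by (auto simp: C_def positive_cone_def)
  qed
  show anC: "antisym_cone G C"
    unfolding antisym_cone_def
  proof (intro ballI impI)
    fix x assume "x \<in> C" "inv x \<in> C"
    then have "(\<one>, x) \<in> r" "(\<one>, inv x) \<in> r" "x \<in> carrier G" by (auto simp: C_def positive_cone_def)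
    moreover then have "(x, \<one>) \<in> r" using inv_r[of x \<one> "inv x"] by simp
    ultimately show "x = \<one>" using an by (auto dest: antisymD)
  qed
  show "C \<noteq> carrier G"
  proof
    assume "C = carrier G"
    then have "r = carrier G \<times> carrier G" using iff by auto
    then show False using ne by simp
  qed
qed

lemma right_order_rel_of_cone:
  assumes C: "total_cone G C" "antisym_cone G C" "C \<noteq> carrier G"
  defines "r \<equiv> {(a, b). a \<in> carrier G \<and> b \<in> carrier G \<and> b \<otimes> inv a \<in> C}"
  shows "right_order_rel G r" "positive_cone G r = C"
proof -
  note D = total_coneD[OF C(1)]
  show pc: "positive_cone G r = C"
    using D(1) by (auto simp: positive_cone_def r_def)
  have inv_swap: "inv (b \<otimes> inv a) = a \<otimes> inv b" if "a \<in> carrier G" "b \<in> carrier G" for a b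
    using that by (simp add: inv_mult_group)
  show "right_order_rel G r"
    unfolding right_order_rel_def
  proof (intro conjI allI ballI impI)
    have "trans r"
    proof (rule transI)
      fix a b c assume "(a, b) \<in> r" "(b, c) \<in> r"
      then have c: "a \<in> carrier G" "b \<in> carrier G" "c \<in> carrier G"
        and "(c \<otimes> inv b) \<otimes> (b \<otimes> inv a) \<in> C" using D(3) by (auto simp: r_def)
      moreover have "(c \<otimes> inv b) \<otimes> (b \<otimes> inv a) = c \<otimes> inv a"
        using c by (simp add: m_assoc cancel_left_inv)
      ultimately show "(a, c) \<in> r" by (simp add: r_def)
    qed
    moreover have "antisym r"
    proof (rule antisymI)
      fix a b assume "(a, b) \<in> r" "(b, a) \<in> r"
      then have c: "a \<in> carrier G" "b \<in> carrier G" and "b \<otimes> inv a \<in> C" "inv (b \<otimes> inv a) \<in> C"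
        using inv_swap[of a b] by (auto simp: r_def)
      then have "b \<otimes> inv a = \<one>" using C(2) by (auto simp: antisym_cone_def)
      then show "a = b" using c inv_equality by fastforce
    qed
    moreover have "total_on (carrier G) r"
    proof (rule total_onI)
      fix a b assume "a \<in> carrier G" "b \<in> carrier G"
      then show "(a, b) \<in> r \<or> (b, a) \<in> r"
        using D(4)[of "b \<otimes> inv a"] inv_swap[of a b] by (auto simp: r_def)
    qed
    moreover have "refl_on (carrier G) r" "r \<subseteq> carrier G \<times> carrier G"
      using total_cone_one[OF C(1)] by (auto simp: refl_on_def r_def)
    ultimately show "linear_order_on (carrier G) r"
      by (simp add: linear_order_on_def partial_order_on_def preorder_on_def)
    show "(a \<otimes> t, b \<otimes> t) \<in> r" if "t \<in> carrier G" "(a, b) \<in> r" for a b t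
    proof -
      have c: "a \<in> carrier G" "b \<in> carrier G" "b \<otimes> inv a \<in> C" using that by (auto simp: r_def)
      have "(b \<otimes> t) \<otimes> inv (a \<otimes> t) = b \<otimes> inv a"
        using c that by (simp add: inv_mult_group m_assoc cancel_left_inv)
      then show ?thesis using c that by (simp add: r_def)
    qed
    show "(a, b) \<in> r" if "a \<in> carrier G" "b \<in> carrier G" "a \<preceq> b" for a b
      using that D(2)[of "b \<otimes> inv a"] by (simp add: le_mult_inv_iff r_def)
    show "r \<noteq> carrier G \<times> carrier G"
    proof
      assume "r = carrier G \<times> carrier G"
      then have "positive_cone G r = carrier G" by (auto simp: positive_cone_def)
      then show False using pc C(3) by simp
    qed
  qed
qed

lemma mem_right_orders_iff:
  "C \<in> right_orders G \<longleftrightarrow> total_cone G C \<and> antisym_cone G C \<and> C \<noteq> carrier G"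
proof
  assume "C \<in> right_orders G"
  then obtain r where "C = positive_cone G r" "right_order_rel G r" by (auto simp: right_orders_def)
  then show "total_cone G C \<and> antisym_cone G C \<and> C \<noteq> carrier G"
    using right_order_relD(1-3)[of r] by simp
next
  assume "total_cone G C \<and> antisym_cone G C \<and> C \<noteq> carrier G"
  then have c: "total_cone G C" "antisym_cone G C" "C \<noteq> carrier G" by auto
  show "C \<in> right_orders G"
    unfolding right_orders_def
    using right_order_rel_of_cone(1)[OF c] right_order_rel_of_cone(2)[OF c] by (intro CollectI exI conjI) auto
qed

text \<open>Left translation by \<open>g\<close> sends the pair of \<open>\<one>\<close> and
  \<open>x\<close> to that of \<open>g\<close> and \<open>g \<otimes> x\<close>, which right
  invariance reads as membership of \<open>g \<otimes> x \<otimes> inv g\<close> in the cone. Thus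
  left invariance becomes normality.\<close>

lemma mem_orders_iff:
  "C \<in> orders G \<longleftrightarrow> C \<in> right_orders G \<and> normal_cone G C"
proof
  assume "C \<in> orders G"
  then obtain r where C: "C = positive_cone G r" and r: "right_order_rel G r" and
    l: "\<And>a b s. \<lbrakk>s \<in> carrier G; (a, b) \<in> r\<rbrakk> \<Longrightarrow> (s \<otimes> a, s \<otimes> b) \<in> r"
    by (auto simp: orders_def order_rel_def)
  have "normal_cone G C"
    unfolding normal_cone_def
  proof (intro ballI)
    fix x g assume xg: "x \<in> C" "g \<in> carrier G"
    then have "(\<one>, x) \<in> r" "x \<in> carrier G" by (auto simp: C positive_cone_def)
    then have "(g, g \<otimes> x) \<in> r" using l[of g \<one> x] xg by simp
    then show "g \<otimes> x \<otimes> inv g \<in> C" using right_order_relD(4)[OF r] C by simp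
  qed
  then show "C \<in> right_orders G \<and> normal_cone G C" using C r by (auto simp: right_orders_def)
next
  assume C: "C \<in> right_orders G \<and> normal_cone G C"
  then have c: "total_cone G C" "antisym_cone G C" "C \<noteq> carrier G" by (auto simp: mem_right_orders_iff)
  let ?r = "{(a, b). a \<in> carrier G \<and> b \<in> carrier G \<and> b \<otimes> inv a \<in> C}"
  have "order_rel G ?r"
    unfolding order_rel_def
  proof (intro conjI allI ballI impI right_order_rel_of_cone(1)[OF c])
    fix a b s assume s: "s \<in> carrier G" and "(a, b) \<in> ?r"
    then have ab: "a \<in> carrier G" "b \<in> carrier G" "s \<otimes> (b \<otimes> inv a) \<otimes> inv s \<in> C"
      using C by (auto simp: normal_cone_def)
    moreover have "s \<otimes> (b \<otimes> inv a) \<otimes> inv s = (s \<otimes> b) \<otimes> inv (s \<otimes> a)"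
      using ab s by (simp add: inv_mult_group m_assoc)
    ultimately show "(s \<otimes> a, s \<otimes> b) \<in> ?r" using s by simp
  qed
  then show "C \<in> orders G"
    unfolding orders_def using right_order_rel_of_cone(2)[OF c] by blast
qed

end

section \<open>Prime subgroups and proper prime cones\<close>

context
  fixes G :: "'a ogroup" (structure)
  assumes l_group: "l_group G"
begin

interpretation l_group G by (fact l_group)

text \<open>One half of the correspondence between \<open>Spec G\<close> and proper prime cones.
  Totality comes from comparing the cosets of \<open>x\<close> and \<open>\<one>\<close>, closure
  under meets from \<open>p\<close> being a sublattice. Convexity recovers \<open>p\<close>: a unit
  \<open>x\<close> lies between \<open>s\<close> and \<open>inv t\<close> for some \<open>s\<close>,
  \<open>t\<close> in \<open>p\<close>.\<close>

lemma prime_cone_up_cone: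
  assumes p: "p \<in> Spec G"
  shows "prime_cone G (up_cone G p)" "cone_units G (up_cone G p) = p" "up_cone G p \<noteq> carrier G"
proof -
  have sg: "subgroup p G" and lat: "\<And>x y. \<lbrakk>x \<in> p; y \<in> p\<rbrakk> \<Longrightarrow> x \<curlywedge> y \<in> p"
    and cvx: "\<And>x y z. \<lbrakk>x \<in> p; y \<in> p; z \<in> carrier G; x \<preceq> z; z \<preceq> y\<rbrakk> \<Longrightarrow> z \<in> p"
    and ne: "p \<noteq> carrier G" and tot: "total_order (coset_order G p)"
    using p unfolding Spec_def convex_l_subgroup_def by blast+
  interpret p: subgroup p G by fact
  have pc: "x \<in> carrier G" if "x \<in> p" for x using that p.subset by blast
  have total: "x \<in> up_cone G p \<or> inv x \<in> up_cone G p" if x: "x \<in> carrier G" for x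
  proof -
    have one: "p #> \<one> = p" using coset_mult_one p.subset by simp
    \<comment> \<open>The coset order is witnessed by some pair of representatives; here the witness
      is moved to the prescribed pair \<open>u\<close>, \<open>v\<close>.\<close>
    have le_cases: "(\<exists>t\<in>p. u \<preceq> t \<otimes> v)"
      if le: "p #> u \<sqsubseteq>\<^bsub>coset_order G p\<^esub> p #> v" and uv: "u \<in> carrier G" "v \<in> carrier G" for u v
    proof -
      obtain u' v' t where u': "u' \<in> carrier G" "p #> u = p #> u'" and v': "v' \<in> carrier G" "p #> v = p #> v'"
        and t: "t \<in> p" "u' \<preceq> t \<otimes> v'"
        using le unfolding coset_order_le by blast
      have "u \<in> p #> u'" "v' \<in> p #> v" using u' v' uv rcos_self[OF _ sg] by auto
      then obtain a b where a: "a \<in> p" "u = a \<otimes> u'" and b: "b \<in> p" "v' = b \<otimes> v"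
        by (auto simp: r_coset_def)
      have "u \<preceq> a \<otimes> (t \<otimes> v')" using a t u' v' pc by (simp add: local.mult_left_mono)
      also have "a \<otimes> (t \<otimes> v') = (a \<otimes> t \<otimes> b) \<otimes> v" using a b t uv pc by (simp add: m_assoc)
      finally show ?thesis using a b t by blast
    qed
    have "p #> x \<in> carrier (coset_order G p)" "p #> \<one> \<in> carrier (coset_order G p)"
      using x by (auto simp: coset_order_def RCOSETS_def)
    then have "p #> x \<sqsubseteq>\<^bsub>coset_order G p\<^esub> p #> \<one> \<or> p #> \<one> \<sqsubseteq>\<^bsub>coset_order G p\<^esub> p #> x"
      using total_order.total_order_total[OF tot] by blast
    then have "(\<exists>t\<in>p. x \<preceq> t \<otimes> \<one>) \<or> (\<exists>t\<in>p. \<one> \<preceq> t \<otimes> x)"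
      using le_cases[of x \<one>] le_cases[of \<one> x] x by blast
    then consider t where "t \<in> p" "x \<preceq> t" | t where "t \<in> p" "\<one> \<preceq> t \<otimes> x"
      using pc by auto
    then show ?thesis
    proof cases
      case 1
      then have "inv t \<preceq> inv x" using x pc inv_le_inv_iff[of t x] by auto
      then show ?thesis using 1 x p.m_inv_closed by (auto simp: up_cone_def)
    next
      case 2
      then have "inv t \<preceq> x" using x pc mult_left_le_iff[of "inv t" x t] by auto
      then show ?thesis using 2 x p.m_inv_closed by (auto simp: up_cone_def)
    qed
  qed
  show "prime_cone G (up_cone G p)"
    unfolding prime_cone_def total_cone_def
  proof (intro conjI ballI impI)
    show "up_cone G p \<subseteq> carrier G" by (auto simp: up_cone_def)
    show "x \<in> up_cone G p" if "x \<in> carrier G" "\<one> \<preceq> x" for x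
      using that p.one_closed by (auto simp: up_cone_def)
    show "x \<in> up_cone G p \<or> inv x \<in> up_cone G p" if "x \<in> carrier G" for x using total[OF that] .
    fix x y assume "x \<in> up_cone G p" "y \<in> up_cone G p"
    then obtain s t where s: "s \<in> p" "s \<preceq> x" "x \<in> carrier G" and t: "t \<in> p" "t \<preceq> y" "y \<in> carrier G"
      by (auto simp: up_cone_def)
    have "s \<otimes> t \<preceq> x \<otimes> y" using s t pc by (simp add: mult_mono_both)
    then show "x \<otimes> y \<in> up_cone G p" using s t p.m_closed by (auto simp: up_cone_def)
    have "s \<curlywedge> t \<preceq> x \<curlywedge> y" using s t pc
      by (meson inf_closed inf_greatest inf_le1 inf_le2 ole_trans)
    then show "x \<curlywedge> y \<in> up_cone G p" using s t lat by (auto simp: up_cone_def inf_closed)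
  qed
  show units: "cone_units G (up_cone G p) = p"
  proof
    show "cone_units G (up_cone G p) \<subseteq> p"
    proof
      fix x assume "x \<in> cone_units G (up_cone G p)"
      then obtain s t where st: "x \<in> carrier G" "s \<in> p" "s \<preceq> x" "t \<in> p" "t \<preceq> inv x"
        by (auto simp: cone_units_def up_cone_def)
      then have "x \<preceq> inv t" using pc inv_le_inv_iff[of "inv x" t] by auto
      then show "x \<in> p" using cvx[of s "inv t" x] st p.m_inv_closed by blast
    qed
    show "p \<subseteq> cone_units G (up_cone G p)"
    proof
      fix x assume x: "x \<in> p"
      then have "inv x \<in> p" by (rule p.m_inv_closed)
      with x show "x \<in> cone_units G (up_cone G p)"
        using pc ole_refl[of x] ole_refl[of "inv x"] unfolding cone_units_def up_cone_def by blast
    qed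
  qed
  show "up_cone G p \<noteq> carrier G"
    using units ne by (auto simp: cone_units_def)
qed

text \<open>The other half of the correspondence. By \<open>le_iff\<close>, the order of the right
  cosets is the preorder of \<open>P\<close>, from which the axioms of a total order are read
  off.\<close>

lemma cone_units_Spec:
  assumes P: "prime_cone G P" "P \<noteq> carrier G"
  shows "cone_units G P \<in> Spec G" "up_cone G (cone_units G P) = P"
proof -
  let ?p = "cone_units G P"
  note T = prime_coneD(1)[OF P(1)] and m = prime_coneD(2)[OF P(1)]
  note D = total_coneD[OF T]
  note up = total_cone_upward[OF T]
  have pD: "x \<in> ?p \<Longrightarrow> x \<in> carrier G \<and> x \<in> P \<and> inv x \<in> P" for x
    using D(1) by (auto simp: cone_units_def)
  have sg: "subgroup ?p G"
  proof
    show "?p \<subseteq> carrier G" using pD by blast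
    show "\<one> \<in> ?p" using total_cone_one[OF T] by (simp add: cone_units_def)
    show "x \<otimes> y \<in> ?p" if "x \<in> ?p" "y \<in> ?p" for x y
      using pD[OF that(1)] pD[OF that(2)] D(3) by (simp add: cone_units_def inv_mult_group)
    show "inv x \<in> ?p" if "x \<in> ?p" for x
      using pD[OF that] by (simp add: cone_units_def)
  qed
  interpret p: subgroup ?p G by fact
  have conv: "convex_l_subgroup ?p G"
    unfolding convex_l_subgroup_def
  proof (intro conjI ballI impI sg)
    fix x y assume x: "x \<in> ?p" and y: "y \<in> ?p"
    note c = pD[OF x] pD[OF y]
    have "x \<curlyvee> y \<in> P" "inv (x \<curlywedge> y) \<in> P"
      using c up[of x "x \<curlyvee> y"] up[of "inv x" "inv (x \<curlywedge> y)"]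
      by (auto simp: inv_inf sup_ge1 sup_closed)
    then show "x \<curlyvee> y \<in> ?p" "x \<curlywedge> y \<in> ?p"
      using c m by (auto simp: cone_units_def inv_sup)
    fix z assume z: "z \<in> carrier G" "x \<preceq> z \<and> z \<preceq> y"
    then have "inv y \<preceq> inv z" using c inv_le_inv_iff[of y z] by simp
    then have "inv z \<in> P" using c z up[of "inv y" "inv z"] by simp
    moreover have "z \<in> P" using c z up[of x z] by simp
    ultimately show "z \<in> ?p" by (simp add: cone_units_def)
  qed
  let ?L = "coset_order G ?p"
  have le_iff: "?p #> x \<sqsubseteq>\<^bsub>?L\<^esub> ?p #> y \<longleftrightarrow> y \<otimes> inv x \<in> P"
    if xy: "x \<in> carrier G" "y \<in> carrier G" for x y
  proof
    assume "?p #> x \<sqsubseteq>\<^bsub>?L\<^esub> ?p #> y"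
    then obtain x' y' t where x': "x' \<in> carrier G" "?p #> x = ?p #> x'"
      and y': "y' \<in> carrier G" "?p #> y = ?p #> y'" and t: "t \<in> ?p" "x' \<preceq> t \<otimes> y'"
      unfolding coset_order_le by (elim bexE conjE) blast
    have "x' \<in> ?p #> x" "y \<in> ?p #> y'" using x' y' xy rcos_self[OF _ sg] by auto
    then obtain a b where a: "a \<in> ?p" "x' = a \<otimes> x" and b: "b \<in> ?p" "y = b \<otimes> y'"
      by (auto simp: r_coset_def)
    have c: "a \<in> carrier G" "b \<in> carrier G" "t \<in> carrier G" using a b t pD by auto
    have "\<one> \<preceq> (t \<otimes> y') \<otimes> inv (a \<otimes> x)" using t a c xy y' le_mult_inv_iff[of "a \<otimes> x" "t \<otimes> y'"] by simp
    then have "(t \<otimes> y') \<otimes> inv (a \<otimes> x) \<in> P" using c xy y' D(2) by simp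
    then have "(b \<otimes> inv t) \<otimes> ((t \<otimes> y') \<otimes> inv (a \<otimes> x)) \<otimes> a \<in> P"
      using D(3) pD[OF a(1)] pD[OF b(1)] pD[OF t(1)] by simp
    also have "(b \<otimes> inv t) \<otimes> ((t \<otimes> y') \<otimes> inv (a \<otimes> x)) \<otimes> a = y \<otimes> inv x"
      using b c xy y' by (simp add: inv_mult_group m_assoc cancel_left_inv)
    finally show "y \<otimes> inv x \<in> P" .
  next
    assume yx: "y \<otimes> inv x \<in> P"
    \<comment> \<open>Any \<open>t\<close> above \<open>x \<otimes> inv y\<close> gives
      \<open>x \<preceq> t \<otimes> y\<close>. The join with \<open>\<one>\<close> puts
      \<open>t\<close> into \<open>P\<close>; its inverse is
      \<open>(y \<otimes> inv x) \<curlywedge> \<one>\<close>, which is in \<open>P\<close> because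
      prime cones are closed under meets.\<close>
    let ?t = "(x \<otimes> inv y) \<curlyvee> \<one>"
    have "?t \<in> P" using xy D(2) by (simp add: sup_closed sup_ge2)
    moreover have "inv ?t \<in> P"
      using xy yx m[of "y \<otimes> inv x" \<one>] total_cone_one[OF T] by (simp add: inv_sup inv_mult_group)
    ultimately have t: "?t \<in> ?p" by (simp add: cone_units_def)
    have "x \<preceq> ?t \<otimes> y"
      using local.mult_right_mono[OF sup_ge1[of "x \<otimes> inv y" \<one>], of y] xy
      by (simp add: m_assoc sup_closed)
    then show "?p #> x \<sqsubseteq>\<^bsub>?L\<^esub> ?p #> y"
      using xy t unfolding coset_order_le by blast
  qed
  have car: "c \<in> carrier ?L \<longleftrightarrow> (\<exists>x\<in>carrier G. c = ?p #> x)" for c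
    by (auto simp: coset_order_def RCOSETS_def)
  have total_order: "total_order ?L"
  proof unfold_locales
    show "x .=\<^bsub>?L\<^esub> x" for x by (simp add: coset_order_def)
    show "y .=\<^bsub>?L\<^esub> x" if "x .=\<^bsub>?L\<^esub> y" for x y using that by (simp add: coset_order_def)
    show "x .=\<^bsub>?L\<^esub> z" if "x .=\<^bsub>?L\<^esub> y" "y .=\<^bsub>?L\<^esub> z" for x y z
      using that by (simp add: coset_order_def)
    show "(.=\<^bsub>?L\<^esub>) = (=)" by (simp add: coset_order_def)
    show "x \<sqsubseteq>\<^bsub>?L\<^esub> z \<longleftrightarrow> y \<sqsubseteq>\<^bsub>?L\<^esub> w" if "x .=\<^bsub>?L\<^esub> y" "z .=\<^bsub>?L\<^esub> w" for x y z w
      using that by (simp add: coset_order_def)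
    fix c assume "c \<in> carrier ?L"
    then obtain x where x: "x \<in> carrier G" "c = ?p #> x" using car by blast
    then show "c \<sqsubseteq>\<^bsub>?L\<^esub> c" using le_iff[of x x] total_cone_one[OF T] by simp
    fix d assume "d \<in> carrier ?L"
    then obtain y where y: "y \<in> carrier G" "d = ?p #> y" using car by blast
    have inv_yx: "inv (y \<otimes> inv x) = x \<otimes> inv y" using x y by (simp add: inv_mult_group)
    show "c \<sqsubseteq>\<^bsub>?L\<^esub> d \<or> d \<sqsubseteq>\<^bsub>?L\<^esub> c"
      using x y le_iff[of x y] le_iff[of y x] D(4)[of "y \<otimes> inv x"] inv_yx by auto
    show "c .=\<^bsub>?L\<^esub> d" if "c \<sqsubseteq>\<^bsub>?L\<^esub> d" "d \<sqsubseteq>\<^bsub>?L\<^esub> c"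
    proof -
      have "y \<otimes> inv x \<in> ?p"
        using that x y le_iff[of x y] le_iff[of y x] inv_yx by (simp add: cone_units_def)
      then have "y \<in> ?p #> x"
        using x y by (auto simp: r_coset_def m_assoc intro!: bexI[of _ "y \<otimes> inv x"])
      then have "?p #> x = ?p #> y" using repr_independence x sg by blast
      then show ?thesis using x y by (simp add: coset_order_def)
    qed
    fix e assume "e \<in> carrier ?L"
    then obtain z where z: "z \<in> carrier G" "e = ?p #> z" using car by blast
    show "c \<sqsubseteq>\<^bsub>?L\<^esub> e" if "c \<sqsubseteq>\<^bsub>?L\<^esub> d" "d \<sqsubseteq>\<^bsub>?L\<^esub> e"
    proof -
      have "(z \<otimes> inv y) \<otimes> (y \<otimes> inv x) \<in> P"
        using that x y z le_iff[of x y] le_iff[of y z] D(3) by simp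
      also have "(z \<otimes> inv y) \<otimes> (y \<otimes> inv x) = z \<otimes> inv x"
        using x y z by (simp add: m_assoc cancel_left_inv)
      finally show ?thesis using x z le_iff by simp
    qed
  qed
  have "?p \<noteq> carrier G"
    using P(2) D(1) by (auto simp: cone_units_def)
  then show "?p \<in> Spec G" using conv total_order by (simp add: Spec_def)
  show "up_cone G ?p = P"
  proof
    show "up_cone G ?p \<subseteq> P" using up pD by (auto simp: up_cone_def)
    show "P \<subseteq> up_cone G ?p"
    proof
      fix x assume x: "x \<in> P"
      \<comment> \<open>The required unit below \<open>x\<close> is its meet with the identity: the
        inverse of that meet is positive.\<close>
      then have "x \<curlywedge> \<one> \<in> P" "x \<in> carrier G" using m total_cone_one[OF T] D(1) by auto
      moreover then have "inv (x \<curlywedge> \<one>) \<in> P" using D(2) by (simp add: inv_inf sup_closed sup_ge2)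
      ultimately show "x \<in> up_cone G ?p"
        using inf_le1[of x \<one>] by (auto simp: up_cone_def cone_units_def)
    qed
  qed
qed

lemma up_cone_mono: "p \<subseteq> q \<Longrightarrow> up_cone G p \<subseteq> up_cone G q"
  by (auto simp: up_cone_def)

lemma cone_units_mono: "P \<subseteq> Q \<Longrightarrow> cone_units G P \<subseteq> cone_units G Q"
  by (auto simp: cone_units_def)

end


section \<open>Antisymmetric cones inside prime cones\<close>

text \<open>Equivalently, polars are normal subgroups. Conjugating one of two orthogonal elements is
  exactly what happens when the cone of an ultrafilter is tested for normality.\<close>

definition conj_orthogonal :: "('a, 'b) ogroup_scheme \<Rightarrow> bool" where
  "conj_orthogonal G \<longleftrightarrow> (\<forall>x\<in>carrier G. \<forall>y\<in>carrier G. \<forall>g\<in>carrier G.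
    \<one>\<^bsub>G\<^esub> \<preceq>\<^bsub>G\<^esub> x \<longrightarrow> \<one>\<^bsub>G\<^esub> \<preceq>\<^bsub>G\<^esub> y \<longrightarrow> x \<sqinter>\<^bsub>order_of G\<^esub> y = \<one>\<^bsub>G\<^esub> \<longrightarrow>
    (g \<otimes>\<^bsub>G\<^esub> x \<otimes>\<^bsub>G\<^esub> inv\<^bsub>G\<^esub> g) \<sqinter>\<^bsub>order_of G\<^esub> y = \<one>\<^bsub>G\<^esub>)"

section \<open>Ultrafilters of positive elements and the cones they define\<close>

context l_group
begin

text \<open>A base of a proper filter in the positive cone. Upward closure is not imposed, so a
  single positive element other than \<open>\<one>\<close> already provides an example.\<close>

definition meet_filter :: "'a set \<Rightarrow> bool" where
  "meet_filter U \<longleftrightarrow> U \<noteq> {} \<and> U \<subseteq> {x \<in> carrier G. \<one> \<preceq> x} \<and> \<one> \<notin> U \<and> (\<forall>x\<in>U. \<forall>y\<in>U. x \<curlywedge> y \<in> U)"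

text \<open>Maximality is expressed through orthogonal witnesses because orthogonality, unlike mere
  non-membership, can be carried over to products and conjugates.\<close>

definition ultra_meet_filter :: "'a set \<Rightarrow> bool" where
  "ultra_meet_filter U \<longleftrightarrow> meet_filter U \<and>
    (\<forall>y\<in>carrier G. \<one> \<preceq> y \<longrightarrow> y \<notin> U \<longrightarrow> (\<exists>u\<in>U. u \<curlywedge> y = \<one>))"

text \<open>\<open>W\<close> is the filter generated by \<open>U\<close> and \<open>y\<close>. It is
  proper because no member of \<open>U\<close> is orthogonal to \<open>y\<close>, so a maximal
  \<open>U\<close> must contain \<open>y\<close> or an element orthogonal to it.\<close>

lemma meet_filter_extend:
  assumes U: "meet_filter U" and y: "y \<in> carrier G" "\<one> \<preceq> y" and no: "\<And>u. u \<in> U \<Longrightarrow> u \<curlywedge> y \<noteq> \<one>"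
  defines "W \<equiv> {z \<in> carrier G. \<one> \<preceq> z \<and> (\<exists>u\<in>U. u \<curlywedge> y \<preceq> z)}"
  shows "meet_filter W" "U \<subseteq> W" "y \<in> W"
proof -
  have Uc: "\<And>u. u \<in> U \<Longrightarrow> u \<in> carrier G \<and> \<one> \<preceq> u" and Um: "\<And>u v. \<lbrakk>u \<in> U; v \<in> U\<rbrakk> \<Longrightarrow> u \<curlywedge> v \<in> U"
    and ne: "U \<noteq> {}"
    using U unfolding meet_filter_def by blast+
  show UW: "U \<subseteq> W"
  proof
    fix u assume u: "u \<in> U"
    then show "u \<in> W" using Uc[OF u] inf_le1[of u y] y unfolding W_def by blast
  qed
  obtain u0 where "u0 \<in> U" using ne by blast
  then show yW: "y \<in> W" using Uc[of u0] inf_le2[of u0 y] y unfolding W_def by blast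
  show "meet_filter W"
    unfolding meet_filter_def
  proof (intro conjI ballI notI)
    show "W = {} \<Longrightarrow> False" using yW by blast
    show "W \<subseteq> {x \<in> carrier G. \<one> \<preceq> x}" unfolding W_def by blast
    assume "\<one> \<in> W"
    then obtain u where u: "u \<in> U" "u \<curlywedge> y \<preceq> \<one>" unfolding W_def by blast
    have "\<one> \<preceq> u \<curlywedge> y" using Uc[OF u(1)] y by (simp add: inf_greatest)
    then have "u \<curlywedge> y = \<one>" using u Uc[OF u(1)] y by (intro ole_antisym) (auto simp: inf_closed)
    then show False using no u by blast
  next
    fix a b assume "a \<in> W" "b \<in> W"
    then obtain u v where u: "u \<in> U" "u \<curlywedge> y \<preceq> a" and v: "v \<in> U" "v \<curlywedge> y \<preceq> b"
      and ab: "a \<in> carrier G" "b \<in> carrier G" "\<one> \<preceq> a" "\<one> \<preceq> b"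
      unfolding W_def by blast
    note c = Uc[OF u(1)] Uc[OF v(1)]
    let ?w = "u \<curlywedge> v"
    have w: "?w \<in> carrier G" using c by (simp add: inf_closed)
    have "?w \<curlywedge> y \<preceq> ?w" "?w \<curlywedge> y \<preceq> y" using w y by (simp_all add: inf_le1 inf_le2)
    then have "?w \<curlywedge> y \<preceq> u" "?w \<curlywedge> y \<preceq> v" "?w \<curlywedge> y \<preceq> y"
      using w y c inf_le1[of u v] inf_le2[of u v] ole_trans[of "?w \<curlywedge> y" ?w] by (auto simp: inf_closed)
    then have "?w \<curlywedge> y \<preceq> u \<curlywedge> y" "?w \<curlywedge> y \<preceq> v \<curlywedge> y"
      using w y c by (simp_all add: inf_greatest inf_closed)
    then have "?w \<curlywedge> y \<preceq> a" "?w \<curlywedge> y \<preceq> b"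
      using u v ab c w y ole_trans[of "?w \<curlywedge> y" "u \<curlywedge> y" a] ole_trans[of "?w \<curlywedge> y" "v \<curlywedge> y" b]
      by (simp_all add: inf_closed)
    then have "?w \<curlywedge> y \<preceq> a \<curlywedge> b" using ab w y by (simp add: inf_greatest inf_closed)
    moreover have "\<one> \<preceq> a \<curlywedge> b" "a \<curlywedge> b \<in> carrier G" using ab by (simp_all add: inf_greatest inf_closed)
    ultimately show "a \<curlywedge> b \<in> W" using Um[OF u(1) v(1)] unfolding W_def by blast
  qed
qed

lemma ultra_meet_filter_exists:
  assumes A: "meet_filter A"
  shows "\<exists>U. ultra_meet_filter U \<and> A \<subseteq> U"
proof -
  let ?S = "{U. meet_filter U \<and> A \<subseteq> U}"
  have "\<exists>M\<in>?S. \<forall>X\<in>?S. M \<subseteq> X \<longrightarrow> X = M"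
  proof (rule subset_Zorn_nonempty)
    show "?S \<noteq> {}" using A by blast
    fix \<C> assume ne: "\<C> \<noteq> {}" and ch: "subset.chain ?S \<C>"
    have f: "\<And>U. U \<in> \<C> \<Longrightarrow> meet_filter U \<and> A \<subseteq> U" using ch unfolding subset.chain_def by blast
    have c: "\<And>U V. \<lbrakk>U \<in> \<C>; V \<in> \<C>\<rbrakk> \<Longrightarrow> U \<subseteq> V \<or> V \<subseteq> U" using ch unfolding subset.chain_def by blast
    have "meet_filter (\<Union>\<C>)"
      unfolding meet_filter_def
    proof (intro conjI ballI)
      show "\<Union>\<C> \<noteq> {}" using ne f A unfolding meet_filter_def by blast
      show "\<Union>\<C> \<subseteq> {x \<in> carrier G. \<one> \<preceq> x}" using f unfolding meet_filter_def by blast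
      show "\<one> \<notin> \<Union>\<C>" using f unfolding meet_filter_def by blast
      fix x y assume "x \<in> \<Union>\<C>" "y \<in> \<Union>\<C>"
      then obtain U where "U \<in> \<C>" "x \<in> U" "y \<in> U" using c by blast
      then show "x \<curlywedge> y \<in> \<Union>\<C>" using f[of U] unfolding meet_filter_def by blast
    qed
    then show "\<Union>\<C> \<in> ?S" using f ne by blast
  qed
  then obtain M where "M \<in> ?S" and max: "\<forall>X\<in>?S. M \<subseteq> X \<longrightarrow> X = M" ..
  then have M: "meet_filter M" "A \<subseteq> M" by simp_all
  have "\<exists>u\<in>M. u \<curlywedge> y = \<one>" if y: "y \<in> carrier G" "\<one> \<preceq> y" "y \<notin> M" for y
  proof (rule ccontr)
    assume "\<not> (\<exists>u\<in>M. u \<curlywedge> y = \<one>)"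
    then have no: "\<And>u. u \<in> M \<Longrightarrow> u \<curlywedge> y \<noteq> \<one>" by blast
    let ?W = "{z \<in> carrier G. \<one> \<preceq> z \<and> (\<exists>u\<in>M. u \<curlywedge> y \<preceq> z)}"
    have W: "meet_filter ?W" "M \<subseteq> ?W" "y \<in> ?W"
      using meet_filter_extend[OF M(1) y(1,2)] no by simp_all
    then have "?W = M" using max M(2) by simp
    then show False using W(3) y(3) by simp
  qed
  then show ?thesis using M unfolding ultra_meet_filter_def by blast
qed

text \<open>Totality holds because \<open>npart x\<close> and \<open>npart (inv x)\<close> are
  orthogonal, so \<open>U\<close> contains at most one of them. For products, the meet of two
  witnesses is orthogonal to \<open>npart y \<otimes> npart x\<close>, which dominates
  \<open>npart (x \<otimes> y)\<close>. For conjugates, \<open>npart\<close> commutes with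
  conjugation and the same witness serves.\<close>

lemma total_cone_of_ultra:
  assumes U: "ultra_meet_filter U"
  defines "Q \<equiv> {x \<in> carrier G. npart x \<notin> U}"
  shows "total_cone G Q" "conj_orthogonal G \<Longrightarrow> normal_cone G Q"
proof -
  have Uc: "\<And>u. u \<in> U \<Longrightarrow> u \<in> carrier G \<and> \<one> \<preceq> u" and Um: "\<And>u v. \<lbrakk>u \<in> U; v \<in> U\<rbrakk> \<Longrightarrow> u \<curlywedge> v \<in> U"
    and U1: "\<one> \<notin> U" and max: "\<And>y. \<lbrakk>y \<in> carrier G; \<one> \<preceq> y; y \<notin> U\<rbrakk> \<Longrightarrow> \<exists>u\<in>U. u \<curlywedge> y = \<one>"
    using U unfolding ultra_meet_filter_def meet_filter_def by blast+
  have wit: "\<exists>u\<in>U. u \<curlywedge> npart x = \<one>" if "x \<in> Q" for x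
    using that max[of "npart x"] one_le_npart[of x] by (simp add: Q_def)
  have notU: "y \<notin> U" if "u \<in> U" "u \<curlywedge> y = \<one>" for u y
    using that Um[of u y] U1 by auto
  show "total_cone G Q"
    unfolding total_cone_def
  proof (intro conjI ballI impI)
    show "Q \<subseteq> carrier G" by (auto simp: Q_def)
    show "x \<in> Q" if "x \<in> carrier G" "\<one> \<preceq> x" for x
      using that U1 npart_eq_one_iff[of x] by (simp add: Q_def)
    show "x \<in> Q \<or> inv x \<in> Q" if "x \<in> carrier G" for x
      using that npart_inv_orthogonal[of x] notU by (auto simp: Q_def)
    fix x y assume x: "x \<in> Q" and y: "y \<in> Q"
    obtain u v where u: "u \<in> U" "u \<curlywedge> npart x = \<one>" and v: "v \<in> U" "v \<curlywedge> npart y = \<one>"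
      using wit[OF x] wit[OF y] by blast
    have c: "x \<in> carrier G" "y \<in> carrier G" using x y by (auto simp: Q_def)
    note uv = Uc[OF u(1)] Uc[OF v(1)]
    let ?w = "u \<curlywedge> v"
    have w: "?w \<in> U" using Um u v by blast
    note wc = Uc[OF w]
    have "?w \<curlywedge> npart x = \<one>"
      by (rule orthogonal_antimono[OF u(2)]) (use uv wc c in \<open>simp_all add: inf_le1 ole_refl one_le_npart\<close>)
    moreover have "?w \<curlywedge> npart y = \<one>"
      by (rule orthogonal_antimono[OF v(2)]) (use uv wc c in \<open>simp_all add: inf_le2 ole_refl one_le_npart\<close>)
    ultimately have "?w \<curlywedge> (npart y \<otimes> npart x) = \<one>"
      using wc c by (simp add: orthogonal_mult one_le_npart)
    then have "?w \<curlywedge> npart (x \<otimes> y) = \<one>"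
      by (rule orthogonal_antimono) (use wc c in \<open>simp_all add: ole_refl one_le_npart npart_mult_le\<close>)
    then show "x \<otimes> y \<in> Q" using notU[OF w] c by (simp add: Q_def)
  qed
  show "normal_cone G Q" if co: "conj_orthogonal G"
    unfolding normal_cone_def
  proof (intro ballI)
    fix x g assume x: "x \<in> Q" and g: "g \<in> carrier G"
    obtain u where u: "u \<in> U" "u \<curlywedge> npart x = \<one>" using wit[OF x] by blast
    have c: "x \<in> carrier G" using x by (auto simp: Q_def)
    have "npart x \<curlywedge> u = \<one>" using u inf_commute[of u "npart x"] by simp
    then have "(g \<otimes> npart x \<otimes> inv g) \<curlywedge> u = \<one>"
      using co c g Uc[OF u(1)] one_le_npart[OF c] npart_closed[OF c] unfolding conj_orthogonal_def by blast
    then have "u \<curlywedge> npart (g \<otimes> x \<otimes> inv g) = \<one>"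
      using inf_commute[of u] npart_conj[OF c g] by simp
    then show "g \<otimes> x \<otimes> inv g \<in> Q" using notU[OF u(1)] c g by (simp add: Q_def)
  qed
qed

text \<open>One of \<open>x\<close> and \<open>inv x\<close> has a nontrivial negative part, since
  otherwise both would be positive. An ultrafilter containing that negative part keeps the element
  out of its cone.\<close>

lemma total_cone_separating:
  assumes x: "x \<in> carrier G" "x \<noteq> \<one>"
  shows "\<exists>Q. total_cone G Q \<and> (conj_orthogonal G \<longrightarrow> normal_cone G Q) \<and> \<not> (x \<in> Q \<and> inv x \<in> Q)"
proof -
  have "\<exists>y. y \<in> carrier G \<and> (y = x \<or> y = inv x) \<and> npart y \<noteq> \<one>"
  proof (rule ccontr)
    assume *: "\<not> ?thesis"
    have "npart x = \<one>" "npart (inv x) = \<one>" using * x by auto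
    then have "\<one> \<preceq> x" "\<one> \<preceq> inv x" using x npart_eq_one_iff by auto
    then show False using x one_le_inv_iff ole_antisym by auto
  qed
  then obtain y where y: "y \<in> carrier G" "y = x \<or> y = inv x" "npart y \<noteq> \<one>" by blast
  have "meet_filter {npart y}"
    using y one_le_npart[of y] inf_absorb1[of "npart y" "npart y"] by (auto simp: meet_filter_def ole_refl)
  from ultra_meet_filter_exists[OF this] obtain U where U: "ultra_meet_filter U" "npart y \<in> U" by blast
  let ?Q = "{x \<in> carrier G. npart x \<notin> U}"
  have "\<not> (x \<in> ?Q \<and> inv x \<in> ?Q)" using y U by auto
  then show ?thesis using total_cone_of_ultra[OF U(1)] by blast
qed

text \<open>The lexicographic refinement of the preorder of \<open>M\<close> by that of \<open>Q\<close>.\<close>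

lemma total_cone_refine:
  assumes M: "total_cone G M" and Q: "total_cone G Q"
  defines "R \<equiv> {x \<in> M. inv x \<in> M \<longrightarrow> x \<in> Q}"
  shows "total_cone G R" "\<lbrakk>normal_cone G M; normal_cone G Q\<rbrakk> \<Longrightarrow> normal_cone G R"
proof -
  note MD = total_coneD[OF M] and QD = total_coneD[OF Q]
  show "total_cone G R"
    unfolding total_cone_def
  proof (intro conjI ballI impI)
    show "R \<subseteq> carrier G" using MD(1) by (auto simp: R_def)
    show "x \<in> R" if "x \<in> carrier G" "\<one> \<preceq> x" for x
      using MD(2)[OF that] QD(2)[OF that] by (simp add: R_def)
    show "x \<in> R \<or> inv x \<in> R" if "x \<in> carrier G" for x
      using MD(4)[OF that] QD(4)[OF that] that by (auto simp: R_def)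
    fix x y assume "x \<in> R" "y \<in> R"
    then have x: "x \<in> M" "inv x \<in> M \<Longrightarrow> x \<in> Q" and y: "y \<in> M" "inv y \<in> M \<Longrightarrow> y \<in> Q"
      by (auto simp: R_def)
    have c: "x \<in> carrier G" "y \<in> carrier G" using MD(1) x y by auto
    \<comment> \<open>If a product of two elements of \<open>M\<close> is a unit of
      \<open>M\<close>, both factors are units, so both are subject to the second comparison and lie
      in \<open>Q\<close>.\<close>
    have "x \<otimes> y \<in> Q" if "inv (x \<otimes> y) \<in> M"
    proof -
      have "y \<otimes> inv (x \<otimes> y) \<in> M" "inv (x \<otimes> y) \<otimes> x \<in> M" using MD(3) x y that by blast+
      moreover have "y \<otimes> inv (x \<otimes> y) = inv x" "inv (x \<otimes> y) \<otimes> x = inv y"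
        using c by (simp_all add: inv_mult_group cancel_left_inv m_assoc)
      ultimately show ?thesis using x y QD(3) by simp
    qed
    then show "x \<otimes> y \<in> R" using MD(3)[OF x(1) y(1)] by (simp add: R_def)
  qed
  show "normal_cone G R" if n: "normal_cone G M" "normal_cone G Q"
    unfolding normal_cone_def
  proof (intro ballI)
    fix x g assume xR: "x \<in> R" and g: "g \<in> carrier G"
    then have x: "x \<in> M" "inv x \<in> M \<Longrightarrow> x \<in> Q" by (auto simp: R_def)
    have c: "x \<in> carrier G" using MD(1) x by auto
    have "inv x \<in> M" if "inv (g \<otimes> x \<otimes> inv g) \<in> M"
    proof -
      have "inv g \<otimes> inv (g \<otimes> x \<otimes> inv g) \<otimes> inv (inv g) \<in> M"
        using n(1) that g inv_closed[OF g] unfolding normal_cone_def by blast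
      also have "inv g \<otimes> inv (g \<otimes> x \<otimes> inv g) \<otimes> inv (inv g) = inv x"
        using c g by (simp add: inv_mult_group m_assoc cancel_left_inv)
      finally show ?thesis .
    qed
    moreover have "g \<otimes> x \<otimes> inv g \<in> M" using n(1) x g by (simp add: normal_cone_def)
    ultimately show "g \<otimes> x \<otimes> inv g \<in> R"
      using n(2) x g by (auto simp: R_def normal_cone_def)
  qed
qed

text \<open>Totality is the only condition for which the chain matters: if \<open>x\<close> is
  missing from \<open>C\<close> and \<open>inv x\<close> from \<open>D\<close>, both are missing
  from the smaller of the two.\<close>

lemma total_cone_Inter_chain:
  assumes ne: "\<C> \<noteq> {}" and f: "\<And>C. C \<in> \<C> \<Longrightarrow> total_cone G C"
    and ch: "\<And>C D. \<lbrakk>C \<in> \<C>; D \<in> \<C>\<rbrakk> \<Longrightarrow> C \<subseteq> D \<or> D \<subseteq> C"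
  shows "total_cone G (\<Inter>\<C>)"
  unfolding total_cone_def
proof (intro conjI ballI impI)
  show "\<Inter>\<C> \<subseteq> carrier G" using ne total_coneD(1)[OF f] by blast
  show "x \<in> \<Inter>\<C>" if "x \<in> carrier G" "\<one> \<preceq> x" for x using that total_coneD(2)[OF f] by blast
  show "x \<otimes> y \<in> \<Inter>\<C>" if "x \<in> \<Inter>\<C>" "y \<in> \<Inter>\<C>" for x y using that total_coneD(3)[OF f] by blast
  show "x \<in> \<Inter>\<C> \<or> inv x \<in> \<Inter>\<C>" if x: "x \<in> carrier G" for x
  proof (rule ccontr)
    assume "\<not> ?thesis"
    then obtain C D where CD: "C \<in> \<C>" "x \<notin> C" "D \<in> \<C>" "inv x \<notin> D" by blast
    then show False using ch[of C D] total_coneD(4)[OF f[OF CD(1)] x] total_coneD(4)[OF f[OF CD(3)] x] by blast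
  qed
qed

text \<open>\<open>P\<close> need not be normal even when \<open>n\<close> holds, so a normal cone
  inside it has to be produced first; the cone of a suitable ultrafilter is one. Zorn's lemma then
  gives a minimal cone among the admissible ones inside \<open>P\<close>, and a minimal cone that is
  not antisymmetric could be refined lexicographically.\<close>

lemma antisym_cone_below_prime:
  assumes P: "prime_cone G P" "P \<noteq> carrier G" and n: "n \<Longrightarrow> conj_orthogonal G"
  shows "\<exists>C. total_cone G C \<and> antisym_cone G C \<and> C \<subseteq> P \<and> (n \<longrightarrow> normal_cone G C)"
proof -
  note T = prime_coneD(1)[OF P(1)]
  note D = total_coneD[OF T] and up = total_cone_upward[OF T]
  have neg_le: "inv (npart x) \<preceq> x" if "x \<in> carrier G" for x
    using that inf_le1[of x \<one>] by (simp add: npart_def inv_sup)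
  \<comment> \<open>The positive elements that lie strictly above \<open>\<one>\<close> modulo
    \<open>P\<close>. If \<open>U\<close> contains them and \<open>npart x\<close> is not in
    \<open>U\<close>, then \<open>inv (npart x)\<close> is in \<open>P\<close>; as it lies below
    \<open>x\<close>, also \<open>x\<close> is in \<open>P\<close>.\<close>
  let ?A = "{x \<in> carrier G. \<one> \<preceq> x \<and> inv x \<notin> P}"
  have "meet_filter ?A"
    unfolding meet_filter_def
  proof (intro conjI ballI)
    obtain y where "y \<in> carrier G" "y \<notin> P" using P(2) D(1) by blast
    then have "npart y \<in> ?A" using neg_le[of y] up[of "inv (npart y)" y] one_le_npart[of y] by auto
    then show "?A \<noteq> {}" by blast
    show "?A \<subseteq> {x \<in> carrier G. \<one> \<preceq> x}" by blast
    show "\<one> \<notin> ?A" using total_cone_one[OF T] by simp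
    \<comment> \<open>Modulo \<open>P\<close> the meet of \<open>a\<close> and \<open>b\<close> is
      congruent to the smaller of the two, here \<open>a\<close>. So if the meet is not strictly
      positive modulo \<open>P\<close>, neither is \<open>a\<close>.\<close>
    have key: "inv a \<in> P"
      if "inv (a \<curlywedge> b) \<in> P" "b \<otimes> inv a \<in> P" "a \<in> carrier G" "b \<in> carrier G" for a b
    proof -
      have "(b \<otimes> inv a) \<curlywedge> \<one> \<in> P" using prime_coneD(2)[OF P(1)] that total_cone_one[OF T] by blast
      moreover have "(b \<otimes> inv a) \<curlywedge> \<one> = (a \<curlywedge> b) \<otimes> inv a"
        using that inf_commute[of "b \<otimes> inv a" \<one>] by (simp add: mult_inf_distrib_right)
      ultimately have "inv (a \<curlywedge> b) \<otimes> ((a \<curlywedge> b) \<otimes> inv a) \<in> P" using that D(3) by simp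
      then show ?thesis using that by (simp add: cancel_left_inv inf_closed)
    qed
    fix x y assume "x \<in> ?A" "y \<in> ?A"
    then have xy: "x \<in> carrier G" "y \<in> carrier G" "\<one> \<preceq> x" "\<one> \<preceq> y" "inv x \<notin> P" "inv y \<notin> P" by auto
    have "y \<otimes> inv x \<in> P \<or> x \<otimes> inv y \<in> P"
      using D(4)[of "y \<otimes> inv x"] xy by (simp add: inv_mult_group)
    then have "inv (x \<curlywedge> y) \<notin> P"
      using key[of x y] key[of y x] xy inf_commute[of x y] by auto
    then show "x \<curlywedge> y \<in> ?A" using xy by (simp add: inf_closed inf_greatest)
  qed
  then obtain U where U: "ultra_meet_filter U" "?A \<subseteq> U" using ultra_meet_filter_exists by blast
  let ?Q = "{x \<in> carrier G. npart x \<notin> U}"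
  have "?Q \<subseteq> P"
  proof
    fix x assume "x \<in> ?Q"
    then have x: "x \<in> carrier G" and "npart x \<notin> ?A" using U by blast+
    then have "inv (npart x) \<in> P" using one_le_npart[OF x] npart_closed[OF x] by simp
    then show "x \<in> P" using up[OF _ neg_le[OF x] x] by simp
  qed
  define S where "S = {C. total_cone G C \<and> C \<subseteq> P \<and> (n \<longrightarrow> normal_cone G C)}"
  have QS: "?Q \<in> S" using \<open>?Q \<subseteq> P\<close> total_cone_of_ultra[OF U(1)] n unfolding S_def by blast
  \<comment> \<open>Zorn's lemma is available for maximal sets; passing to complements turns it into
    a source of minimal cones.\<close>
  let ?T = "(\<lambda>C. - C) ` S"
  have "\<exists>M\<in>?T. \<forall>X\<in>?T. M \<subseteq> X \<longrightarrow> X = M"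
  proof (rule subset_Zorn_nonempty)
    show "?T \<noteq> {}" using QS by blast
    fix \<D> assume ne: "\<D> \<noteq> {}" and ch: "subset.chain ?T \<D>"
    let ?C = "uminus ` \<D>"
    have CS: "?C \<subseteq> S" using ch unfolding subset.chain_def by auto
    have CT: "\<And>C. C \<in> ?C \<Longrightarrow> total_cone G C" using CS unfolding S_def by blast
    have "X \<subseteq> Y \<or> Y \<subseteq> X" if "X \<in> \<D>" "Y \<in> \<D>" for X Y
      using ch that unfolding subset.chain_def by blast
    then have "\<And>C D. \<lbrakk>C \<in> ?C; D \<in> ?C\<rbrakk> \<Longrightarrow> C \<subseteq> D \<or> D \<subseteq> C"
      by (metis Compl_subset_Compl_iff imageE)
    then have "total_cone G (\<Inter>?C)"
      using ne CT by (intro total_cone_Inter_chain) blast+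
    moreover have "\<Inter>?C \<subseteq> P" using CS ne unfolding S_def by blast
    moreover have "n \<longrightarrow> normal_cone G (\<Inter>?C)"
      using CS unfolding S_def normal_cone_def by blast
    ultimately have "\<Inter>?C \<in> S" unfolding S_def by blast
    moreover have "\<Union>\<D> = - \<Inter>?C" by auto
    ultimately show "\<Union>\<D> \<in> ?T" by blast
  qed
  then obtain X where "X \<in> ?T" and max: "\<forall>Y\<in>?T. X \<subseteq> Y \<longrightarrow> Y = X" ..
  then obtain M where M: "M \<in> S" and X: "X = - M" by auto
  have min: "C = M" if "C \<in> S" "C \<subseteq> M" for C
  proof -
    have "- C = X" using max that X by simp
    then show ?thesis using X by simp
  qed
  have MT: "total_cone G M" using M unfolding S_def by blast
  have "antisym_cone G M"
    unfolding antisym_cone_def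
  proof (intro ballI impI, rule ccontr)
    fix x assume x: "x \<in> M" "inv x \<in> M" "x \<noteq> \<one>"
    then have "x \<in> carrier G" using total_coneD(1)[OF MT] by blast
    from total_cone_separating[OF this x(3)] obtain Q where Q: "total_cone G Q"
      "conj_orthogonal G \<longrightarrow> normal_cone G Q" "\<not> (x \<in> Q \<and> inv x \<in> Q)" by blast
    let ?R = "{x \<in> M. inv x \<in> M \<longrightarrow> x \<in> Q}"
    have "?R \<in> S"
      using total_cone_refine[OF MT Q(1)] Q(2) M n unfolding S_def by blast
    \<comment> \<open>The refinement changes nothing, so every unit of \<open>M\<close> lies in
      \<open>Q\<close>. Applied to \<open>x\<close> and \<open>inv x\<close>, this contradicts the
      choice of \<open>Q\<close>.\<close>
    then have R: "?R = M" by (rule min) blast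
    have "inv (inv x) = x" using \<open>x \<in> carrier G\<close> by simp
    then have "x \<in> Q" "inv x \<in> Q" using x R by (metis (mono_tags, lifting) mem_Collect_eq)+
    then show False using Q(3) by simp
  qed
  then show ?thesis using M unfolding S_def by blast
qed

end


section \<open>Sublattices generated by subgroups\<close>

inductive_set lattice_closure :: "('a, 'b) ogroup_scheme \<Rightarrow> 'a set \<Rightarrow> 'a set"
  for G :: "('a, 'b) ogroup_scheme" and K :: "'a set" where
  base: "x \<in> K \<Longrightarrow> x \<in> lattice_closure G K"
| join: "\<lbrakk>x \<in> lattice_closure G K; y \<in> lattice_closure G K\<rbrakk>
    \<Longrightarrow> x \<squnion>\<^bsub>order_of G\<^esub> y \<in> lattice_closure G K"
| meet: "\<lbrakk>x \<in> lattice_closure G K; y \<in> lattice_closure G K\<rbrakk>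
    \<Longrightarrow> x \<sqinter>\<^bsub>order_of G\<^esub> y \<in> lattice_closure G K"

context l_group
begin

lemma lattice_closure_closed:
  assumes "K \<subseteq> carrier G" "x \<in> lattice_closure G K"
  shows "x \<in> carrier G"
  using assms(2) by induction (use assms(1) in \<open>auto simp: sup_closed inf_closed\<close>)

text \<open>Products distribute over joins and meets and inversion exchanges these two. Hence the
  sublattice generated by a subgroup is already the generated l-subgroup, and its elements can be
  treated by induction on lattice terms.\<close>

lemma subgroup_lattice_closure:
  assumes K: "subgroup K G"
  shows "subgroup (lattice_closure G K) G"
proof -
  interpret K: subgroup K G by fact
  let ?L = "lattice_closure G K"
  have c: "x \<in> carrier G" if "x \<in> ?L" for x using lattice_closure_closed K.subset that by blast
  have right: "x \<otimes> k \<in> ?L" if "x \<in> ?L" "k \<in> K" for x k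
    using that(1)
  proof induction
    case (base x)
    then show ?case using that(2) by (simp add: lattice_closure.base)
  next
    case (join x y)
    then show ?case using c that(2) by (simp add: mult_sup_distrib_right lattice_closure.join)
  next
    case (meet x y)
    then show ?case using c that(2) by (simp add: mult_inf_distrib_right lattice_closure.meet)
  qed
  have mult: "x \<otimes> y \<in> ?L" if x: "x \<in> ?L" and y: "y \<in> ?L" for x y
    using y
  proof induction
    case (base y)
    then show ?case using x right by blast
  next
    case (join y z)
    then show ?case using c x by (simp add: mult_sup_distrib_left lattice_closure.join)
  next
    case (meet y z)
    then show ?case using c x by (simp add: mult_inf_distrib_left lattice_closure.meet)
  qed
  have inv: "inv x \<in> ?L" if "x \<in> ?L" for x
    using that
  proof induction
    case (base x)
    then show ?case by (simp add: lattice_closure.base)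
  next
    case (join x y)
    then show ?case using c by (simp add: inv_sup lattice_closure.meet)
  next
    case (meet x y)
    then show ?case using c by (simp add: inv_inf lattice_closure.join)
  qed
  show ?thesis
  proof
    show "?L \<subseteq> carrier G" using c by blast
    show "\<one> \<in> ?L" by (simp add: lattice_closure.base)
  qed (use mult inv in auto)
qed

text \<open>\<open>x \<otimes> inv k\<close> being a unit says that \<open>x\<close> and
  \<open>k\<close> have the same right coset. In the chain of cosets a join has the coset of its
  larger argument, and \<open>kl\<close> makes this the coset of \<open>l\<close>.\<close>

lemma sup_cong_units:
  assumes Q: "prime_cone G Q" and c: "x \<in> carrier G" "y \<in> carrier G" "k \<in> carrier G" "l \<in> carrier G"
    and x: "x \<otimes> inv k \<in> cone_units G Q" and y: "y \<otimes> inv l \<in> cone_units G Q" and kl: "l \<otimes> inv k \<in> Q"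
  shows "(x \<curlyvee> y) \<otimes> inv l \<in> cone_units G Q"
proof -
  note T = prime_coneD(1)[OF Q]
  note D = total_coneD[OF T]
  have xy: "k \<otimes> inv x \<in> Q" "y \<otimes> inv l \<in> Q" "l \<otimes> inv y \<in> Q"
    using x y c by (simp_all add: cone_units_def inv_mult_group)
  have "y \<otimes> inv l \<preceq> (x \<curlyvee> y) \<otimes> inv l"
    using c by (simp add: mult_sup_distrib_right sup_ge2)
  then have 1: "(x \<curlyvee> y) \<otimes> inv l \<in> Q"
    using total_cone_upward[OF T xy(2)] c by (simp add: sup_closed)
  have "(l \<otimes> inv k) \<otimes> (k \<otimes> inv x) \<in> Q" using D(3)[OF kl xy(1)] .
  then have "l \<otimes> inv x \<in> Q" using c by (simp add: m_assoc cancel_left_inv)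
  then have "(l \<otimes> inv x) \<curlywedge> (l \<otimes> inv y) \<in> Q" using prime_coneD(2)[OF Q] xy(3) by blast
  then have 2: "inv ((x \<curlyvee> y) \<otimes> inv l) \<in> Q"
    using c by (simp add: inv_mult_group inv_sup sup_closed mult_inf_distrib_left)
  show ?thesis using 1 2 by (simp add: cone_units_def)
qed

text \<open>As for joins, but \<open>kl\<close> now says that \<open>l\<close> represents the
  smaller coset.\<close>

lemma inf_cong_units:
  assumes Q: "prime_cone G Q" and c: "x \<in> carrier G" "y \<in> carrier G" "k \<in> carrier G" "l \<in> carrier G"
    and x: "x \<otimes> inv k \<in> cone_units G Q" and y: "y \<otimes> inv l \<in> cone_units G Q" and kl: "k \<otimes> inv l \<in> Q"
  shows "(x \<curlywedge> y) \<otimes> inv l \<in> cone_units G Q"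
proof -
  note T = prime_coneD(1)[OF Q]
  note D = total_coneD[OF T]
  have xy: "x \<otimes> inv k \<in> Q" "y \<otimes> inv l \<in> Q" "l \<otimes> inv y \<in> Q"
    using x y c by (simp_all add: cone_units_def inv_mult_group)
  have "l \<otimes> inv y \<preceq> inv ((x \<curlywedge> y) \<otimes> inv l)"
    using c by (simp add: inv_mult_group inv_inf inf_closed mult_sup_distrib_left sup_ge2)
  then have 1: "inv ((x \<curlywedge> y) \<otimes> inv l) \<in> Q"
    using total_cone_upward[OF T xy(3)] c by (simp add: inf_closed)
  have "(x \<otimes> inv k) \<otimes> (k \<otimes> inv l) \<in> Q" using D(3)[OF xy(1) kl] .
  then have "x \<otimes> inv l \<in> Q" using c by (simp add: m_assoc cancel_left_inv)
  then have "(x \<otimes> inv l) \<curlywedge> (y \<otimes> inv l) \<in> Q" using prime_coneD(2)[OF Q] xy(2) by blast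
  then have 2: "(x \<curlywedge> y) \<otimes> inv l \<in> Q"
    using c by (simp add: mult_inf_distrib_right)
  show ?thesis using 1 2 by (simp add: cone_units_def)
qed

text \<open>A prime cone decides the finitely many comparisons that occur in the evaluation of a lattice
  term, and every prime cone that decides them in the same way selects the same element of \<open>K\<close>.\<close>

lemma lattice_closure_approx:
  assumes P: "prime_cone G P" and K: "subgroup K G" and x: "x \<in> lattice_closure G K"
  shows "\<exists>k\<in>K. \<exists>A. finite A \<and> A \<subseteq> P \<inter> K \<and>
    (\<forall>Q. prime_cone G Q \<longrightarrow> A \<subseteq> Q \<longrightarrow> x \<otimes> inv k \<in> cone_units G Q)"
  using x
proof induction
  interpret K: subgroup K G by fact
  note PT = prime_coneD(1)[OF P]
  note PD = total_coneD[OF PT]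
  have c: "x \<in> carrier G" if "x \<in> lattice_closure G K" for x using lattice_closure_closed K.subset that by blast
  {
    case (base x)
    have "x \<otimes> inv x \<in> cone_units G Q" if "prime_cone G Q" for Q
      using total_cone_one[OF prime_coneD(1)[OF that]] base by (simp add: cone_units_def)
    then have "finite {} \<and> {} \<subseteq> P \<inter> K \<and> (\<forall>Q. prime_cone G Q \<longrightarrow> {} \<subseteq> Q \<longrightarrow> x \<otimes> inv x \<in> cone_units G Q)"
      by blast
    then show ?case using base by blast
  next
    case (join x y)
    then obtain k l A B where k: "k \<in> K" and A: "finite A" "A \<subseteq> P \<inter> K"
        "\<And>Q. \<lbrakk>prime_cone G Q; A \<subseteq> Q\<rbrakk> \<Longrightarrow> x \<otimes> inv k \<in> cone_units G Q"
      and l: "l \<in> K" and B: "finite B" "B \<subseteq> P \<inter> K"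
        "\<And>Q. \<lbrakk>prime_cone G Q; B \<subseteq> Q\<rbrakk> \<Longrightarrow> y \<otimes> inv l \<in> cone_units G Q"
      by (elim bexE exE conjE) metis
    note car = c[OF join(1)] c[OF join(2)] K.mem_carrier[OF k] K.mem_carrier[OF l]
    have kl: "l \<otimes> inv k \<in> K" "k \<otimes> inv l \<in> K" using k l by simp_all
    have "l \<otimes> inv k \<in> P \<or> k \<otimes> inv l \<in> P"
      using PD(4)[of "l \<otimes> inv k"] car by (simp add: inv_mult_group)
    then show ?case
    proof
      assume *: "l \<otimes> inv k \<in> P"
      \<comment> \<open>\<open>A\<close> fixes the coset of \<open>x\<close>, \<open>B\<close> that
        of \<open>y\<close>, and the added element records which of the two is larger.\<close>
      let ?C = "insert (l \<otimes> inv k) (A \<union> B)"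
      have "(x \<curlyvee> y) \<otimes> inv l \<in> cone_units G Q" if "prime_cone G Q" "?C \<subseteq> Q" for Q
        using that by (intro sup_cong_units[OF that(1) car] A(3) B(3)) auto
      moreover have "finite ?C \<and> ?C \<subseteq> P \<inter> K" using A B * kl by simp
      ultimately show ?case using l by blast
    next
      assume *: "k \<otimes> inv l \<in> P"
      let ?C = "insert (k \<otimes> inv l) (A \<union> B)"
      have "(x \<curlyvee> y) \<otimes> inv k \<in> cone_units G Q" if "prime_cone G Q" "?C \<subseteq> Q" for Q
        unfolding sup_commute[of x y]
        using that by (intro sup_cong_units[OF that(1) car(2,1,4,3)] A(3) B(3)) auto
      moreover have "finite ?C \<and> ?C \<subseteq> P \<inter> K" using A B * kl by simp
      ultimately show ?case using k by blast
    qed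
  next
    case (meet x y)
    then obtain k l A B where k: "k \<in> K" and A: "finite A" "A \<subseteq> P \<inter> K"
        "\<And>Q. \<lbrakk>prime_cone G Q; A \<subseteq> Q\<rbrakk> \<Longrightarrow> x \<otimes> inv k \<in> cone_units G Q"
      and l: "l \<in> K" and B: "finite B" "B \<subseteq> P \<inter> K"
        "\<And>Q. \<lbrakk>prime_cone G Q; B \<subseteq> Q\<rbrakk> \<Longrightarrow> y \<otimes> inv l \<in> cone_units G Q"
      by (elim bexE exE conjE) metis
    note car = c[OF meet(1)] c[OF meet(2)] K.mem_carrier[OF k] K.mem_carrier[OF l]
    have kl: "l \<otimes> inv k \<in> K" "k \<otimes> inv l \<in> K" using k l by simp_all
    have "k \<otimes> inv l \<in> P \<or> l \<otimes> inv k \<in> P"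
      using PD(4)[of "k \<otimes> inv l"] car by (simp add: inv_mult_group)
    then show ?case
    proof
      assume *: "k \<otimes> inv l \<in> P"
      let ?C = "insert (k \<otimes> inv l) (A \<union> B)"
      have "(x \<curlywedge> y) \<otimes> inv l \<in> cone_units G Q" if "prime_cone G Q" "?C \<subseteq> Q" for Q
        using that by (intro inf_cong_units[OF that(1) car] A(3) B(3)) auto
      moreover have "finite ?C \<and> ?C \<subseteq> P \<inter> K" using A B * kl by simp
      ultimately show ?case using l by blast
    next
      assume *: "l \<otimes> inv k \<in> P"
      let ?C = "insert (l \<otimes> inv k) (A \<union> B)"
      have "(x \<curlywedge> y) \<otimes> inv k \<in> cone_units G Q" if "prime_cone G Q" "?C \<subseteq> Q" for Q
        unfolding inf_commute[of x y]
        using that by (intro inf_cong_units[OF that(1) car(2,1,4,3)] A(3) B(3)) auto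
      moreover have "finite ?C \<and> ?C \<subseteq> P \<inter> K" using A B * kl by simp
      ultimately show ?case using k by blast
    qed
  }
qed

text \<open>An \<open>x\<close> in \<open>P\<close> is congruent modulo \<open>P\<close> to some
  \<open>k\<close> in \<open>K\<close>, which then also belongs to \<open>P\<close>. The comparisons
  that certify the congruence lie in \<open>P \<inter> K\<close>, hence in \<open>Q\<close>, so
  \<open>x\<close> is congruent to the same \<open>k\<close> modulo \<open>Q\<close>; and
  \<open>k\<close> is in \<open>Q\<close>.\<close>

lemma prime_cone_subset_of_trace:
  assumes P: "prime_cone G P" and Q: "prime_cone G Q" and K: "subgroup K G"
    and gen: "lattice_closure G K = carrier G" and PQ: "P \<inter> K \<subseteq> Q"
  shows "P \<subseteq> Q"
proof
  fix x assume x: "x \<in> P"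
  note PD = total_coneD[OF prime_coneD(1)[OF P]] and QD = total_coneD[OF prime_coneD(1)[OF Q]]
  have xc: "x \<in> carrier G" using PD(1) x .
  then have "x \<in> lattice_closure G K" using gen by simp
  from lattice_closure_approx[OF P K this] obtain k A where k: "k \<in> K" and A: "A \<subseteq> P \<inter> K"
    and app: "\<And>Q. \<lbrakk>prime_cone G Q; A \<subseteq> Q\<rbrakk> \<Longrightarrow> x \<otimes> inv k \<in> cone_units G Q" by blast
  have kc: "k \<in> carrier G" using subgroup.mem_carrier[OF K k] .
  have "inv (x \<otimes> inv k) \<in> P" using app[OF P] A by (auto simp: cone_units_def)
  then have "inv (x \<otimes> inv k) \<otimes> x \<in> P" using PD(3) x by blast
  also have "inv (x \<otimes> inv k) \<otimes> x = k" using xc kc by (simp add: inv_mult_group m_assoc)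
  finally have kQ: "k \<in> Q" using PQ k by blast
  have "x \<otimes> inv k \<in> Q" using app[OF Q] A PQ by (auto simp: cone_units_def)
  then have "(x \<otimes> inv k) \<otimes> k \<in> Q" using QD(3) kQ by blast
  then show "x \<in> Q" using xc kc by (simp add: m_assoc)
qed

end

section \<open>Restriction of orders and cones to a subgroup\<close>

lemma (in po_group) po_group_subgroup:
  assumes K: "subgroup K G"
  shows "po_group (G\<lparr>carrier := K\<rparr>)"
proof (rule po_groupI)
  let ?S = "G\<lparr>carrier := K\<rparr>"
  interpret K: subgroup K G by fact
  show "group ?S" using subgroup.subgroup_is_group[OF K is_group] .
  fix x y z assume c: "x \<in> carrier ?S" "y \<in> carrier ?S" "z \<in> carrier ?S"
  then have g: "x \<in> carrier G" "y \<in> carrier G" "z \<in> carrier G" by auto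
  show "ole ?S x x" using g ole_refl by simp
  show "x = y" if "ole ?S x y" "ole ?S y x" using that g ole_antisym[of x y] by simp
  show "ole ?S x z" if "ole ?S x y" "ole ?S y z"
    using that g ole_trans[of x y z] by simp
  fix t assume t: "t \<in> carrier ?S" "ole ?S x y"
  then have "t \<in> carrier G" by auto
  then show "ole ?S (z \<otimes>\<^bsub>?S\<^esub> x \<otimes>\<^bsub>?S\<^esub> t)
     (z \<otimes>\<^bsub>?S\<^esub> y \<otimes>\<^bsub>?S\<^esub> t)"
    using t g mult_mono[of x y z t] by simp
qed

lemma (in po_group) total_cone_subgroup:
  assumes K: "subgroup K G" and C: "total_cone G C"
  shows "total_cone (G\<lparr>carrier := K\<rparr>) (C \<inter> K)"
    and "antisym_cone G C \<Longrightarrow> antisym_cone (G\<lparr>carrier := K\<rparr>) (C \<inter> K)"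
    and "normal_cone G C \<Longrightarrow> normal_cone (G\<lparr>carrier := K\<rparr>) (C \<inter> K)"
proof -
  let ?S = "G\<lparr>carrier := K\<rparr>"
  interpret K: subgroup K G by fact
  note D = total_coneD[OF C]
  have i: "inv\<^bsub>?S\<^esub> x = inv x" if "x \<in> K" for x using m_inv_consistent[OF K that] .
  show "total_cone ?S (C \<inter> K)"
    unfolding total_cone_def
    using D(2,3,4) K.mem_carrier i by simp
  show "antisym_cone ?S (C \<inter> K)" if "antisym_cone G C"
    unfolding antisym_cone_def
  proof (intro ballI impI)
    fix x assume x: "x \<in> C \<inter> K" "inv\<^bsub>?S\<^esub> x \<in> C \<inter> K"
    then have "inv x \<in> C" using i[of x] by simp
    then have "x = \<one>" using that x(1) unfolding antisym_cone_def by blast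
    then show "x = \<one>\<^bsub>?S\<^esub>" by simp
  qed
  show "normal_cone ?S (C \<inter> K)" if "normal_cone G C"
    using that i K.mem_carrier unfolding normal_cone_def by simp
qed


section \<open>The minimal spectrum as a space of orders on a generating subgroup\<close>

lemma right_orders_subgroupD:
  fixes G :: "'a ogroup" (structure)
  assumes G: "po_group G" and K: "subgroup K G" and C: "C \<in> right_orders (G\<lparr>carrier := K\<rparr>)"
  shows "C \<subseteq> K" "C \<noteq> K" "\<one> \<in> C" "\<And>x. x \<in> K \<Longrightarrow> x \<in> C \<or> inv x \<in> C"
    "\<And>x. \<lbrakk>x \<in> C; inv x \<in> C\<rbrakk> \<Longrightarrow> x = \<one>" "\<And>x. \<lbrakk>x \<in> K; \<one> \<preceq> x\<rbrakk> \<Longrightarrow> x \<in> C"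
    "\<And>x y. \<lbrakk>x \<in> C; y \<in> C\<rbrakk> \<Longrightarrow> x \<otimes> y \<in> C"
proof -
  let ?K = "G\<lparr>carrier := K\<rparr>"
  interpret po_group G by fact
  interpret GK: po_group ?K by (rule po_group_subgroup[OF K])
  have c: "total_cone ?K C" "antisym_cone ?K C" "C \<noteq> carrier ?K"
    using C mem_right_orders_iff[OF GK.po_group_axioms] by blast+
  note D = total_coneD[OF c(1)]
  have i: "inv\<^bsub>?K\<^esub> x = inv x" if "x \<in> K" for x using m_inv_consistent[OF K that] .
  show CK: "C \<subseteq> K" using D(1) by auto
  show "C \<noteq> K" using c(3) by simp
  show "\<one> \<in> C" using GK.total_cone_one[OF c(1)] by simp
  show "x \<in> C" if "x \<in> K" "\<one> \<preceq> x" for x using D(2)[of x] that by simp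
  show "x \<otimes> y \<in> C" if "x \<in> C" "y \<in> C" for x y using D(3)[OF that] by simp
  show "x \<in> C \<or> inv x \<in> C" if "x \<in> K" for x using D(4)[of x] i[OF that] that by simp
  show "x = \<one>" if "x \<in> C" "inv x \<in> C" for x
  proof -
    have "inv\<^bsub>?K\<^esub> x \<in> C" using that i CK by auto
    then have "x = \<one>\<^bsub>?K\<^esub>" using c(2) that(1) unfolding antisym_cone_def by blast
    then show ?thesis by simp
  qed
qed

context
  fixes G :: "'a ogroup" (structure) and K :: "'a set" and n :: bool
  assumes l_group: "l_group G" and sub: "subgroup K G" and gen: "lattice_closure G K = carrier G"
    and conj: "n \<Longrightarrow> conj_orthogonal G"
    and lift: "\<And>C. \<lbrakk>C \<in> right_orders (G\<lparr>carrier := K\<rparr>); n \<longrightarrow> normal_cone (G\<lparr>carrier := K\<rparr>) C\<rbrakk>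
      \<Longrightarrow> \<exists>P. prime_cone G P \<and> P \<inter> K = C"
begin

interpretation l_group G by (fact l_group)
interpretation K: subgroup K G by (fact sub)
interpretation GK: po_group "G\<lparr>carrier := K\<rparr>" by (rule po_group_subgroup[OF sub])

private abbreviation (input) GK where "GK \<equiv> G\<lparr>carrier := K\<rparr>"

text \<open>The flag \<open>n\<close> selects all right orders or only the two-sided ones, so that
  one argument serves the three varieties. Freeness is represented by the assumptions
  \<open>gen\<close> and \<open>lift\<close>.\<close>

definition trace_orders :: "'a set set" where
  "trace_orders = {C \<in> right_orders GK. n \<longrightarrow> normal_cone GK C}"

text \<open>The trace is taken of the cone and not of the subgroup: for a minimal prime
  \<open>p\<close>, antisymmetry makes \<open>p \<inter> K\<close> trivial, so it would carry no
  information.\<close>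

definition order_trace :: "'a set \<Rightarrow> 'a set" where
  "order_trace p = up_cone G p \<inter> K"

lemmas right_ordersD = right_orders_subgroupD[OF po_group_axioms sub]

text \<open>Antisymmetric total cones are minimal: an element of \<open>C\<close> outside
  \<open>P\<close> would have its inverse in \<open>P \<inter> K\<close>, hence in \<open>C\<close>,
  and so would be the identity.\<close>

lemma right_orders_eqI:
  assumes "C \<in> right_orders GK" "total_cone G P" "P \<inter> K \<subseteq> C"
  shows "P \<inter> K = C"
proof
  show "C \<subseteq> P \<inter> K"
  proof
    fix x assume x: "x \<in> C"
    note D = right_ordersD[OF assms(1)]
    have xK: "x \<in> K" using D(1) x by blast
    show "x \<in> P \<inter> K"
    proof (rule ccontr)
      assume "x \<notin> P \<inter> K"
      then have "x \<notin> P" using xK by blast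
      then have "inv x \<in> P \<inter> K" using total_coneD(4)[OF assms(2)] xK K.mem_carrier K.m_inv_closed by blast
      then have "x = \<one>" using D(5)[OF x] assms(3) by blast
      then show False using \<open>x \<notin> P\<close> total_cone_one[OF assms(2)] by simp
    qed
  qed
qed (fact assms(3))

text \<open>\<open>lift\<close> is applied to the trace of \<open>C\<close>, not to that of
  \<open>?P\<close>, which is not yet known to be antisymmetric or normal. Minimality of
  \<open>p\<close> then identifies the lift with \<open>?P\<close>, and with it the two
  traces.\<close>

lemma trace_in_trace_orders:
  assumes p: "p \<in> minimal_primes G"
  shows "order_trace p \<in> trace_orders"
proof -
  have pS: "p \<in> Spec G" and min: "\<And>q. \<lbrakk>q \<in> Spec G; q \<subseteq> p\<rbrakk> \<Longrightarrow> q = p"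
    using p by (auto simp: minimal_primes_def)
  let ?P = "up_cone G p"
  note P = prime_cone_up_cone[OF l_group pS]
  obtain C where C: "total_cone G C" "antisym_cone G C" "C \<subseteq> ?P" "n \<longrightarrow> normal_cone G C"
    using antisym_cone_below_prime[of ?P n] P conj by blast
  note CK = total_cone_subgroup[OF sub C(1)]
  have carr: "prime_cone G (carrier G)"
    by (simp add: prime_cone_def total_cone_def inf_closed)
  \<comment> \<open>Properness is inherited from \<open>?P\<close>: if its trace were all of
    \<open>K\<close>, the improper prime cone \<open>carrier G\<close> would be contained in
    it.\<close>
  have ne: "C \<inter> K \<noteq> K"
  proof
    assume "C \<inter> K = K"
    then have "carrier G \<inter> K \<subseteq> ?P" using C(3) by blast
    then have "carrier G \<subseteq> ?P" using prime_cone_subset_of_trace[OF carr P(1) sub gen] by blast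
    then show False using P(3) total_coneD(1)[OF prime_coneD(1)[OF P(1)]] by blast
  qed
  have CR: "C \<inter> K \<in> right_orders GK"
    unfolding mem_right_orders_iff[OF GK.po_group_axioms] using CK(1) CK(2)[OF C(2)] ne by simp
  have Cn: "n \<longrightarrow> normal_cone GK (C \<inter> K)" using CK(3) C(4) by blast
  obtain Q where Q: "prime_cone G Q" "Q \<inter> K = C \<inter> K" using lift[OF CR Cn] by blast
  have QP: "Q \<subseteq> ?P" using prime_cone_subset_of_trace[OF Q(1) P(1) sub gen] Q(2) C(3) by blast
  then have "Q \<noteq> carrier G" using P(3) total_coneD(1)[OF prime_coneD(1)[OF P(1)]] by blast
  note QS = cone_units_Spec[OF l_group Q(1) this]
  have "cone_units G Q \<subseteq> p" using cone_units_mono[OF l_group QP] P(2) by simp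
  then have "cone_units G Q = p" using min QS(1) by blast
  then have "order_trace p = C \<inter> K" using QS(2) Q(2) by (simp add: order_trace_def)
  then show ?thesis using CR Cn by (simp add: trace_orders_def)
qed

text \<open>A prime below the lift has its trace inside the antisymmetric \<open>C\<close>, hence
  equal to \<open>C\<close>. Equal traces mean equal prime cones, so the lift is minimal.\<close>

lemma trace_orders_lift:
  assumes C: "C \<in> trace_orders"
  shows "\<exists>p\<in>minimal_primes G. order_trace p = C"
proof -
  have CR: "C \<in> right_orders GK" and "n \<longrightarrow> normal_cone GK C" using C by (auto simp: trace_orders_def)
  then obtain P where P: "prime_cone G P" "P \<inter> K = C" using lift by blast
  have Pne: "P \<noteq> carrier G" using P(2) right_ordersD(2)[OF CR] K.subset by blast
  note PS = cone_units_Spec[OF l_group P(1) Pne]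
  have "q = cone_units G P" if q: "q \<in> Spec G" "q \<subseteq> cone_units G P" for q
  proof -
    note qc = prime_cone_up_cone[OF l_group q(1)]
    have "up_cone G q \<subseteq> P" using up_cone_mono[OF l_group q(2)] PS(2) by simp
    then have "up_cone G q \<inter> K = C"
      using right_orders_eqI[OF CR prime_coneD(1)[OF qc(1)]] P(2) by blast
    then have "P \<subseteq> up_cone G q"
      using prime_cone_subset_of_trace[OF P(1) qc(1) sub gen] P(2) by blast
    then have "cone_units G P \<subseteq> q" using cone_units_mono[OF l_group] qc(2) by blast
    then show ?thesis using q(2) by blast
  qed
  then have "cone_units G P \<in> minimal_primes G" using PS(1) by (auto simp: minimal_primes_def)
  moreover have "order_trace (cone_units G P) = C" using PS(2) P(2) by (simp add: order_trace_def)
  ultimately show ?thesis by blast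
qed

lemma trace_inj: "inj_on order_trace (minimal_primes G)"
proof (rule inj_onI)
  fix p q assume pq: "p \<in> minimal_primes G" "q \<in> minimal_primes G" "order_trace p = order_trace q"
  then have S: "p \<in> Spec G" "q \<in> Spec G" by (auto simp: minimal_primes_def)
  note P = prime_cone_up_cone[OF l_group S(1)] and Q = prime_cone_up_cone[OF l_group S(2)]
  have "up_cone G p = up_cone G q"
    using prime_cone_subset_of_trace[OF P(1) Q(1) sub gen] prime_cone_subset_of_trace[OF Q(1) P(1) sub gen]
      pq(3) by (auto simp: order_trace_def)
  then show "p = q" using P(2) Q(2) by metis
qed

section \<open>Continuity of the trace and of its inverse\<close>

lemma topspace_spec_space: "topspace (spec_space G) = Spec G"
proof -
  have "p \<in> \<Union>{{p \<in> Spec G. \<not> A \<subseteq> p} |A. A \<subseteq> carrier G}" if p: "p \<in> Spec G" for p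
  proof -
    have "p \<subseteq> carrier G" "p \<noteq> carrier G"
      using p subgroup.subset unfolding Spec_def convex_l_subgroup_def by blast+
    then show ?thesis using p by blast
  qed
  then show ?thesis unfolding spec_space_def topology_generated_by_topspace by blast
qed

lemma topspace_min_space: "topspace (min_space G) = minimal_primes G"
  unfolding min_space_def topspace_subtopology topspace_spec_space by (auto simp: minimal_primes_def)

lemma openin_min_space:
  assumes "A \<subseteq> carrier G"
  shows "openin (min_space G) {p \<in> minimal_primes G. \<not> A \<subseteq> p}"
proof -
  have "openin (spec_space G) {p \<in> Spec G. \<not> A \<subseteq> p}"
    unfolding spec_space_def using assms by (intro topology_generated_by_Basis) blast
  moreover have "{p \<in> minimal_primes G. \<not> A \<subseteq> p} = {p \<in> Spec G. \<not> A \<subseteq> p} \<inter> minimal_primes G"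
    by (auto simp: minimal_primes_def)
  ultimately show ?thesis unfolding min_space_def openin_subtopology by blast
qed

text \<open>Translates a condition on cones into one on prime subgroups, so that
  \<open>a \<notin> up_cone G p\<close> becomes an open condition of the spectrum. The inverse of
  \<open>npart a\<close> is \<open>a \<curlywedge> \<one>\<close>, which belongs to a prime cone
  exactly when \<open>a\<close> does.\<close>

lemma mem_up_cone_iff:
  assumes p: "p \<in> Spec G" and a: "a \<in> carrier G"
  shows "a \<in> up_cone G p \<longleftrightarrow> npart a \<in> p"
proof -
  note P = prime_cone_up_cone[OF l_group p]
  note T = prime_coneD(1)[OF P(1)]
  have i: "inv (npart a) = a \<curlywedge> \<one>" using a by (simp add: npart_def inv_sup)
  have "npart a \<in> up_cone G p" using total_coneD(2)[OF T, of "npart a"] a one_le_npart by simp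
  then have "npart a \<in> cone_units G (up_cone G p) \<longleftrightarrow> a \<curlywedge> \<one> \<in> up_cone G p"
    using i by (simp add: cone_units_def)
  moreover have "a \<in> up_cone G p" if "a \<curlywedge> \<one> \<in> up_cone G p"
    using total_cone_upward[OF T that inf_le1[of a \<one>]] a by simp
  moreover have "a \<curlywedge> \<one> \<in> up_cone G p" if "a \<in> up_cone G p"
    using prime_coneD(2)[OF P(1) that total_cone_one[OF T]] .
  ultimately show ?thesis unfolding P(2) by blast
qed

lemma openin_min_space_notin:
  assumes "a \<in> carrier G"
  shows "openin (min_space G) {p \<in> minimal_primes G. a \<notin> up_cone G p}"
proof -
  have "{p \<in> minimal_primes G. a \<notin> up_cone G p} = {p \<in> minimal_primes G. \<not> {npart a} \<subseteq> p}"
    using mem_up_cone_iff assms by (auto simp: minimal_primes_def)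
  then show ?thesis using openin_min_space[of "{npart a}"] assms by simp
qed

text \<open>For \<open>a\<close> in \<open>K\<close> other than the identity, antisymmetry of the
  trace turns membership of \<open>a\<close> into non-membership of \<open>inv a\<close>, which is
  open. Here minimality of the primes and \<open>a\<close> being in \<open>K\<close> are both
  essential.\<close>

lemma openin_min_space_in:
  assumes a: "a \<in> K"
  shows "openin (min_space G) {p \<in> minimal_primes G. a \<in> up_cone G p}"
proof (cases "a = \<one>")
  case True
  have "a \<in> up_cone G p" if "p \<in> minimal_primes G" for p
    using that True total_cone_one prime_coneD(1) prime_cone_up_cone(1)[OF l_group]
    unfolding minimal_primes_def by blast
  then have "{p \<in> minimal_primes G. a \<in> up_cone G p} = topspace (min_space G)"
    using topspace_min_space by blast
  then show ?thesis by simp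
next
  case False
  have "a \<in> up_cone G p \<longleftrightarrow> inv a \<notin> up_cone G p" if p: "p \<in> minimal_primes G" for p
  proof -
    have "order_trace p \<in> right_orders GK" using trace_in_trace_orders[OF p] by (simp add: trace_orders_def)
    note D = right_ordersD(4,5)[OF this, of a]
    show ?thesis using D a False K.m_inv_closed[OF a] unfolding order_trace_def by blast
  qed
  then have "{p \<in> minimal_primes G. a \<in> up_cone G p} = {p \<in> minimal_primes G. inv a \<notin> up_cone G p}"
    by blast
  then show ?thesis using openin_min_space_notin[of "inv a"] a K.mem_carrier by simp
qed

lemma topspace_right_order_space: "topspace (right_order_space GK) = right_orders GK"
proof -
  have "C \<in> {C \<in> right_orders GK. \<one> \<in> C}" if "C \<in> right_orders GK" for C
    using that right_ordersD(3) by blast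
  moreover have "\<one> \<in> carrier GK" by simp
  ultimately show ?thesis unfolding right_order_space_def topology_generated_by_topspace by blast
qed

private abbreviation (input) OT where "OT \<equiv> subtopology (right_order_space GK) trace_orders"

lemma topspace_trace_orders:
  "topspace OT = trace_orders"
  unfolding topspace_subtopology topspace_right_order_space by (auto simp: trace_orders_def)

lemma continuous_map_trace:
  "continuous_map (min_space G) OT order_trace"
  unfolding continuous_map_in_subtopology
proof
  show im: "order_trace \<in> topspace (min_space G) \<rightarrow> trace_orders"
    unfolding topspace_min_space using trace_in_trace_orders by blast
  have R: "order_trace p \<in> right_orders GK" if "p \<in> minimal_primes G" for p
    using trace_in_trace_orders[OF that] by (simp add: trace_orders_def)
  show "continuous_map (min_space G) (right_order_space GK) order_trace"
    unfolding right_order_space_def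
  proof (rule continuous_on_generated_topo)
    fix U assume "U \<in> {{C \<in> right_orders GK. a \<in> C} |a. a \<in> carrier GK} \<union>
       {{C \<in> right_orders GK. a \<notin> C} |a. a \<in> carrier GK}"
    then obtain a where a: "a \<in> K" and "U = {C \<in> right_orders GK. a \<in> C} \<or> U = {C \<in> right_orders GK. a \<notin> C}"
      by auto
    then consider "U = {C \<in> right_orders GK. a \<in> C}" | "U = {C \<in> right_orders GK. a \<notin> C}" by blast
    then show "openin (min_space G) (order_trace -` U \<inter> topspace (min_space G))"
    proof cases
      case 1
      have "order_trace -` U \<inter> topspace (min_space G) = {p \<in> minimal_primes G. a \<in> up_cone G p}"
        using R a unfolding topspace_min_space 1 by (auto simp: order_trace_def)
      then show ?thesis using openin_min_space_in[OF a] by simp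
    next
      case 2
      have "order_trace -` U \<inter> topspace (min_space G) = {p \<in> minimal_primes G. a \<notin> up_cone G p}"
        using R a unfolding topspace_min_space 2 by (auto simp: order_trace_def)
      then show ?thesis using openin_min_space_notin[OF K.mem_carrier[OF a]] by simp
    qed
  next
    have "order_trace ` topspace (min_space G) \<subseteq> topspace (right_order_space GK)"
      unfolding topspace_min_space topspace_right_order_space using R by blast
    then show "order_trace ` topspace (min_space G) \<subseteq>
      \<Union>({{C \<in> right_orders GK. a \<in> C} |a. a \<in> carrier GK} \<union> {{C \<in> right_orders GK. a \<notin> C} |a. a \<in> carrier GK})"
      unfolding right_order_space_def topology_generated_by_topspace .
  qed
qed

lemma openin_right_order_space_finite:
  assumes "finite A" "A \<subseteq> K"
  shows "openin (right_order_space GK) {C \<in> right_orders GK. A \<subseteq> C}"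
  using assms
proof (induction A)
  case empty
  then show ?case using openin_topspace[of "right_order_space GK"] by (simp add: topspace_right_order_space)
next
  case (insert a A)
  have "openin (right_order_space GK) {C \<in> right_orders GK. a \<in> C}"
    unfolding right_order_space_def using insert.prems by (intro topology_generated_by_Basis) auto
  moreover have "{C \<in> right_orders GK. insert a A \<subseteq> C} = {C \<in> right_orders GK. a \<in> C} \<inter> {C \<in> right_orders GK. A \<subseteq> C}"
    by blast
  ultimately show ?case using insert by auto
qed

text \<open>If \<open>a\<close> is outside \<open>p\<close>, the finite set \<open>B\<close> of
  comparisons fixes a \<open>k\<close> in \<open>K\<close> congruent to \<open>a\<close>. Every
  trace order containing \<open>B\<close> belongs to a minimal prime \<open>q\<close> modulo which
  \<open>a\<close> is still congruent to \<open>k\<close>; were \<open>a\<close> in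
  \<open>q\<close>, then \<open>k\<close> would be a unit of an antisymmetric cone.\<close>

lemma openin_trace_image:
  assumes A: "A \<subseteq> carrier G"
  shows "openin OT
    (order_trace ` {p \<in> minimal_primes G. \<not> A \<subseteq> p})"
proof (subst openin_subopen, intro ballI)
  fix C assume "C \<in> order_trace ` {p \<in> minimal_primes G. \<not> A \<subseteq> p}"
  then obtain p a where p: "p \<in> minimal_primes G" "C = order_trace p" and a: "a \<in> A" "a \<notin> p" by blast
  have pS: "p \<in> Spec G" using p by (simp add: minimal_primes_def)
  note P = prime_cone_up_cone[OF l_group pS]
  have ac: "a \<in> carrier G" using a A by blast
  then have "a \<in> lattice_closure G K" using gen by simp
  from lattice_closure_approx[OF P(1) sub this] obtain k B where k: "k \<in> K"
    and B: "finite B" "B \<subseteq> up_cone G p \<inter> K"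
    and app: "\<And>Q. \<lbrakk>prime_cone G Q; B \<subseteq> Q\<rbrakk> \<Longrightarrow> a \<otimes> inv k \<in> cone_units G Q" by blast
  have kc: "k \<in> carrier G" using k K.mem_carrier by blast
  have cong: "a \<otimes> inv k \<in> q" if "q \<in> Spec G" "B \<subseteq> up_cone G q" for q
    using app[of "up_cone G q"] prime_cone_up_cone[OF l_group that(1)] that(2) by simp
  \<comment> \<open>Otherwise the congruence would put \<open>a\<close> itself into
    \<open>p\<close>.\<close>
  have kn: "k \<noteq> \<one>" using cong[OF pS] B(2) a(2) ac by auto
  let ?W = "{D \<in> right_orders GK. B \<subseteq> D} \<inter> trace_orders"
  have "openin OT ?W"
    using openin_right_order_space_finite[OF B(1)] B(2) unfolding openin_subtopology by blast
  moreover have "C \<in> ?W"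
    using trace_in_trace_orders[OF p(1)] p(2) B(2) by (auto simp: trace_orders_def order_trace_def)
  moreover have "?W \<subseteq> order_trace ` {p \<in> minimal_primes G. \<not> A \<subseteq> p}"
  proof
    fix D assume D: "D \<in> ?W"
    then obtain q where q: "q \<in> minimal_primes G" "order_trace q = D" using trace_orders_lift by blast
    have qS: "q \<in> Spec G" using q by (simp add: minimal_primes_def)
    note Q = prime_cone_up_cone[OF l_group qS]
    have DR: "D \<in> right_orders GK" and "B \<subseteq> up_cone G q" using D q(2) by (auto simp: order_trace_def)
    then have ak: "a \<otimes> inv k \<in> q" using cong[OF qS] by blast
    have "a \<notin> q"
    proof
      assume aq: "a \<in> q"
      have "subgroup q G" using qS unfolding Spec_def convex_l_subgroup_def by blast
      then have "inv (a \<otimes> inv k) \<otimes> a \<in> q" using ak aq by (simp add: subgroup.m_closed subgroup.m_inv_closed)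
      also have "inv (a \<otimes> inv k) \<otimes> a = k" using ac kc by (simp add: inv_mult_group m_assoc)
      finally have "k \<in> up_cone G q" "inv k \<in> up_cone G q" using Q(2) unfolding cone_units_def by blast+
      then have "k \<in> D" "inv k \<in> D" using q(2) k K.m_inv_closed[OF k] by (auto simp: order_trace_def)
      then show False using right_ordersD(5)[OF DR] kn by blast
    qed
    then show "D \<in> order_trace ` {p \<in> minimal_primes G. \<not> A \<subseteq> p}" using q a(1) by blast
  qed
  ultimately show "\<exists>T. openin OT T \<and> C \<in> T \<and>
    T \<subseteq> order_trace ` {p \<in> minimal_primes G. \<not> A \<subseteq> p}" by blast
qed

lemma bij_betw_trace: "bij_betw order_trace (minimal_primes G) trace_orders"
  unfolding bij_betw_def using trace_inj trace_in_trace_orders trace_orders_lift by blast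

lemma continuous_map_inv_trace:
  "continuous_map OT (min_space G)
    (inv_into (minimal_primes G) order_trace)"
proof -
  let ?g = "inv_into (minimal_primes G) order_trace"
  have g: "?g C \<in> minimal_primes G" "order_trace (?g C) = C" if "C \<in> trace_orders" for C
    using bij_betw_trace that by (auto simp: bij_betw_def inv_into_into f_inv_into_f)
  have gt: "?g (order_trace p) = p" if "p \<in> minimal_primes G" for p
    using trace_inj that by simp
  have "continuous_map OT (spec_space G) ?g"
    unfolding spec_space_def
  proof (rule continuous_on_generated_topo)
    fix U assume "U \<in> {{p \<in> Spec G. \<not> A \<subseteq> p} |A. A \<subseteq> carrier G}"
    then obtain A where A: "A \<subseteq> carrier G" "U = {p \<in> Spec G. \<not> A \<subseteq> p}" by blast
    \<comment> \<open>The preimage under the inverse of a bijection is a direct image, so openness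
      of \<open>order_trace\<close> is what continuity requires.\<close>
    have "?g -` U \<inter> trace_orders = order_trace ` {p \<in> minimal_primes G. \<not> A \<subseteq> p}"
    proof
      show "?g -` U \<inter> trace_orders \<subseteq> order_trace ` {p \<in> minimal_primes G. \<not> A \<subseteq> p}"
      proof
        fix C assume C: "C \<in> ?g -` U \<inter> trace_orders"
        then have "?g C \<in> {p \<in> minimal_primes G. \<not> A \<subseteq> p}" using g A by simp
        then have "order_trace (?g C) \<in> order_trace ` {p \<in> minimal_primes G. \<not> A \<subseteq> p}" by (rule imageI)
        then show "C \<in> order_trace ` {p \<in> minimal_primes G. \<not> A \<subseteq> p}" using g(2)[of C] C by simp
      qed
      show "order_trace ` {p \<in> minimal_primes G. \<not> A \<subseteq> p} \<subseteq> ?g -` U \<inter> trace_orders"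
      proof
        fix C assume "C \<in> order_trace ` {p \<in> minimal_primes G. \<not> A \<subseteq> p}"
        then obtain p where p: "p \<in> minimal_primes G" "\<not> A \<subseteq> p" "C = order_trace p" by blast
        then have "p \<in> Spec G" by (simp add: minimal_primes_def)
        then show "C \<in> ?g -` U \<inter> trace_orders"
          using gt[OF p(1)] trace_in_trace_orders[OF p(1)] p A(2) by simp
      qed
    qed
    then show "openin OT
      (?g -` U \<inter> topspace OT)"
      unfolding topspace_trace_orders using openin_trace_image[OF A(1)] by simp
  next
    have "?g ` trace_orders \<subseteq> Spec G" using g(1) by (auto simp: minimal_primes_def)
    then show "?g ` topspace OT
      \<subseteq> \<Union>{{p \<in> Spec G. \<not> A \<subseteq> p} |A. A \<subseteq> carrier G}"
      unfolding topspace_trace_orders using topspace_spec_space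
      unfolding spec_space_def topology_generated_by_topspace by simp
  qed
  then show ?thesis
    unfolding min_space_def continuous_map_in_subtopology topspace_trace_orders using g(1) by blast
qed

theorem min_space_homeomorphic_trace_orders:
  "min_space G homeomorphic_space subtopology (right_order_space GK) trace_orders"
  unfolding homeomorphic_space_def homeomorphic_maps_def
proof (intro exI conjI ballI)
  show "continuous_map (min_space G) OT order_trace"
    by (rule continuous_map_trace)
  show "continuous_map OT (min_space G)
    (inv_into (minimal_primes G) order_trace)"
    by (rule continuous_map_inv_trace)
  show "inv_into (minimal_primes G) order_trace (order_trace p) = p" if "p \<in> topspace (min_space G)" for p
    using trace_inj that topspace_min_space by simp
  show "order_trace (inv_into (minimal_primes G) order_trace C) = C"
    if "C \<in> topspace OT" for C
    using bij_betw_trace that topspace_trace_orders by (simp add: bij_betw_def f_inv_into_f)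
qed

end


section \<open>Homomorphisms of l-groups\<close>

lemma l_homD:
  assumes "h \<in> l_hom G H"
  shows "h \<in> hom G H" "x \<in> carrier G \<Longrightarrow> h x \<in> carrier H"
    "\<lbrakk>x \<in> carrier G; y \<in> carrier G\<rbrakk> \<Longrightarrow> h (x \<otimes>\<^bsub>G\<^esub> y) = h x \<otimes>\<^bsub>H\<^esub> h y"
    "\<lbrakk>x \<in> carrier G; y \<in> carrier G\<rbrakk> \<Longrightarrow> h (x \<squnion>\<^bsub>order_of G\<^esub> y) = h x \<squnion>\<^bsub>order_of H\<^esub> h y"
    "\<lbrakk>x \<in> carrier G; y \<in> carrier G\<rbrakk> \<Longrightarrow> h (x \<sqinter>\<^bsub>order_of G\<^esub> y) = h x \<sqinter>\<^bsub>order_of H\<^esub> h y"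
  using assms unfolding l_hom_def hom_def by blast+

lemma l_hom_comp:
  assumes f: "f \<in> l_hom G H" and g: "g \<in> l_hom H L"
  shows "(\<lambda>x. g (f x)) \<in> l_hom G L"
  unfolding l_hom_def hom_def
  by (simp add: l_homD[OF f] l_homD[OF g])

lemma l_hom_restrict:
  assumes G: "l_group G" and f: "f \<in> l_hom G H"
  shows "restrict f (carrier G) \<in> l_hom G H"
proof -
  interpret l_group G by fact
  show ?thesis
    unfolding l_hom_def hom_def
    by (simp add: l_homD[OF f] sup_closed inf_closed)
qed

lemma l_hom_one:
  assumes "l_group G" "l_group H" "h \<in> l_hom G H"
  shows "h \<one>\<^bsub>G\<^esub> = \<one>\<^bsub>H\<^esub>"
proof -
  interpret G: l_group G by fact
  interpret H: l_group H by fact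
  show ?thesis using hom_one[OF l_homD(1)[OF assms(3)] G.is_group H.is_group] .
qed

lemma l_hom_inv:
  assumes "l_group G" "l_group H" "h \<in> l_hom G H" "x \<in> carrier G"
  shows "h (inv\<^bsub>G\<^esub> x) = inv\<^bsub>H\<^esub> h x"
proof -
  interpret G: l_group G by fact
  interpret H: l_group H by fact
  interpret group_hom G H h
    by unfold_locales (rule l_homD(1)[OF assms(3)])
  show ?thesis using hom_inv[OF assms(4)] .
qed

lemma l_hom_mono:
  assumes "l_group G" "l_group H" "h \<in> l_hom G H" "x \<in> carrier G" "y \<in> carrier G" "x \<preceq>\<^bsub>G\<^esub> y"
  shows "h x \<preceq>\<^bsub>H\<^esub> h y"
proof -
  interpret G: l_group G by fact
  interpret H: l_group H by fact
  have "h x = h x \<sqinter>\<^bsub>order_of H\<^esub> h y"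
    using G.inf_absorb1[of x y] l_homD(5)[OF assms(3), of x y] assms by simp
  then show ?thesis using H.inf_le2[of "h x" "h y"] l_homD(2)[OF assms(3)] assms by simp
qed

text \<open>Surjectivity allows an arbitrary upper or lower bound in \<open>H\<close> to be pulled
  back to \<open>G\<close>, where the join or meet is known to be the best one.\<close>

lemma l_hom_of_order_iso:
  assumes "l_group G" "l_group H" and h: "h \<in> hom G H" and onto: "h ` carrier G = carrier H"
    and le: "\<And>x y. \<lbrakk>x \<in> carrier G; y \<in> carrier G\<rbrakk> \<Longrightarrow> h x \<preceq>\<^bsub>H\<^esub> h y \<longleftrightarrow> x \<preceq>\<^bsub>G\<^esub> y"
  shows "h \<in> l_hom G H"
proof -
  interpret G: l_group G by fact
  interpret H: l_group H by fact
  have c: "h x \<in> carrier H" if "x \<in> carrier G" for x using onto that by blast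
  show ?thesis
    unfolding l_hom_def
  proof (intro CollectI conjI ballI h)
    fix x y assume xy: "x \<in> carrier G" "y \<in> carrier G"
    show "h (G.lsup x y) = H.lsup (h x) (h y)"
    proof (rule H.sup_eqI[symmetric])
      fix u assume u: "u \<in> carrier H" "h x \<preceq>\<^bsub>H\<^esub> u" "h y \<preceq>\<^bsub>H\<^esub> u"
      then obtain v where v: "v \<in> carrier G" "u = h v" using onto by blast
      then show "h (G.lsup x y) \<preceq>\<^bsub>H\<^esub> u"
        using u xy le G.sup_least[of x v y] by (simp add: G.sup_closed)
    qed (use xy c le in \<open>simp_all add: G.sup_closed G.sup_ge1 G.sup_ge2\<close>)
    show "h (G.linf x y) = H.linf (h x) (h y)"
    proof (rule H.inf_eqI[symmetric])
      fix u assume u: "u \<in> carrier H" "u \<preceq>\<^bsub>H\<^esub> h x" "u \<preceq>\<^bsub>H\<^esub> h y"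
      then obtain v where v: "v \<in> carrier G" "u = h v" using onto by blast
      then show "u \<preceq>\<^bsub>H\<^esub> h (G.linf x y)"
        using u xy le G.inf_greatest[of v x y] by (simp add: G.inf_closed)
    qed (use xy c le in \<open>simp_all add: G.inf_closed G.inf_le1 G.inf_le2\<close>)
  qed
qed

text \<open>The route by which a prime cone of a concrete l-group reaches the free one: it is pulled
  back along an l-homomorphism supplied by the universal property.\<close>

lemma prime_cone_vimage:
  assumes G: "l_group G" and H: "l_group H" and h: "h \<in> l_hom G H" and P: "prime_cone H P"
  shows "prime_cone G {x \<in> carrier G. h x \<in> P}"
    and "normal_cone H P \<Longrightarrow> normal_cone G {x \<in> carrier G. h x \<in> P}"
proof -
  let ?Q = "{x \<in> carrier G. h x \<in> P}"
  interpret G: l_group G by fact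
  interpret H: l_group H by fact
  note T = prime_coneD(1)[OF P]
  note D = total_coneD[OF T]
  note hD = l_homD[OF h]
  have hi: "h (inv\<^bsub>G\<^esub> x) = inv\<^bsub>H\<^esub> h x" if "x \<in> carrier G" for x
    using l_hom_inv[OF G H h that] .
  show "prime_cone G ?Q"
    unfolding prime_cone_def total_cone_def
  proof (intro conjI ballI impI)
    show "x \<in> ?Q" if "x \<in> carrier G" "\<one>\<^bsub>G\<^esub> \<preceq>\<^bsub>G\<^esub> x" for x
      using that l_hom_mono[OF G H h _ that(1), of "\<one>\<^bsub>G\<^esub>"] l_hom_one[OF G H h] D(2)[of "h x"] hD(2) by simp
    show "x \<otimes>\<^bsub>G\<^esub> y \<in> ?Q"
      if "x \<in> ?Q" "y \<in> ?Q" for x y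
      using that D(3) hD(3) by simp
    show "G.linf x y \<in> ?Q"
      if "x \<in> ?Q" "y \<in> ?Q" for x y
      using that prime_coneD(2)[OF P] hD(5) by (simp add: G.inf_closed)
    show "x \<in> ?Q \<or> inv\<^bsub>G\<^esub> x \<in> ?Q" if "x \<in> carrier G" for x
      using that D(4)[of "h x"] hD(2) hi by simp
  qed blast
  show "normal_cone G ?Q" if "normal_cone H P"
    using that unfolding normal_cone_def by (simp add: hD hi)
qed

section \<open>Intrinsic description of the varieties\<close>

text \<open>Representability without factors: normal prime cones correspond to totally ordered
  quotients, and these must jointly detect positivity. This form is easily transported along
  injective l-homomorphisms between different element types.\<close>

definition normal_prime_separated :: "('a, 'b) ogroup_scheme \<Rightarrow> bool" where
  "normal_prime_separated G \<longleftrightarrow>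
    (\<forall>x\<in>carrier G. (\<forall>P. prime_cone G P \<longrightarrow> normal_cone G P \<longrightarrow> x \<in> P) \<longrightarrow> \<one>\<^bsub>G\<^esub> \<preceq>\<^bsub>G\<^esub> x)"

lemma normal_prime_separated_vimage:
  assumes G: "l_group G" and H: "l_group H" and h: "h \<in> l_hom G H" and inj: "inj_on h (carrier G)"
    and sep: "normal_prime_separated H"
  shows "normal_prime_separated G"
  unfolding normal_prime_separated_def
proof (intro ballI impI)
  interpret G: l_group G by fact
  interpret H: l_group H by fact
  fix x assume x: "x \<in> carrier G" and all: "\<forall>P. prime_cone G P \<longrightarrow> normal_cone G P \<longrightarrow> x \<in> P"
  have hx: "h x \<in> carrier H" using l_homD(2)[OF h x] .
  have "h x \<in> P" if P: "prime_cone H P" "normal_cone H P" for P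
    using all prime_cone_vimage[OF G H h P(1)] P(2) by blast
  then have "\<one>\<^bsub>H\<^esub> \<preceq>\<^bsub>H\<^esub> h x" using sep hx unfolding normal_prime_separated_def by blast
  then have "h (G.linf \<one>\<^bsub>G\<^esub> x) = h \<one>\<^bsub>G\<^esub>"
    using l_homD(5)[OF h] x hx l_hom_one[OF G H h] H.inf_absorb1[of "\<one>\<^bsub>H\<^esub>" "h x"] by simp
  then have "G.linf \<one>\<^bsub>G\<^esub> x = \<one>\<^bsub>G\<^esub>" using inj x by (simp add: inj_on_def G.inf_closed)
  then show "\<one>\<^bsub>G\<^esub> \<preceq>\<^bsub>G\<^esub> x" using G.le_iff_inf[of "\<one>\<^bsub>G\<^esub>" x] x by simp
qed

text \<open>In a totally ordered quotient one of two orthogonal elements becomes trivial, and then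
  so does its conjugate. Hence the meet in question is at most \<open>\<one>\<close> modulo every
  normal prime cone, and separation makes it so in \<open>G\<close>.\<close>

lemma conj_orthogonal_if_normal_prime_separated:
  fixes G (structure)
  assumes G: "l_group G" and sep: "normal_prime_separated G"
  shows "conj_orthogonal G"
  unfolding conj_orthogonal_def
proof (intro ballI impI)
  interpret l_group G by fact
  fix x y g assume c: "x \<in> carrier G" "y \<in> carrier G" "g \<in> carrier G"
    and pos: "\<one> \<preceq> x" "\<one> \<preceq> y" and xy: "linf x y = \<one>"
  let ?x = "g \<otimes> x \<otimes> inv g"
  let ?z = "linf ?x y"
  have xc: "?x \<in> carrier G" using c by simp
  have zc: "?z \<in> carrier G" using c by (simp add: inf_closed)
  have "inv ?z \<in> P" if P: "prime_cone G P" "normal_cone G P" for P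
  proof -
    note T = prime_coneD(1)[OF P(1)]
    note D = total_coneD[OF T]
    \<comment> \<open>If \<open>a\<close> is the smaller element modulo \<open>P\<close>, it is
      congruent to the meet of \<open>a\<close> and \<open>b\<close>, which is
      \<open>\<one>\<close>.\<close>
    have key: "inv a \<in> P"
      if "linf a b = \<one>" "b \<otimes> inv a \<in> P" "a \<in> carrier G" "b \<in> carrier G" for a b
    proof -
      have "linf (b \<otimes> inv a) \<one> \<in> P"
        using prime_coneD(2)[OF P(1)] that total_cone_one[OF T] by blast
      moreover have "linf (b \<otimes> inv a) \<one> = linf a b \<otimes> inv a"
        using that(3,4) inf_commute[of "b \<otimes> inv a" "\<one>"] by (simp add: mult_inf_distrib_right)
      ultimately show ?thesis using that by simp
    qed
    have "y \<otimes> inv x \<in> P \<or> x \<otimes> inv y \<in> P"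
      using D(4)[of "y \<otimes> inv x"] c by (simp add: inv_mult_group)
    then have "inv x \<in> P \<or> inv y \<in> P"
      using key[of x y] key[of y x] xy c inf_commute[of x y] by auto
    then show "inv ?z \<in> P"
    proof
      assume "inv x \<in> P"
      then have "g \<otimes> inv x \<otimes> inv g \<in> P" using P(2) c unfolding normal_cone_def by blast
      also have "g \<otimes> inv x \<otimes> inv g = inv ?x" using c by (simp add: inv_mult_group m_assoc)
      finally have "inv ?x \<in> P" .
      moreover have "inv ?x \<preceq> inv ?z" using inv_inf[OF xc c(2)] sup_ge1 xc c by simp
      ultimately show ?thesis using total_cone_upward[OF T] zc by simp
    next
      assume "inv y \<in> P"
      moreover have "inv y \<preceq> inv ?z" using inv_inf[OF xc c(2)] sup_ge2 xc c by simp
      ultimately show ?thesis using total_cone_upward[OF T] zc by simp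
    qed
  qed
  then have "\<one> \<preceq> inv ?z" using sep zc unfolding normal_prime_separated_def by simp
  then have "?z \<preceq> \<one>" using one_le_inv_iff zc by simp
  moreover have "\<one> \<preceq> ?z" using one_le_conj[OF pos(1)] pos(2) c by (simp add: inf_greatest)
  ultimately show "?z = \<one>" using ole_antisym zc by simp
qed

lemma conj_orthogonal_if_comm:
  fixes G (structure)
  assumes "l_group G" "comm_group G"
  shows "conj_orthogonal G"
proof -
  interpret l_group G by fact
  interpret comm_group G by fact
  have "g \<otimes> x \<otimes> inv g = x" if "x \<in> carrier G" "g \<in> carrier G" for x g
    using that by (simp add: m_comm[of g x] m_assoc)
  then show ?thesis unfolding conj_orthogonal_def by simp
qed

section \<open>Copies and l-subgroups\<close>

text \<open>Transport of structure along an injection. The universal property is stated at a single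
  element type, so every target group is first copied into that type.\<close>

definition copy_ogroup :: "('a \<Rightarrow> 'b) \<Rightarrow> 'a ogroup \<Rightarrow> 'b ogroup" where
  "copy_ogroup e H = (let d = inv_into (carrier H) e in
    \<lparr>carrier = e ` carrier H, mult = (\<lambda>x y. e (d x \<otimes>\<^bsub>H\<^esub> d y)), one = e \<one>\<^bsub>H\<^esub>,
     ole = (\<lambda>x y. d x \<preceq>\<^bsub>H\<^esub> d y)\<rparr>)"

lemma copy_ogroup:
  fixes H :: "'a ogroup" and e :: "'a \<Rightarrow> 'b"
  assumes H: "l_group H" and inj: "inj_on e (carrier H)"
  defines "d \<equiv> inv_into (carrier H) e" and "H' \<equiv> copy_ogroup e H"
  shows "l_group H'" "e \<in> l_hom H H'" "d \<in> l_hom H' H" "inj_on d (carrier H')"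
    "\<And>x. x \<in> carrier H \<Longrightarrow> d (e x) = x"
proof -
  interpret H: l_group H by fact
  show de: "d (e x) = x" if "x \<in> carrier H" for x using inj that by (simp add: d_def)
  have sel: "carrier H' = e ` carrier H" "\<And>x y. x \<otimes>\<^bsub>H'\<^esub> y = e (d x \<otimes>\<^bsub>H\<^esub> d y)" "\<one>\<^bsub>H'\<^esub> = e \<one>\<^bsub>H\<^esub>"
    "\<And>x y. x \<preceq>\<^bsub>H'\<^esub> y \<longleftrightarrow> d x \<preceq>\<^bsub>H\<^esub> d y"
    by (simp_all add: H'_def copy_ogroup_def d_def Let_def)
  have ed: "e (d a) = a" and dc: "d a \<in> carrier H" if "a \<in> carrier H'" for a
    using that de by (auto simp: sel)
  have ec: "e x \<in> carrier H'" if "x \<in> carrier H" for x using that by (simp add: sel)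
  have G: "group H'"
  proof (rule groupI)
    fix a b c assume abc: "a \<in> carrier H'" "b \<in> carrier H'" "c \<in> carrier H'"
    show "a \<otimes>\<^bsub>H'\<^esub> b \<in> carrier H'" using abc dc ec by (simp add: sel(2))
    show "a \<otimes>\<^bsub>H'\<^esub> b \<otimes>\<^bsub>H'\<^esub> c = a \<otimes>\<^bsub>H'\<^esub> (b \<otimes>\<^bsub>H'\<^esub> c)" using abc dc by (simp add: sel(2) de H.m_assoc)
  next
    show "\<one>\<^bsub>H'\<^esub> \<in> carrier H'" by (simp add: sel)
    fix a assume a: "a \<in> carrier H'"
    show "\<one>\<^bsub>H'\<^esub> \<otimes>\<^bsub>H'\<^esub> a = a" using a dc ed by (simp add: sel(2,3) de)
    have "e (inv\<^bsub>H\<^esub> d a) \<otimes>\<^bsub>H'\<^esub> a = \<one>\<^bsub>H'\<^esub>" using a dc by (simp add: sel(2,3) de)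
    then show "\<exists>b\<in>carrier H'. b \<otimes>\<^bsub>H'\<^esub> a = \<one>\<^bsub>H'\<^esub>" using ec a dc by blast
  qed
  have po: "po_group H'"
  proof (rule po_groupI[OF G])
    fix a b c t assume abc: "a \<in> carrier H'" "b \<in> carrier H'" "c \<in> carrier H'"
    show "a \<preceq>\<^bsub>H'\<^esub> a" using abc dc by (simp add: sel(4) H.ole_refl)
    show "a = b" if "a \<preceq>\<^bsub>H'\<^esub> b" "b \<preceq>\<^bsub>H'\<^esub> a"
    proof -
      have "d a = d b" using that abc dc by (simp add: sel(4) H.ole_antisym)
      then show ?thesis using ed abc by metis
    qed
    show "a \<preceq>\<^bsub>H'\<^esub> c" if "a \<preceq>\<^bsub>H'\<^esub> b" "b \<preceq>\<^bsub>H'\<^esub> c"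
      using that H.ole_trans[of "d a" "d b" "d c"] abc dc by (simp add: sel(4))
    assume "t \<in> carrier H'" "a \<preceq>\<^bsub>H'\<^esub> b"
    then show "c \<otimes>\<^bsub>H'\<^esub> a \<otimes>\<^bsub>H'\<^esub> t \<preceq>\<^bsub>H'\<^esub> c \<otimes>\<^bsub>H'\<^esub> b \<otimes>\<^bsub>H'\<^esub> t"
      using abc dc by (simp add: sel(2,4) de H.mult_mono)
  qed
  show L: "l_group H'"
  proof (rule l_groupI[OF po])
    fix a b assume ab: "a \<in> carrier H'" "b \<in> carrier H'"
    show "\<exists>z\<in>carrier H'. a \<preceq>\<^bsub>H'\<^esub> z \<and> b \<preceq>\<^bsub>H'\<^esub> z \<and> (\<forall>u\<in>carrier H'. a \<preceq>\<^bsub>H'\<^esub> u \<and> b \<preceq>\<^bsub>H'\<^esub> u \<longrightarrow> z \<preceq>\<^bsub>H'\<^esub> u)"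
      using ab dc ec de
      by (intro bexI[of _ "e (H.lsup (d a) (d b))"])
        (simp_all add: sel(4) H.sup_closed H.sup_ge1 H.sup_ge2 H.sup_least)
    show "\<exists>z\<in>carrier H'. z \<preceq>\<^bsub>H'\<^esub> a \<and> z \<preceq>\<^bsub>H'\<^esub> b \<and> (\<forall>u\<in>carrier H'. u \<preceq>\<^bsub>H'\<^esub> a \<and> u \<preceq>\<^bsub>H'\<^esub> b \<longrightarrow> u \<preceq>\<^bsub>H'\<^esub> z)"
      using ab dc ec de
      by (intro bexI[of _ "e (H.linf (d a) (d b))"])
        (simp_all add: sel(4) H.inf_closed H.inf_le1 H.inf_le2 H.inf_greatest)
  qed
  show "e \<in> l_hom H H'"
    by (rule l_hom_of_order_iso[OF H L]) (simp_all add: hom_def sel de)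
  show "d \<in> l_hom H' H"
  proof (rule l_hom_of_order_iso[OF L H])
    show "d \<in> hom H' H" using dc by (simp add: hom_def sel(2) de)
    show "d ` carrier H' = carrier H" by (simp add: sel(1) image_image de)
  qed (simp add: sel(4))
  show "inj_on d (carrier H')" using ed by (rule inj_on_inverseI)
qed

lemma sub_l_group:
  fixes G :: "('a, 'b) ogroup_scheme" (structure)
  assumes G: "l_group G" and S: "subgroup S G"
    and cl: "\<And>x y. \<lbrakk>x \<in> S; y \<in> S\<rbrakk> \<Longrightarrow> x \<squnion>\<^bsub>order_of G\<^esub> y \<in> S \<and> x \<sqinter>\<^bsub>order_of G\<^esub> y \<in> S"
  shows "l_group (G\<lparr>carrier := S\<rparr>)" "(\<lambda>x. x) \<in> l_hom (G\<lparr>carrier := S\<rparr>) G"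
proof -
  interpret l_group G by fact
  interpret S: subgroup S G by fact
  let ?S = "G\<lparr>carrier := S\<rparr>"
  have sup: "\<exists>z\<in>carrier ?S. x \<preceq>\<^bsub>?S\<^esub> z \<and> y \<preceq>\<^bsub>?S\<^esub> z \<and> (\<forall>u\<in>carrier ?S. x \<preceq>\<^bsub>?S\<^esub> u \<and> y \<preceq>\<^bsub>?S\<^esub> u \<longrightarrow> z \<preceq>\<^bsub>?S\<^esub> u)"
    if "x \<in> carrier ?S" "y \<in> carrier ?S" for x y
    using that cl[of x y] S.mem_carrier
    by (intro bexI[of _ "x \<curlyvee> y"]) (simp_all add: sup_ge1 sup_ge2 sup_least)
  have inf: "\<exists>z\<in>carrier ?S. z \<preceq>\<^bsub>?S\<^esub> x \<and> z \<preceq>\<^bsub>?S\<^esub> y \<and> (\<forall>u\<in>carrier ?S. u \<preceq>\<^bsub>?S\<^esub> x \<and> u \<preceq>\<^bsub>?S\<^esub> y \<longrightarrow> u \<preceq>\<^bsub>?S\<^esub> z)"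
    if "x \<in> carrier ?S" "y \<in> carrier ?S" for x y
    using that cl[of x y] S.mem_carrier
    by (intro bexI[of _ "x \<curlywedge> y"]) (simp_all add: inf_le1 inf_le2 inf_greatest)
  show L: "l_group ?S" by (rule l_groupI[OF po_group_subgroup[OF S] sup inf])
  interpret S': l_group ?S by (rule L)
  have "S'.lsup x y = x \<curlyvee> y" if "x \<in> S" "y \<in> S" for x y
    using that cl[of x y] S.mem_carrier
    by (intro S'.sup_eqI) (simp_all add: sup_ge1 sup_ge2 sup_least)
  moreover have "S'.linf x y = x \<curlywedge> y" if "x \<in> S" "y \<in> S" for x y
    using that cl[of x y] S.mem_carrier
    by (intro S'.inf_eqI) (simp_all add: inf_le1 inf_le2 inf_greatest)
  ultimately show "(\<lambda>x. x) \<in> l_hom ?S G" unfolding l_hom_def hom_def using S.mem_carrier by auto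
qed


section \<open>Representable l-groups\<close>

lemma product_ogroup_simps:
  "carrier (product_ogroup I T) = (\<Pi>\<^sub>E i\<in>I. carrier (T i))"
  "x \<otimes>\<^bsub>product_ogroup I T\<^esub> y = (\<lambda>i\<in>I. x i \<otimes>\<^bsub>T i\<^esub> y i)"
  "\<one>\<^bsub>product_ogroup I T\<^esub> = (\<lambda>i\<in>I. \<one>\<^bsub>T i\<^esub>)"
  "x \<preceq>\<^bsub>product_ogroup I T\<^esub> y \<longleftrightarrow> (\<forall>i\<in>I. x i \<preceq>\<^bsub>T i\<^esub> y i)"
  by (simp_all add: product_ogroup_def product_group_def monoid.defs)

section \<open>Products of totally ordered groups\<close>

context
  fixes I :: "'i set" and T :: "'i \<Rightarrow> ('b, 'c) ogroup_scheme"
  assumes tot: "\<And>i. i \<in> I \<Longrightarrow> to_group (T i)"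
begin

private abbreviation (input) PT where "PT \<equiv> product_ogroup I T"

lemma factor_po_group: "i \<in> I \<Longrightarrow> po_group (T i)"
  using tot to_group.axioms(1) by blast

lemma factor_group: "i \<in> I \<Longrightarrow> group (T i)"
  using factor_po_group po_group.axioms(1) by blast

lemma po_group_product: "po_group PT"
proof (rule po_groupI)
  show "group PT"
  proof (rule groupI)
    fix x y z assume c: "x \<in> carrier PT" "y \<in> carrier PT" "z \<in> carrier PT"
    then have ci: "x i \<in> carrier (T i)" "y i \<in> carrier (T i)" "z i \<in> carrier (T i)" if "i \<in> I" for i
      using that by (auto simp: product_ogroup_simps)
    show "x \<otimes>\<^bsub>PT\<^esub> y \<in> carrier PT"
      using ci factor_group by (simp add: product_ogroup_simps group.is_monoid monoid.m_closed)
    show "x \<otimes>\<^bsub>PT\<^esub> y \<otimes>\<^bsub>PT\<^esub> z = x \<otimes>\<^bsub>PT\<^esub> (y \<otimes>\<^bsub>PT\<^esub> z)"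
      using ci factor_group by (auto simp: product_ogroup_simps group.is_monoid monoid.m_assoc intro!: restrict_ext)
  next
    show "\<one>\<^bsub>PT\<^esub> \<in> carrier PT" using factor_group by (simp add: product_ogroup_simps group.is_monoid)
    fix x assume c: "x \<in> carrier PT"
    then have ci: "x i \<in> carrier (T i)" if "i \<in> I" for i using that by (auto simp: product_ogroup_simps)
    have x: "x = (\<lambda>i\<in>I. x i)" using c by (auto simp: product_ogroup_simps PiE_restrict)
    have "(\<lambda>i\<in>I. \<one>\<^bsub>T i\<^esub> \<otimes>\<^bsub>T i\<^esub> x i) = (\<lambda>i\<in>I. x i)"
      using ci factor_group by (intro restrict_ext) (simp add: group.is_monoid)
    then show "\<one>\<^bsub>PT\<^esub> \<otimes>\<^bsub>PT\<^esub> x = x"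
      using x by (simp add: product_ogroup_simps cong: restrict_cong)
    have "(\<lambda>i\<in>I. inv\<^bsub>T i\<^esub> x i) \<in> carrier PT"
      using ci factor_group by (simp add: product_ogroup_simps)
    moreover have "(\<lambda>i\<in>I. inv\<^bsub>T i\<^esub> x i) \<otimes>\<^bsub>PT\<^esub> x = \<one>\<^bsub>PT\<^esub>"
      using ci factor_group by (auto simp: product_ogroup_simps group.l_inv intro!: restrict_ext)
    ultimately show "\<exists>y\<in>carrier PT. y \<otimes>\<^bsub>PT\<^esub> x = \<one>\<^bsub>PT\<^esub>" by blast
  qed
next
  fix x y z w assume c: "x \<in> carrier PT" "y \<in> carrier PT"
  then have ci: "x i \<in> carrier (T i)" "y i \<in> carrier (T i)" if "i \<in> I" for i
    using that by (auto simp: product_ogroup_simps)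
  show "x = y" if "x \<preceq>\<^bsub>PT\<^esub> y" "y \<preceq>\<^bsub>PT\<^esub> x"
  proof (rule PiE_ext[of x I "\<lambda>i. carrier (T i)" y])
    fix i assume i: "i \<in> I"
    show "x i = y i" using po_group.ole_antisym[OF factor_po_group[OF i]] ci[OF i] that i by (simp add: product_ogroup_simps)
  qed (use c in \<open>auto simp: product_ogroup_simps\<close>)
  show "x \<preceq>\<^bsub>PT\<^esub> x" using ci factor_po_group by (simp add: product_ogroup_simps po_group.ole_refl)
  assume z: "z \<in> carrier PT"
  then have zi: "z i \<in> carrier (T i)" if "i \<in> I" for i using that by (auto simp: product_ogroup_simps)
  show "x \<preceq>\<^bsub>PT\<^esub> z" if "x \<preceq>\<^bsub>PT\<^esub> y" "y \<preceq>\<^bsub>PT\<^esub> z"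
    unfolding product_ogroup_simps
  proof
    fix i assume i: "i \<in> I"
    show "x i \<preceq>\<^bsub>T i\<^esub> z i"
      using po_group.ole_trans[OF factor_po_group[OF i], of "x i" "y i" "z i"] ci[OF i] zi[OF i] that i
      by (simp add: product_ogroup_simps)
  qed
  assume w: "w \<in> carrier PT" and xy: "x \<preceq>\<^bsub>PT\<^esub> y"
  then have wi: "w i \<in> carrier (T i)" if "i \<in> I" for i using that by (auto simp: product_ogroup_simps)
  show "z \<otimes>\<^bsub>PT\<^esub> x \<otimes>\<^bsub>PT\<^esub> w \<preceq>\<^bsub>PT\<^esub> z \<otimes>\<^bsub>PT\<^esub> y \<otimes>\<^bsub>PT\<^esub> w"
    using xy ci zi wi factor_po_group by (simp add: product_ogroup_simps po_group.mult_mono)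
qed

lemma product_upper:
  assumes x: "x \<in> carrier PT" and y: "y \<in> carrier PT"
  defines "z \<equiv> (\<lambda>i\<in>I. if x i \<preceq>\<^bsub>T i\<^esub> y i then y i else x i)"
  shows "z \<in> carrier PT" "x \<preceq>\<^bsub>PT\<^esub> z" "y \<preceq>\<^bsub>PT\<^esub> z"
    "\<And>u. \<lbrakk>x \<preceq>\<^bsub>PT\<^esub> u; y \<preceq>\<^bsub>PT\<^esub> u\<rbrakk> \<Longrightarrow> z \<preceq>\<^bsub>PT\<^esub> u"
proof -
  have ci: "x i \<in> carrier (T i)" "y i \<in> carrier (T i)" if "i \<in> I" for i
    using that x y by (auto simp: product_ogroup_simps)
  have r: "x i \<preceq>\<^bsub>T i\<^esub> x i" "y i \<preceq>\<^bsub>T i\<^esub> y i" "x i \<preceq>\<^bsub>T i\<^esub> y i \<or> y i \<preceq>\<^bsub>T i\<^esub> x i" if "i \<in> I" for i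
    using that ci factor_po_group tot by (simp_all add: po_group.ole_refl to_group.ole_total)
  show "z \<in> carrier PT" using ci by (simp add: product_ogroup_simps z_def)
  show "x \<preceq>\<^bsub>PT\<^esub> z" using r by (simp add: product_ogroup_simps z_def)
  show "y \<preceq>\<^bsub>PT\<^esub> z" using r by (auto simp: product_ogroup_simps z_def)
  show "z \<preceq>\<^bsub>PT\<^esub> u" if "x \<preceq>\<^bsub>PT\<^esub> u" "y \<preceq>\<^bsub>PT\<^esub> u" for u
    using that by (simp add: product_ogroup_simps z_def)
qed

lemma product_lower:
  assumes x: "x \<in> carrier PT" and y: "y \<in> carrier PT"
  defines "z \<equiv> (\<lambda>i\<in>I. if x i \<preceq>\<^bsub>T i\<^esub> y i then x i else y i)"
  shows "z \<in> carrier PT" "z \<preceq>\<^bsub>PT\<^esub> x" "z \<preceq>\<^bsub>PT\<^esub> y"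
    "\<And>u. \<lbrakk>u \<preceq>\<^bsub>PT\<^esub> x; u \<preceq>\<^bsub>PT\<^esub> y\<rbrakk> \<Longrightarrow> u \<preceq>\<^bsub>PT\<^esub> z"
proof -
  have ci: "x i \<in> carrier (T i)" "y i \<in> carrier (T i)" if "i \<in> I" for i
    using that x y by (auto simp: product_ogroup_simps)
  have r: "x i \<preceq>\<^bsub>T i\<^esub> x i" "y i \<preceq>\<^bsub>T i\<^esub> y i" "x i \<preceq>\<^bsub>T i\<^esub> y i \<or> y i \<preceq>\<^bsub>T i\<^esub> x i" if "i \<in> I" for i
    using that ci factor_po_group tot by (simp_all add: po_group.ole_refl to_group.ole_total)
  show "z \<in> carrier PT" using ci by (simp add: product_ogroup_simps z_def)
  show "z \<preceq>\<^bsub>PT\<^esub> x" using r by (auto simp: product_ogroup_simps z_def)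
  show "z \<preceq>\<^bsub>PT\<^esub> y" using r by (simp add: product_ogroup_simps z_def)
  show "u \<preceq>\<^bsub>PT\<^esub> z" if "u \<preceq>\<^bsub>PT\<^esub> x" "u \<preceq>\<^bsub>PT\<^esub> y" for u
    using that by (simp add: product_ogroup_simps z_def)
qed

lemma l_group_product: "l_group PT"
proof (rule l_groupI[OF po_group_product])
  fix x y assume xy: "x \<in> carrier PT" "y \<in> carrier PT"
  show "\<exists>z\<in>carrier PT. x \<preceq>\<^bsub>PT\<^esub> z \<and> y \<preceq>\<^bsub>PT\<^esub> z \<and>
      (\<forall>u\<in>carrier PT. x \<preceq>\<^bsub>PT\<^esub> u \<and> y \<preceq>\<^bsub>PT\<^esub> u \<longrightarrow> z \<preceq>\<^bsub>PT\<^esub> u)"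
    by (rule bexI[OF _ product_upper(1)[OF xy]]) (simp add: product_upper[OF xy])
  show "\<exists>z\<in>carrier PT. z \<preceq>\<^bsub>PT\<^esub> x \<and> z \<preceq>\<^bsub>PT\<^esub> y \<and>
      (\<forall>u\<in>carrier PT. u \<preceq>\<^bsub>PT\<^esub> x \<and> u \<preceq>\<^bsub>PT\<^esub> y \<longrightarrow> u \<preceq>\<^bsub>PT\<^esub> z)"
    by (rule bexI[OF _ product_lower(1)[OF xy]]) (simp add: product_lower[OF xy])
qed

lemma product_inf:
  assumes "x \<in> carrier PT" "y \<in> carrier PT"
  shows "x \<sqinter>\<^bsub>order_of PT\<^esub> y = (\<lambda>i\<in>I. if x i \<preceq>\<^bsub>T i\<^esub> y i then x i else y i)"
  using product_lower[OF assms] assms by (intro l_group.inf_eqI[OF l_group_product]) auto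

text \<open>The cone of a factor pulled back along the projection. Meets in the product are
  componentwise minima, so they remain in the cone.\<close>

lemma prime_cone_product_component:
  assumes i: "i \<in> I"
  shows "prime_cone PT {x \<in> carrier PT. \<one>\<^bsub>T i\<^esub> \<preceq>\<^bsub>T i\<^esub> x i}"
    and "normal_cone PT {x \<in> carrier PT. \<one>\<^bsub>T i\<^esub> \<preceq>\<^bsub>T i\<^esub> x i}"
proof -
  let ?P = "{x \<in> carrier PT. \<one>\<^bsub>T i\<^esub> \<preceq>\<^bsub>T i\<^esub> x i}"
  interpret Ti: to_group "T i" using tot[OF i] .
  interpret P: l_group PT by (rule l_group_product)
  have ci: "x i \<in> carrier (T i)" if "x \<in> carrier PT" for x using that i by (auto simp: product_ogroup_simps)
  have mi: "(x \<otimes>\<^bsub>PT\<^esub> y) i = x i \<otimes>\<^bsub>T i\<^esub> y i" for x y using i by (simp add: product_ogroup_simps)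
  have ii: "(inv\<^bsub>PT\<^esub> x) i = inv\<^bsub>T i\<^esub> (x i)" if x: "x \<in> carrier PT" for x
  proof -
    have "(inv\<^bsub>PT\<^esub> x \<otimes>\<^bsub>PT\<^esub> x) i = \<one>\<^bsub>T i\<^esub>" using x i by (simp add: P.l_inv product_ogroup_simps(3))
    then have "(inv\<^bsub>PT\<^esub> x) i \<otimes>\<^bsub>T i\<^esub> x i = \<one>\<^bsub>T i\<^esub>" by (simp only: mi)
    then show ?thesis using Ti.inv_equality ci[OF x] ci[OF P.inv_closed[OF x]] by metis
  qed
  show "prime_cone PT ?P"
    unfolding prime_cone_def total_cone_def
  proof (intro conjI ballI impI)
    show "x \<in> ?P" if "x \<in> carrier PT" "\<one>\<^bsub>PT\<^esub> \<preceq>\<^bsub>PT\<^esub> x" for x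
      using that i by (auto simp: product_ogroup_simps(3,4))
    show "x \<otimes>\<^bsub>PT\<^esub> y \<in> ?P"
      if "x \<in> ?P" "y \<in> ?P" for x y
      using that ci by (simp add: mi Ti.one_le_mult)
    show "x \<in> ?P \<or> inv\<^bsub>PT\<^esub> x \<in> ?P"
      if "x \<in> carrier PT" for x
      using that ci[OF that] Ti.ole_total[of "\<one>\<^bsub>T i\<^esub>" "x i"] by (auto simp: ii Ti.one_le_inv_iff)
    show "x \<sqinter>\<^bsub>order_of PT\<^esub> y \<in> ?P"
      if "x \<in> ?P" "y \<in> ?P" for x y
    proof -
      have "(x \<sqinter>\<^bsub>order_of PT\<^esub> y) i = (if x i \<preceq>\<^bsub>T i\<^esub> y i then x i else y i)"
        using product_inf that i by simp
      then show ?thesis using that P.inf_closed[of x y] by auto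
    qed
  qed blast
  show "normal_cone PT ?P"
    unfolding normal_cone_def using ci by (simp add: mi ii Ti.one_le_conj)
qed

lemma normal_prime_separated_product: "normal_prime_separated PT"
  unfolding normal_prime_separated_def
proof (intro ballI impI)
  fix x assume x: "x \<in> carrier PT" and all: "\<forall>P. prime_cone PT P \<longrightarrow> normal_cone PT P \<longrightarrow> x \<in> P"
  have "\<one>\<^bsub>T i\<^esub> \<preceq>\<^bsub>T i\<^esub> x i" if "i \<in> I" for i
    using all prime_cone_product_component[OF that] by blast
  then show "\<one>\<^bsub>PT\<^esub> \<preceq>\<^bsub>PT\<^esub> x" by (simp add: product_ogroup_simps(3,4))
qed

end

text \<open>The group of cosets of the units, ordered by \<open>P\<close> rather than by the order
  of \<open>G\<close>. Its elements have the type that \<open>representable\<close> prescribes for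
  the factors.\<close>

definition cone_quotient :: "('a, 'b) ogroup_scheme \<Rightarrow> 'a set \<Rightarrow> 'a set ogroup" where
  "cone_quotient G P =
    \<lparr>carrier = rcosets\<^bsub>G\<^esub> cone_units G P, mult = set_mult G, one = cone_units G P,
     ole = (\<lambda>c d. \<exists>x\<in>c. \<exists>y\<in>d. y \<otimes>\<^bsub>G\<^esub> inv\<^bsub>G\<^esub> x \<in> P)\<rparr>"

section \<open>Normal cones have totally ordered quotient groups\<close>

context
  fixes G :: "('a, 'b) ogroup_scheme" (structure) and P :: "'a set"
  assumes po_group: "po_group G" and cone: "total_cone G P" and nrm: "normal_cone G P"
begin

interpretation po_group G by (fact po_group)

private abbreviation (input) N where "N \<equiv> cone_units G P"
private abbreviation (input) Q where "Q \<equiv> cone_quotient G P"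

lemma normal_cone_units: "N \<lhd> G"
proof -
  note D = total_coneD[OF cone]
  have "subgroup N G"
  proof
    show "N \<subseteq> carrier G" using D(1) by (auto simp: cone_units_def)
    show "\<one> \<in> N" using total_cone_one[OF cone] by (simp add: cone_units_def)
    show "x \<otimes> y \<in> N" if "x \<in> N" "y \<in> N" for x y
      using that D(1,3) by (simp add: cone_units_def inv_mult_group)
    show "inv x \<in> N" if "x \<in> N" for x using that D(1) by (simp add: cone_units_def)
  qed
  moreover have "g \<otimes> x \<otimes> inv g \<in> N" if "x \<in> N" "g \<in> carrier G" for x g
  proof -
    have c: "x \<in> carrier G" "x \<in> P" "inv x \<in> P" using that D(1) by (auto simp: cone_units_def)
    have "inv (g \<otimes> x \<otimes> inv g) = g \<otimes> inv x \<otimes> inv g" using c that by (simp add: inv_mult_group m_assoc)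
    then show ?thesis using nrm c that unfolding normal_cone_def cone_units_def by simp
  qed
  ultimately show ?thesis unfolding normal_inv_iff by blast
qed

interpretation N: normal N G by (rule normal_cone_units)

lemma carrier_cone_quotient: "carrier Q = (\<lambda>x. N #> x) ` carrier G"
  by (auto simp: cone_quotient_def RCOSETS_def)

lemma cone_quotient_mult:
  "\<lbrakk>x \<in> carrier G; y \<in> carrier G\<rbrakk> \<Longrightarrow> (N #> x) \<otimes>\<^bsub>Q\<^esub> (N #> y) = N #> (x \<otimes> y)"
  by (simp add: cone_quotient_def N.rcos_sum)

lemma cone_quotient_one: "\<one>\<^bsub>Q\<^esub> = N #> \<one>"
  by (simp add: cone_quotient_def coset_mult_one[OF N.subset])

lemma cone_quotient_le:
  assumes xy: "x \<in> carrier G" "y \<in> carrier G"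
  shows "N #> x \<preceq>\<^bsub>Q\<^esub> N #> y \<longleftrightarrow> y \<otimes> inv x \<in> P"
proof
  note D = total_coneD[OF cone]
  assume "N #> x \<preceq>\<^bsub>Q\<^esub> N #> y"
  then obtain u v where u: "u \<in> N #> x" and v: "v \<in> N #> y" and uv: "v \<otimes> inv u \<in> P"
    by (auto simp: cone_quotient_def)
  obtain a where a: "a \<in> N" "u = a \<otimes> x" using u by (auto simp: r_coset_def)
  obtain b where b: "b \<in> N" "v = b \<otimes> y" using v by (auto simp: r_coset_def)
  have c: "a \<in> carrier G" "b \<in> carrier G" using a b N.mem_carrier by auto
  have "a \<in> P" "inv b \<in> P" using a b by (auto simp: cone_units_def)
  then have "inv b \<otimes> (v \<otimes> inv u) \<otimes> a \<in> P" using uv D(3) by blast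
  also have "inv b \<otimes> (v \<otimes> inv u) \<otimes> a = y \<otimes> inv x"
    using a b c xy by (simp add: inv_mult_group m_assoc cancel_left_inv)
  finally show "y \<otimes> inv x \<in> P" .
next
  assume "y \<otimes> inv x \<in> P"
  moreover have "x \<in> N #> x" "y \<in> N #> y" using xy rcos_self[OF _ N.subgroup_axioms] by auto
  ultimately show "N #> x \<preceq>\<^bsub>Q\<^esub> N #> y" by (auto simp: cone_quotient_def)
qed

lemma to_group_cone_quotient: "to_group Q"
proof (rule to_groupI)
  note D = total_coneD[OF cone]
  have rep: "\<exists>x\<in>carrier G. c = N #> x" if "c \<in> carrier Q" for c
    using that by (auto simp: carrier_cone_quotient)
  have mem: "N #> x \<in> carrier Q" if "x \<in> carrier G" for x
    using that by (simp add: carrier_cone_quotient)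
  have inv_swap: "inv (b \<otimes> inv a) = a \<otimes> inv b" if "a \<in> carrier G" "b \<in> carrier G" for a b
    using that by (simp add: inv_mult_group)
  show "po_group Q"
  proof (rule po_groupI)
    show "group Q"
    proof (rule groupI)
      fix a b c assume abc: "a \<in> carrier Q" "b \<in> carrier Q" "c \<in> carrier Q"
      obtain x y z where "x \<in> carrier G" "y \<in> carrier G" "z \<in> carrier G" "a = N #> x" "b = N #> y" "c = N #> z"
        using rep[OF abc(1)] rep[OF abc(2)] rep[OF abc(3)] by blast
      then show "a \<otimes>\<^bsub>Q\<^esub> b \<in> carrier Q" "a \<otimes>\<^bsub>Q\<^esub> b \<otimes>\<^bsub>Q\<^esub> c = a \<otimes>\<^bsub>Q\<^esub> (b \<otimes>\<^bsub>Q\<^esub> c)"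
        by (simp_all add: cone_quotient_mult mem m_assoc)
    next
      show "\<one>\<^bsub>Q\<^esub> \<in> carrier Q" by (simp add: cone_quotient_one mem)
      fix a assume "a \<in> carrier Q"
      then obtain x where x: "x \<in> carrier G" "a = N #> x" using rep by blast
      then show "\<one>\<^bsub>Q\<^esub> \<otimes>\<^bsub>Q\<^esub> a = a" by (simp add: cone_quotient_one cone_quotient_mult)
      have "(N #> inv x) \<otimes>\<^bsub>Q\<^esub> a = \<one>\<^bsub>Q\<^esub>" using x by (simp add: cone_quotient_one cone_quotient_mult)
      then show "\<exists>b\<in>carrier Q. b \<otimes>\<^bsub>Q\<^esub> a = \<one>\<^bsub>Q\<^esub>" using mem[of "inv x"] x by blast
    qed
  next
    fix a b assume ab: "a \<in> carrier Q" "b \<in> carrier Q"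
    obtain x y where xy: "x \<in> carrier G" "y \<in> carrier G" "a = N #> x" "b = N #> y"
      using rep[OF ab(1)] rep[OF ab(2)] by blast
    show "a \<preceq>\<^bsub>Q\<^esub> a" using xy total_cone_one[OF cone] by (simp add: cone_quotient_le)
    show "a = b" if "a \<preceq>\<^bsub>Q\<^esub> b" "b \<preceq>\<^bsub>Q\<^esub> a"
    proof -
      have "y \<otimes> inv x \<in> P" "x \<otimes> inv y \<in> P" using that xy by (simp_all add: cone_quotient_le)
      then have "y \<otimes> inv x \<in> N" using xy by (simp add: inv_swap cone_units_def)
      then have "y \<in> N #> x"
        using xy by (auto simp: r_coset_def m_assoc intro!: bexI[of _ "y \<otimes> inv x"])
      then show ?thesis using repr_independence[of y N x] xy N.subgroup_axioms by simp
    qed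
    fix c assume "c \<in> carrier Q"
    then obtain z where z: "z \<in> carrier G" "c = N #> z" using rep by blast
    show "a \<preceq>\<^bsub>Q\<^esub> c" if "a \<preceq>\<^bsub>Q\<^esub> b" "b \<preceq>\<^bsub>Q\<^esub> c"
    proof -
      have "(z \<otimes> inv y) \<otimes> (y \<otimes> inv x) \<in> P" using that xy z D(3) by (simp add: cone_quotient_le)
      then show ?thesis using xy z by (simp add: cone_quotient_le m_assoc cancel_left_inv)
    qed
    fix d assume "d \<in> carrier Q" and le: "a \<preceq>\<^bsub>Q\<^esub> b"
    then obtain w where w: "w \<in> carrier G" "d = N #> w" using rep by blast
    \<comment> \<open>Right translation cancels in \<open>y \<otimes> inv x\<close>, while left
      translation by \<open>z\<close> conjugates it; this is where normality of \<open>P\<close>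
      enters.\<close>
    have "z \<otimes> (y \<otimes> inv x) \<otimes> inv z \<in> P"
      using nrm le xy z unfolding normal_cone_def by (simp add: cone_quotient_le)
    also have "z \<otimes> (y \<otimes> inv x) \<otimes> inv z = (z \<otimes> y \<otimes> w) \<otimes> inv (z \<otimes> x \<otimes> w)"
      using xy z w by (simp add: inv_mult_group m_assoc cancel_left_inv)
    finally show "c \<otimes>\<^bsub>Q\<^esub> a \<otimes>\<^bsub>Q\<^esub> d \<preceq>\<^bsub>Q\<^esub> c \<otimes>\<^bsub>Q\<^esub> b \<otimes>\<^bsub>Q\<^esub> d"
      using xy z w by (simp add: cone_quotient_mult cone_quotient_le)
  qed
  fix a b assume ab: "a \<in> carrier Q" "b \<in> carrier Q"
  obtain x y where xy: "x \<in> carrier G" "y \<in> carrier G" "a = N #> x" "b = N #> y"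
    using rep[OF ab(1)] rep[OF ab(2)] by blast
  then show "a \<preceq>\<^bsub>Q\<^esub> b \<or> b \<preceq>\<^bsub>Q\<^esub> a"
    using D(4)[of "y \<otimes> inv x"] inv_swap[of x y] by (simp add: cone_quotient_le)
qed

end

text \<open>From left to right, the projections of a subdirect product supply the normal prime
  cones. Conversely all normal prime cones together give an embedding into the product of their
  quotients, and separation makes it reflect the order.\<close>

lemma representable_iff:
  fixes H :: "'a ogroup"
  shows "representable H \<longleftrightarrow> l_group H \<and> normal_prime_separated H"
proof
  assume "representable H"
  then obtain I :: "'a set set" and T :: "'a set \<Rightarrow> 'a set ogroup" and \<phi>
    where H: "l_group H" and "\<forall>i\<in>I. to_group (T i)"
      and \<phi>: "\<phi> \<in> l_hom H (product_ogroup I T)" "inj_on \<phi> (carrier H)"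
    unfolding representable_def by (elim conjE exE) (rule that)
  then have T: "\<And>i. i \<in> I \<Longrightarrow> to_group (T i)" by simp
  note L = l_group_product[of I T, OF T] and sep = normal_prime_separated_product[of I T, OF T]
  show "l_group H \<and> normal_prime_separated H"
    using normal_prime_separated_vimage[OF H L \<phi> sep] H by simp
next
  assume asm: "l_group H \<and> normal_prime_separated H"
  then have H: "l_group H" ..
  interpret H: l_group H by (rule H)
  \<comment> \<open>The cones serve as their own indices, which fits the index type in the
    definition of \<open>representable\<close>.\<close>
  define I where "I = {P. prime_cone H P \<and> normal_cone H P}"
  define T where "T = cone_quotient H"
  have IP: "prime_cone H P" "total_cone H P" "normal_cone H P" if "P \<in> I" for P
    using that prime_coneD(1) by (auto simp: I_def)
  note ctx = IP(2,3)
  have T: "to_group (T P)" if "P \<in> I" for P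
    unfolding T_def using to_group_cone_quotient[OF H.po_group_axioms ctx[OF that]] by simp
  let ?N = "cone_units H"
  define \<phi> where "\<phi> = (\<lambda>x. \<lambda>P\<in>I. ?N P #>\<^bsub>H\<^esub> x)"
  interpret PT: l_group "product_ogroup I T" by (rule l_group_product[OF T])
  let ?T = "product_ogroup I T"
  have mem: "\<phi> x \<in> carrier ?T" if "x \<in> carrier H" for x
    using that carrier_cone_quotient[OF H.po_group_axioms ctx] by (simp add: \<phi>_def T_def product_ogroup_simps)
  have le: "\<phi> x \<preceq>\<^bsub>?T\<^esub> \<phi> y \<longleftrightarrow> (\<forall>P\<in>I. y \<otimes>\<^bsub>H\<^esub> inv\<^bsub>H\<^esub> x \<in> P)"
    if "x \<in> carrier H" "y \<in> carrier H" for x y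
    using that cone_quotient_le[OF H.po_group_axioms ctx] by (simp add: \<phi>_def T_def product_ogroup_simps)
  have le': "\<phi> x \<preceq>\<^bsub>?T\<^esub> \<phi> y \<longleftrightarrow> x \<preceq>\<^bsub>H\<^esub> y"
    if xy: "x \<in> carrier H" "y \<in> carrier H" for x y
  proof
    assume "\<phi> x \<preceq>\<^bsub>?T\<^esub> \<phi> y"
    then have "\<one>\<^bsub>H\<^esub> \<preceq>\<^bsub>H\<^esub> y \<otimes>\<^bsub>H\<^esub> inv\<^bsub>H\<^esub> x"
      using asm xy unfolding le[OF xy] normal_prime_separated_def by (simp add: I_def)
    then show "x \<preceq>\<^bsub>H\<^esub> y" using H.le_mult_inv_iff xy by simp
  next
    assume "x \<preceq>\<^bsub>H\<^esub> y"
    then show "\<phi> x \<preceq>\<^bsub>?T\<^esub> \<phi> y"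
      using H.le_mult_inv_iff[OF xy] xy total_coneD(2)[OF IP(2)] unfolding le[OF xy] by simp
  qed
  have sup: "\<phi> (H.lsup x y) = PT.lsup (\<phi> x) (\<phi> y)" if xy: "x \<in> carrier H" "y \<in> carrier H" for x y
  proof (rule PT.sup_eqI[symmetric])
    fix u assume u: "u \<in> carrier ?T"
      "\<phi> x \<preceq>\<^bsub>?T\<^esub> u" "\<phi> y \<preceq>\<^bsub>?T\<^esub> u"
    show "\<phi> (H.lsup x y) \<preceq>\<^bsub>?T\<^esub> u"
      unfolding product_ogroup_simps
    proof
      fix P assume P: "P \<in> I"
      then have "u P \<in> carrier (T P)" using u(1) by (auto simp: product_ogroup_simps)
      then obtain z where z: "z \<in> carrier H" "u P = ?N P #>\<^bsub>H\<^esub> z"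
        using carrier_cone_quotient[OF H.po_group_axioms ctx[OF P]] by (auto simp: T_def)
      have zx: "z \<otimes>\<^bsub>H\<^esub> inv\<^bsub>H\<^esub> x \<in> P" "z \<otimes>\<^bsub>H\<^esub> inv\<^bsub>H\<^esub> y \<in> P"
        using u P z xy cone_quotient_le[OF H.po_group_axioms ctx[OF P]] by (auto simp: product_ogroup_simps \<phi>_def T_def)
      \<comment> \<open>This element is the meet of the two elements in \<open>zx\<close>, so
        closure of \<open>P\<close> under meets is what makes the map preserve joins.\<close>
      have "z \<otimes>\<^bsub>H\<^esub> inv\<^bsub>H\<^esub> (H.lsup x y) \<in> P"
        using prime_coneD(2)[OF IP(1)[OF P] zx] xy z by (simp add: H.inv_sup H.mult_inf_distrib_left)
      then show "\<phi> (H.lsup x y) P \<preceq>\<^bsub>T P\<^esub> u P"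
        using P z xy cone_quotient_le[OF H.po_group_axioms ctx[OF P]] by (simp add: \<phi>_def T_def H.sup_closed)
    qed
  qed (use xy mem le' in \<open>simp_all add: H.sup_closed H.sup_ge1 H.sup_ge2\<close>)
  have hom: "\<phi> \<in> hom H ?T"
    using mem cone_quotient_mult[OF H.po_group_axioms ctx] unfolding hom_def
    by (auto simp: \<phi>_def T_def product_ogroup_simps(2) intro!: restrict_ext)
  interpret \<phi>: group_hom H ?T \<phi> by unfold_locales (rule hom)
  have inf: "\<phi> (H.linf x y) = PT.linf (\<phi> x) (\<phi> y)" if xy: "x \<in> carrier H" "y \<in> carrier H" for x y
  proof -
    have "\<phi> (inv\<^bsub>H\<^esub> H.linf x y) = PT.lsup (\<phi> (inv\<^bsub>H\<^esub> x)) (\<phi> (inv\<^bsub>H\<^esub> y))"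
      using sup xy by (simp add: H.inv_inf)
    then have "inv\<^bsub>?T\<^esub> (\<phi> (H.linf x y)) = inv\<^bsub>?T\<^esub> (PT.linf (\<phi> x) (\<phi> y))"
      using xy mem by (simp add: \<phi>.hom_inv H.inf_closed PT.inv_inf)
    then show ?thesis using PT.inv_inj mem xy by (auto simp: H.inf_closed PT.inf_closed dest: inj_onD)
  qed
  have "\<phi> \<in> l_hom H (product_ogroup I T)"
    unfolding l_hom_def using hom sup inf by simp
  moreover have "inj_on \<phi> (carrier H)"
  proof (rule inj_onI)
    fix x y assume xy: "x \<in> carrier H" "y \<in> carrier H" "\<phi> x = \<phi> y"
    then have "x \<preceq>\<^bsub>H\<^esub> y" "y \<preceq>\<^bsub>H\<^esub> x" using le' PT.ole_refl mem by metis+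
    then show "x = y" using xy H.ole_antisym by blast
  qed
  moreover have "(\<lambda>x. \<phi> x P) ` carrier H = carrier (T P)" if "P \<in> I" for P
    using that carrier_cone_quotient[OF H.po_group_axioms ctx[OF that]] by (simp add: \<phi>_def T_def)
  ultimately show "representable H"
    unfolding representable_def using H T by blast
qed


section \<open>Automorphisms of chains\<close>

text \<open>Maps are extensional so that automorphisms agreeing on \<open>K\<close> are equal, as
  antisymmetry of the pointwise order demands.\<close>

definition chain_auts :: "'a set \<Rightarrow> ('a \<Rightarrow> 'a \<Rightarrow> bool) \<Rightarrow> ('a \<Rightarrow> 'a) set" where
  "chain_auts K r = {f \<in> K \<rightarrow>\<^sub>E K. f ` K = K \<and> inj_on f K \<and> (\<forall>x\<in>K. \<forall>y\<in>K. r x y \<longrightarrow> r (f x) (f y))}"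

text \<open>Automorphisms act on the right: the product \<open>f g\<close> applies \<open>f\<close> first.\<close>

definition aut_ogroup :: "'a set \<Rightarrow> ('a \<Rightarrow> 'a \<Rightarrow> bool) \<Rightarrow> ('a \<Rightarrow> 'a) ogroup" where
  "aut_ogroup K r = \<lparr>carrier = chain_auts K r, mult = (\<lambda>f g. compose K g f), one = (\<lambda>x\<in>K. x),
    ole = (\<lambda>f g. \<forall>x\<in>K. r (f x) (g x))\<rparr>"

lemma aut_ogroup_simps:
  "carrier (aut_ogroup K r) = chain_auts K r"
  "f \<otimes>\<^bsub>aut_ogroup K r\<^esub> g = compose K g f"
  "\<one>\<^bsub>aut_ogroup K r\<^esub> = (\<lambda>x\<in>K. x)"
  "f \<preceq>\<^bsub>aut_ogroup K r\<^esub> g \<longleftrightarrow> (\<forall>x\<in>K. r (f x) (g x))"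
  by (simp_all add: aut_ogroup_def)

locale chain =
  fixes K :: "'a set" and r :: "'a \<Rightarrow> 'a \<Rightarrow> bool" (infix \<open>\<sqsubseteq>\<^sub>r\<close> 50)
  assumes refl: "\<And>x. x \<in> K \<Longrightarrow> x \<sqsubseteq>\<^sub>r x"
    and anti: "\<And>x y. \<lbrakk>x \<in> K; y \<in> K; x \<sqsubseteq>\<^sub>r y; y \<sqsubseteq>\<^sub>r x\<rbrakk> \<Longrightarrow> x = y"
    and trans: "\<And>x y z. \<lbrakk>x \<in> K; y \<in> K; z \<in> K; x \<sqsubseteq>\<^sub>r y; y \<sqsubseteq>\<^sub>r z\<rbrakk> \<Longrightarrow> x \<sqsubseteq>\<^sub>r z"
    and total: "\<And>x y. \<lbrakk>x \<in> K; y \<in> K\<rbrakk> \<Longrightarrow> x \<sqsubseteq>\<^sub>r y \<or> y \<sqsubseteq>\<^sub>r x"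
begin

abbreviation (input) A where "A \<equiv> aut_ogroup K r"

lemma chain_autsD:
  assumes "f \<in> chain_auts K r"
  shows "f \<in> extensional K" "x \<in> K \<Longrightarrow> f x \<in> K" "y \<in> K \<Longrightarrow> \<exists>x\<in>K. f x = y"
    "\<lbrakk>x \<in> K; y \<in> K; f x = f y\<rbrakk> \<Longrightarrow> x = y"
    "\<lbrakk>x \<in> K; y \<in> K; x \<sqsubseteq>\<^sub>r y\<rbrakk> \<Longrightarrow> f x \<sqsubseteq>\<^sub>r f y"
proof -
  have f: "f \<in> K \<rightarrow>\<^sub>E K" "f ` K = K" "inj_on f K" "\<forall>x\<in>K. \<forall>y\<in>K. x \<sqsubseteq>\<^sub>r y \<longrightarrow> f x \<sqsubseteq>\<^sub>r f y"
    using assms by (simp_all add: chain_auts_def)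
  show "f \<in> extensional K" using f(1) by (simp add: PiE_iff)
  show "x \<in> K \<Longrightarrow> f x \<in> K" using f(2) by blast
  show "y \<in> K \<Longrightarrow> \<exists>x\<in>K. f x = y" using f(2) by (metis imageE)
  show "\<lbrakk>x \<in> K; y \<in> K; f x = f y\<rbrakk> \<Longrightarrow> x = y" using f(3) by (simp add: inj_on_def)
  show "\<lbrakk>x \<in> K; y \<in> K; x \<sqsubseteq>\<^sub>r y\<rbrakk> \<Longrightarrow> f x \<sqsubseteq>\<^sub>r f y" using f(4) by blast
qed

lemma chain_autsI:
  assumes "f \<in> extensional K" "\<And>x. x \<in> K \<Longrightarrow> f x \<in> K" "\<And>y. y \<in> K \<Longrightarrow> \<exists>x\<in>K. f x = y"
    "\<And>x y. \<lbrakk>x \<in> K; y \<in> K; x \<sqsubseteq>\<^sub>r y; f x = f y\<rbrakk> \<Longrightarrow> x = y"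
    "\<And>x y. \<lbrakk>x \<in> K; y \<in> K; x \<sqsubseteq>\<^sub>r y\<rbrakk> \<Longrightarrow> f x \<sqsubseteq>\<^sub>r f y"
  shows "f \<in> chain_auts K r"
proof -
  have "x = y" if "x \<in> K" "y \<in> K" "f x = f y" for x y
    using total[OF that(1,2)] assms(4)[of x y] assms(4)[of y x] that by metis
  then have "inj_on f K" by (simp add: inj_on_def)
  moreover have "f ` K = K" using assms(2,3) by (auto simp: image_iff)
  moreover have "f \<in> K \<rightarrow>\<^sub>E K" using assms(1,2) by (simp add: PiE_iff)
  ultimately show ?thesis using assms(5) by (simp add: chain_auts_def)
qed

lemma group_aut_ogroup: "group A"
proof (rule groupI)
  fix f g h assume f: "f \<in> carrier A" and g: "g \<in> carrier A" and h: "h \<in> carrier A"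
  note F = chain_autsD[OF f[unfolded aut_ogroup_simps]] and G = chain_autsD[OF g[unfolded aut_ogroup_simps]]
    and H = chain_autsD[OF h[unfolded aut_ogroup_simps]]
  show "f \<otimes>\<^bsub>A\<^esub> g \<in> carrier A"
    unfolding aut_ogroup_simps
  proof (rule chain_autsI)
    show "\<exists>x\<in>K. compose K g f x = y" if y: "y \<in> K" for y
    proof -
      obtain z where z: "z \<in> K" "g z = y" using G(3)[OF y] by blast
      obtain x where x: "x \<in> K" "f x = z" using F(3)[OF z(1)] by blast
      show ?thesis using x z by (intro bexI[of _ x]) (simp_all add: compose_def)
    qed
    show "x = y" if "x \<in> K" "y \<in> K" "compose K g f x = compose K g f y" for x y
      using that F(2,4) G(4) by (simp add: compose_def)
  qed (simp_all add: compose_def F G)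
  show "f \<otimes>\<^bsub>A\<^esub> g \<otimes>\<^bsub>A\<^esub> h = f \<otimes>\<^bsub>A\<^esub> (g \<otimes>\<^bsub>A\<^esub> h)"
    unfolding aut_ogroup_simps using F(2) by (simp add: compose_def cong: restrict_cong)
next
  show "\<one>\<^bsub>A\<^esub> \<in> carrier A"
    unfolding aut_ogroup_simps by (rule chain_autsI) auto
  fix f assume f: "f \<in> carrier A"
  note F = chain_autsD[OF f[unfolded aut_ogroup_simps]]
  show "\<one>\<^bsub>A\<^esub> \<otimes>\<^bsub>A\<^esub> f = f"
    unfolding aut_ogroup_simps using F(1) by (auto simp: compose_def extensional_def)
  define g where "g = (\<lambda>y\<in>K. inv_into K f y)"
  have img: "f ` K = K" using F(2,3) by blast
  have g: "g y \<in> K" "f (g y) = y" if "y \<in> K" for y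
    using that img by (auto simp: g_def inv_into_into f_inv_into_f)
  have gf: "g (f x) = x" if "x \<in> K" for x
    using F(4)[OF _ that, of "g (f x)"] g[of "f x"] F(2)[OF that] by simp
  have "g \<in> carrier A"
    unfolding aut_ogroup_simps
  proof (rule chain_autsI)
    show "g \<in> extensional K" by (simp add: g_def)
    show "\<exists>x\<in>K. g x = y" if "y \<in> K" for y using gf F(2) that by blast
    show "x = y" if "x \<in> K" "y \<in> K" "g x = g y" for x y using that g by metis
    show "g x \<sqsubseteq>\<^sub>r g y" if xy: "x \<in> K" "y \<in> K" "x \<sqsubseteq>\<^sub>r y" for x y
    proof (rule ccontr)
      assume *: "\<not> g x \<sqsubseteq>\<^sub>r g y"
      then have "g y \<sqsubseteq>\<^sub>r g x" using total g xy by blast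
      then have "y \<sqsubseteq>\<^sub>r x" using F(5)[of "g y" "g x"] g xy by simp
      then have "x = y" using anti xy by blast
      then show False using * refl g xy by simp
    qed
  qed (rule g)
  moreover have "g \<otimes>\<^bsub>A\<^esub> f = \<one>\<^bsub>A\<^esub>"
    unfolding aut_ogroup_simps using g by (auto simp: compose_def intro!: restrict_ext)
  ultimately show "\<exists>g\<in>carrier A. g \<otimes>\<^bsub>A\<^esub> f = \<one>\<^bsub>A\<^esub>" by blast
qed

lemma po_group_aut_ogroup: "po_group A"
proof (rule po_groupI[OF group_aut_ogroup])
  fix f g h assume f: "f \<in> carrier A" and g: "g \<in> carrier A" and h: "h \<in> carrier A"
  note F = chain_autsD[OF f[unfolded aut_ogroup_simps]] and G = chain_autsD[OF g[unfolded aut_ogroup_simps]]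
    and H = chain_autsD[OF h[unfolded aut_ogroup_simps]]
  show "f \<preceq>\<^bsub>A\<^esub> f" using F(2) refl by (simp add: aut_ogroup_simps)
  show "f = g" if "f \<preceq>\<^bsub>A\<^esub> g" "g \<preceq>\<^bsub>A\<^esub> f"
    using that F(1,2) G(1,2) anti by (auto simp: aut_ogroup_simps intro!: extensionalityI[of f K g])
  show "f \<preceq>\<^bsub>A\<^esub> h" if "f \<preceq>\<^bsub>A\<^esub> g" "g \<preceq>\<^bsub>A\<^esub> h"
    unfolding aut_ogroup_simps
  proof
    fix x assume x: "x \<in> K"
    show "f x \<sqsubseteq>\<^sub>r h x"
      using trans[OF F(2)[OF x] G(2)[OF x] H(2)[OF x]] that x by (simp add: aut_ogroup_simps)
  qed
  fix k assume "k \<in> carrier A" and "f \<preceq>\<^bsub>A\<^esub> g"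
  note k = chain_autsD[OF this(1)[unfolded aut_ogroup_simps]] and this(2)
  then show "h \<otimes>\<^bsub>A\<^esub> f \<otimes>\<^bsub>A\<^esub> k \<preceq>\<^bsub>A\<^esub> h \<otimes>\<^bsub>A\<^esub> g \<otimes>\<^bsub>A\<^esub> k"
    using F(2) G(2) H(2) by (simp add: aut_ogroup_simps compose_def)
qed

section \<open>Pointwise maxima and minima of automorphisms\<close>

definition chain_max :: "('a \<Rightarrow> 'a) \<Rightarrow> ('a \<Rightarrow> 'a) \<Rightarrow> 'a \<Rightarrow> 'a" where
  "chain_max f g = (\<lambda>x\<in>K. if f x \<sqsubseteq>\<^sub>r g x then g x else f x)"

definition chain_min :: "('a \<Rightarrow> 'a) \<Rightarrow> ('a \<Rightarrow> 'a) \<Rightarrow> 'a \<Rightarrow> 'a" where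
  "chain_min f g = (\<lambda>x\<in>K. if f x \<sqsubseteq>\<^sub>r g x then f x else g x)"

text \<open>Surjectivity is the delicate point: if \<open>f a = z\<close> and
  \<open>g b = z\<close>, the smaller of \<open>a\<close> and \<open>b\<close> is sent to
  \<open>z\<close>, since there the other map takes a value at most \<open>z\<close>. For
  injectivity, equal values at comparable points force equality of \<open>f\<close> or of
  \<open>g\<close> at these points.\<close>

lemma chain_max:
  assumes f: "f \<in> chain_auts K r" and g: "g \<in> chain_auts K r"
  shows "chain_max f g \<in> chain_auts K r"
proof (rule chain_autsI)
  note F = chain_autsD[OF f] and G = chain_autsD[OF g]
  let ?m = "chain_max f g"
  show "?m \<in> extensional K" by (simp add: chain_max_def)
  show mK: "?m x \<in> K" if "x \<in> K" for x using F(2) G(2) that by (simp add: chain_max_def)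
  have up: "f x \<sqsubseteq>\<^sub>r ?m x" "g x \<sqsubseteq>\<^sub>r ?m x" and eq: "?m x = f x \<or> ?m x = g x" if x: "x \<in> K" for x
    using total[OF F(2)[OF x] G(2)[OF x]] refl[OF F(2)[OF x]] refl[OF G(2)[OF x]] x
    by (auto simp: chain_max_def)
  show "?m x \<sqsubseteq>\<^sub>r ?m y" if xy: "x \<in> K" "y \<in> K" "x \<sqsubseteq>\<^sub>r y" for x y
    using eq[OF xy(1)]
  proof
    assume "?m x = f x"
    then show ?thesis using trans[OF F(2)[OF xy(1)] F(2)[OF xy(2)] mK[OF xy(2)]] F(5)[OF xy] up[OF xy(2)] by simp
  next
    assume "?m x = g x"
    then show ?thesis using trans[OF G(2)[OF xy(1)] G(2)[OF xy(2)] mK[OF xy(2)]] G(5)[OF xy] up[OF xy(2)] by simp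
  qed
  show "x = y" if xy: "x \<in> K" "y \<in> K" "x \<sqsubseteq>\<^sub>r y" and e: "?m x = ?m y" for x y
    using eq[OF xy(1)]
  proof
    assume "?m x = f x"
    then have "f y \<sqsubseteq>\<^sub>r f x" using up[OF xy(2)] e by simp
    then show ?thesis using F(4)[OF xy(1,2)] anti[OF F(2) F(2)] F(5)[OF xy] xy by blast
  next
    assume "?m x = g x"
    then have "g y \<sqsubseteq>\<^sub>r g x" using up[OF xy(2)] e by simp
    then show ?thesis using G(4)[OF xy(1,2)] anti[OF G(2) G(2)] G(5)[OF xy] xy by blast
  qed
  show "\<exists>x\<in>K. ?m x = z" if z: "z \<in> K" for z
  proof -
    obtain a b where a: "a \<in> K" "f a = z" and b: "b \<in> K" "g b = z" using F(3)[OF z] G(3)[OF z] by blast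
    show ?thesis using total[OF a(1) b(1)]
    proof
      assume "a \<sqsubseteq>\<^sub>r b"
      then have "g a \<sqsubseteq>\<^sub>r f a" using G(5)[OF a(1) b(1)] a b by simp
      then have "?m a = f a" using anti[OF F(2)[OF a(1)] G(2)[OF a(1)]] a(1) by (auto simp: chain_max_def)
      then show ?thesis using a by blast
    next
      assume "b \<sqsubseteq>\<^sub>r a"
      then have "f b \<sqsubseteq>\<^sub>r g b" using F(5)[OF b(1) a(1)] a b by simp
      then have "?m b = g b" using b(1) by (simp add: chain_max_def)
      then show ?thesis using b by blast
    qed
  qed
qed

text \<open>Dual to the maximum; the preimage of \<open>z\<close> is now the larger of its preimages
  under \<open>f\<close> and \<open>g\<close>.\<close>

lemma chain_min:
  assumes f: "f \<in> chain_auts K r" and g: "g \<in> chain_auts K r"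
  shows "chain_min f g \<in> chain_auts K r"
proof (rule chain_autsI)
  note F = chain_autsD[OF f] and G = chain_autsD[OF g]
  let ?m = "chain_min f g"
  show "?m \<in> extensional K" by (simp add: chain_min_def)
  show mK: "?m x \<in> K" if "x \<in> K" for x using F(2) G(2) that by (simp add: chain_min_def)
  have lo: "?m x \<sqsubseteq>\<^sub>r f x" "?m x \<sqsubseteq>\<^sub>r g x" and eq: "?m x = f x \<or> ?m x = g x" if x: "x \<in> K" for x
    using total[OF F(2)[OF x] G(2)[OF x]] refl[OF F(2)[OF x]] refl[OF G(2)[OF x]] x
    by (auto simp: chain_min_def)
  show "?m x \<sqsubseteq>\<^sub>r ?m y" if xy: "x \<in> K" "y \<in> K" "x \<sqsubseteq>\<^sub>r y" for x y
    using eq[OF xy(2)]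
  proof
    assume "?m y = f y"
    then show ?thesis using trans[OF mK[OF xy(1)] F(2)[OF xy(1)] F(2)[OF xy(2)]] F(5)[OF xy] lo[OF xy(1)] by simp
  next
    assume "?m y = g y"
    then show ?thesis using trans[OF mK[OF xy(1)] G(2)[OF xy(1)] G(2)[OF xy(2)]] G(5)[OF xy] lo[OF xy(1)] by simp
  qed
  show "x = y" if xy: "x \<in> K" "y \<in> K" "x \<sqsubseteq>\<^sub>r y" and e: "?m x = ?m y" for x y
    using eq[OF xy(2)]
  proof
    assume "?m y = f y"
    then have "f y \<sqsubseteq>\<^sub>r f x" using lo[OF xy(1)] e by simp
    then show ?thesis using F(4)[OF xy(1,2)] anti[OF F(2) F(2)] F(5)[OF xy] xy by blast
  next
    assume "?m y = g y"
    then have "g y \<sqsubseteq>\<^sub>r g x" using lo[OF xy(1)] e by simp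
    then show ?thesis using G(4)[OF xy(1,2)] anti[OF G(2) G(2)] G(5)[OF xy] xy by blast
  qed
  show "\<exists>x\<in>K. ?m x = z" if z: "z \<in> K" for z
  proof -
    obtain a b where a: "a \<in> K" "f a = z" and b: "b \<in> K" "g b = z" using F(3)[OF z] G(3)[OF z] by blast
    show ?thesis using total[OF a(1) b(1)]
    proof
      assume "b \<sqsubseteq>\<^sub>r a"
      then have "f a \<sqsubseteq>\<^sub>r g a" using G(5)[OF b(1) a(1)] a b by simp
      then have "?m a = f a" using a(1) by (simp add: chain_min_def)
      then show ?thesis using a by blast
    next
      assume "a \<sqsubseteq>\<^sub>r b"
      then have "g b \<sqsubseteq>\<^sub>r f b" using F(5)[OF a(1) b(1)] a b by simp
      then have "?m b = g b" using anti[OF F(2)[OF b(1)] G(2)[OF b(1)]] b(1) by (auto simp: chain_min_def)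
      then show ?thesis using b by blast
    qed
  qed
qed

lemma aut_sup_props:
  assumes f: "f \<in> carrier A" and g: "g \<in> carrier A"
  shows "chain_max f g \<in> carrier A" "f \<preceq>\<^bsub>A\<^esub> chain_max f g" "g \<preceq>\<^bsub>A\<^esub> chain_max f g"
    "\<And>u. \<lbrakk>f \<preceq>\<^bsub>A\<^esub> u; g \<preceq>\<^bsub>A\<^esub> u\<rbrakk> \<Longrightarrow> chain_max f g \<preceq>\<^bsub>A\<^esub> u"
proof -
  note F = chain_autsD[OF f[unfolded aut_ogroup_simps]] and G = chain_autsD[OF g[unfolded aut_ogroup_simps]]
  show "chain_max f g \<in> carrier A" using chain_max f g by (simp add: aut_ogroup_simps)
  show "f \<preceq>\<^bsub>A\<^esub> chain_max f g" using refl F(2) by (simp add: aut_ogroup_simps chain_max_def)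
  show "g \<preceq>\<^bsub>A\<^esub> chain_max f g"
    using refl G(2) total[OF F(2) G(2)] by (auto simp: aut_ogroup_simps chain_max_def)
  show "chain_max f g \<preceq>\<^bsub>A\<^esub> u" if "f \<preceq>\<^bsub>A\<^esub> u" "g \<preceq>\<^bsub>A\<^esub> u" for u
    using that by (simp add: aut_ogroup_simps chain_max_def)
qed

lemma aut_inf_props:
  assumes f: "f \<in> carrier A" and g: "g \<in> carrier A"
  shows "chain_min f g \<in> carrier A" "chain_min f g \<preceq>\<^bsub>A\<^esub> f" "chain_min f g \<preceq>\<^bsub>A\<^esub> g"
    "\<And>u. \<lbrakk>u \<preceq>\<^bsub>A\<^esub> f; u \<preceq>\<^bsub>A\<^esub> g\<rbrakk> \<Longrightarrow> u \<preceq>\<^bsub>A\<^esub> chain_min f g"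
proof -
  note F = chain_autsD[OF f[unfolded aut_ogroup_simps]] and G = chain_autsD[OF g[unfolded aut_ogroup_simps]]
  show "chain_min f g \<in> carrier A" using chain_min f g by (simp add: aut_ogroup_simps)
  show "chain_min f g \<preceq>\<^bsub>A\<^esub> f"
    using refl F(2) total[OF F(2) G(2)] by (auto simp: aut_ogroup_simps chain_min_def)
  show "chain_min f g \<preceq>\<^bsub>A\<^esub> g" using refl G(2) by (simp add: aut_ogroup_simps chain_min_def)
  show "u \<preceq>\<^bsub>A\<^esub> chain_min f g" if "u \<preceq>\<^bsub>A\<^esub> f" "u \<preceq>\<^bsub>A\<^esub> g" for u
    using that by (simp add: aut_ogroup_simps chain_min_def)
qed

lemma l_group_aut_ogroup: "l_group A"
proof (rule l_groupI[OF po_group_aut_ogroup])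
  fix f g assume fg: "f \<in> carrier A" "g \<in> carrier A"
  show "\<exists>z\<in>carrier A. f \<preceq>\<^bsub>A\<^esub> z \<and> g \<preceq>\<^bsub>A\<^esub> z \<and> (\<forall>u\<in>carrier A. f \<preceq>\<^bsub>A\<^esub> u \<and> g \<preceq>\<^bsub>A\<^esub> u \<longrightarrow> z \<preceq>\<^bsub>A\<^esub> u)"
    by (rule bexI[OF _ aut_sup_props(1)[OF fg]]) (simp add: aut_sup_props[OF fg])
  show "\<exists>z\<in>carrier A. z \<preceq>\<^bsub>A\<^esub> f \<and> z \<preceq>\<^bsub>A\<^esub> g \<and> (\<forall>u\<in>carrier A. u \<preceq>\<^bsub>A\<^esub> f \<and> u \<preceq>\<^bsub>A\<^esub> g \<longrightarrow> u \<preceq>\<^bsub>A\<^esub> z)"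
    by (rule bexI[OF _ aut_inf_props(1)[OF fg]]) (simp add: aut_inf_props[OF fg])
qed

text \<open>Automorphisms are compared by their values at \<open>e\<close>, and the units are the
  stabiliser of \<open>e\<close>. Evaluation at \<open>e\<close> takes meets to minima in the chain,
  which gives primality. The product applies \<open>f\<close> first, so monotonicity of
  \<open>g\<close> yields closure under products.\<close>

lemma prime_cone_aut_ogroup:
  assumes e: "e \<in> K"
  shows "prime_cone A {f \<in> carrier A. e \<sqsubseteq>\<^sub>r f e}"
proof -
  interpret A: l_group A by (rule l_group_aut_ogroup)
  let ?P = "{f \<in> carrier A. e \<sqsubseteq>\<^sub>r f e}"
  note D = chain_autsD
  have cD: "f \<in> chain_auts K r" if "f \<in> carrier A" for f using that by (simp add: aut_ogroup_simps)
  show ?thesis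
    unfolding prime_cone_def total_cone_def
  proof (intro conjI ballI impI)
    show "?P \<subseteq> carrier A" by blast
    show "f \<in> ?P" if "f \<in> carrier A" "\<one>\<^bsub>A\<^esub> \<preceq>\<^bsub>A\<^esub> f" for f
      using that e by (auto simp: aut_ogroup_simps(3,4))
    show "f \<in> ?P \<or> inv\<^bsub>A\<^esub> f \<in> ?P" if f: "f \<in> carrier A" for f
    proof -
      let ?g = "inv\<^bsub>A\<^esub> f"
      have g: "?g \<in> carrier A" using f by simp
      have "f e \<in> K" using D(2)[OF cD[OF f] e] .
      have "(f \<otimes>\<^bsub>A\<^esub> ?g) e = e" using f e by (simp add: A.r_inv aut_ogroup_simps(3))
      then have "?g (f e) = e" using e by (simp add: aut_ogroup_simps(2) compose_def)
      then show ?thesis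
        using total[OF e \<open>f e \<in> K\<close>] D(5)[OF cD[OF g] \<open>f e \<in> K\<close> e] f g by auto
    qed
    fix f g assume fP: "f \<in> ?P" and gP: "g \<in> ?P"
    then have f: "f \<in> carrier A" "e \<sqsubseteq>\<^sub>r f e" and g: "g \<in> carrier A" "e \<sqsubseteq>\<^sub>r g e" by auto
    have K: "f e \<in> K" "g e \<in> K" "g (f e) \<in> K"
      using D(2)[OF cD[OF f(1)] e] D(2)[OF cD[OF g(1)]] e by auto
    have "g e \<sqsubseteq>\<^sub>r g (f e)" using D(5)[OF cD[OF g(1)] e K(1) f(2)] .
    then have "e \<sqsubseteq>\<^sub>r g (f e)" using trans[OF e K(2,3) g(2)] by blast
    then show "f \<otimes>\<^bsub>A\<^esub> g \<in> ?P"
      using A.m_closed[OF f(1) g(1)] e by (simp add: aut_ogroup_simps(2) compose_def)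
    have "A.linf f g = chain_min f g"
      using aut_inf_props[OF f(1) g(1)] f g by (intro A.inf_eqI) auto
    then show "A.linf f g \<in> ?P"
      using A.inf_closed[OF f(1) g(1)] f g e by (simp add: chain_min_def)
  qed
qed

end


section \<open>Free l-groups\<close>

lemma in_variety_l_group: "in_variety V H \<Longrightarrow> l_group H"
  by (cases V) (simp_all add: representable_def abelian_l_group_def)

text \<open>Each variety is closed under l-subgroups up to isomorphism. It is used for copies at
  another element type and for the l-subgroup generated by the image of \<open>G\<close>.\<close>

lemma in_variety_vimage:
  assumes G: "l_group G" and V: "in_variety V H" and h: "h \<in> l_hom G H" and inj: "inj_on h (carrier G)"
  shows "in_variety V G"
proof (cases V)
  case All_Lgroups
  then show ?thesis using G by simp
next
  case Representable_Lgroups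
  then show ?thesis
    using normal_prime_separated_vimage[OF G _ h inj] G V by (simp add: representable_iff)
next
  case Abelian_Lgroups
  interpret G: l_group G by (rule G)
  have H: "comm_group H" using V Abelian_Lgroups by (simp add: abelian_l_group_def)
  have "x \<otimes>\<^bsub>G\<^esub> y = y \<otimes>\<^bsub>G\<^esub> x" if "x \<in> carrier G" "y \<in> carrier G" for x y
  proof -
    have "h (x \<otimes>\<^bsub>G\<^esub> y) = h (y \<otimes>\<^bsub>G\<^esub> x)"
      using that l_homD[OF h] comm_groupE(4)[OF H] by simp
    then show ?thesis using inj that by (simp add: inj_on_def)
  qed
  then have "comm_group G" by (intro G.group_comm_groupI)
  then show ?thesis using Abelian_Lgroups G by (simp add: abelian_l_group_def)
qed

lemma pos_homD:
  assumes "p \<in> pos_hom G H"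
  shows "p \<in> hom G H" "x \<in> carrier G \<Longrightarrow> p x \<in> carrier H"
    "\<lbrakk>x \<in> carrier G; y \<in> carrier G\<rbrakk> \<Longrightarrow> p (x \<otimes>\<^bsub>G\<^esub> y) = p x \<otimes>\<^bsub>H\<^esub> p y"
    "\<lbrakk>x \<in> carrier G; y \<in> carrier G; x \<preceq>\<^bsub>G\<^esub> y\<rbrakk> \<Longrightarrow> p x \<preceq>\<^bsub>H\<^esub> p y"
  using assms unfolding pos_hom_def hom_def by blast+

section \<open>Consequences of the universal property\<close>

context
  fixes V :: l_variety and G :: "'g ogroup" and F :: "'f ogroup" (structure) and \<eta> :: "'g \<Rightarrow> 'f"
  assumes G: "po_group G" and free: "free_l_group_over V G F \<eta>"
begin

lemma free_variety: "in_variety V F" and free_pos_hom: "\<eta> \<in> pos_hom G F"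
  using free unfolding free_l_group_over_def by simp_all

lemma free_l_group: "l_group F"
  using free_variety by (rule in_variety_l_group)

interpretation F: l_group F by (rule free_l_group)

text \<open>The universal property at an arbitrary element type that embeds into \<open>('g + 'f) list set\<close>.\<close>

lemma free_extension:
  fixes H :: "'x ogroup" and e :: "'x \<Rightarrow> ('g + 'f) list set"
  assumes H: "in_variety V H" and e: "inj_on e (carrier H)" and p: "p \<in> pos_hom G H"
  shows "\<exists>h\<in>l_hom F H. \<forall>g\<in>carrier G. h (\<eta> g) = p g"
    and "\<lbrakk>h1 \<in> l_hom F H; h2 \<in> l_hom F H; \<And>g. g \<in> carrier G \<Longrightarrow> h1 (\<eta> g) = p g;
      \<And>g. g \<in> carrier G \<Longrightarrow> h2 (\<eta> g) = p g; x \<in> carrier F\<rbrakk> \<Longrightarrow> h1 x = h2 x"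
proof -
  have HL: "l_group H" using H by (rule in_variety_l_group)
  note C = copy_ogroup[OF HL e]
  let ?H = "copy_ogroup e H" and ?d = "inv_into (carrier H) e"
  have V: "in_variety V ?H" using in_variety_vimage[OF C(1) H C(3,4)] .
  have "(\<lambda>g. e (p g)) \<in> pos_hom G ?H"
    unfolding pos_hom_def hom_def
    using pos_homD[OF p] l_homD[OF C(2)] l_hom_mono[OF HL C(1,2)] by simp
  then have ex1: "\<exists>!h. h \<in> l_hom F ?H \<and> h \<in> extensional (carrier F) \<and> (\<forall>g\<in>carrier G. h (\<eta> g) = e (p g))"
    using free V unfolding free_l_group_over_def by blast
  then obtain h where h: "h \<in> l_hom F ?H" "\<forall>g\<in>carrier G. h (\<eta> g) = e (p g)" by blast
  show "\<exists>h\<in>l_hom F H. \<forall>g\<in>carrier G. h (\<eta> g) = p g"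
    by (rule bexI[OF _ l_hom_comp[OF h(1) C(3)]]) (simp add: h(2) C(5) pos_homD(2)[OF p])
  assume h12: "h1 \<in> l_hom F H" "h2 \<in> l_hom F H" "\<And>g. g \<in> carrier G \<Longrightarrow> h1 (\<eta> g) = p g"
    "\<And>g. g \<in> carrier G \<Longrightarrow> h2 (\<eta> g) = p g" and x: "x \<in> carrier F"
  define E where "E h \<longleftrightarrow> h \<in> l_hom F ?H \<and> h \<in> extensional (carrier F) \<and> (\<forall>g\<in>carrier G. h (\<eta> g) = e (p g))"
    for h
  \<comment> \<open>Uniqueness is available among extensional maps, so competing extensions are cut
    down to \<open>carrier F\<close> before they are compared.\<close>
  have *: "E (restrict (\<lambda>x. e (k x)) (carrier F))"
    if "k \<in> l_hom F H" "\<And>g. g \<in> carrier G \<Longrightarrow> k (\<eta> g) = p g" for k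
    using l_hom_restrict[OF free_l_group l_hom_comp[OF that(1) C(2)]] that(2) pos_homD(2)[OF free_pos_hom]
    by (simp add: E_def)
  have "\<exists>!h. E h" using ex1 by (simp add: E_def)
  moreover have "E (restrict (\<lambda>x. e (h1 x)) (carrier F))" using h12(1,3) by (rule *)
  moreover have "E (restrict (\<lambda>x. e (h2 x)) (carrier F))" using h12(2,4) by (rule *)
  ultimately have "restrict (\<lambda>x. e (h1 x)) (carrier F) = restrict (\<lambda>x. e (h2 x)) (carrier F)" by blast
  then have "e (h1 x) = e (h2 x)" using x by (metis restrict_apply')
  then show "h1 x = h2 x" using inj_onD[OF e] l_homD(2)[OF h12(1) x] l_homD(2)[OF h12(2) x] by blast
qed

lemma subgroup_image: "subgroup (\<eta> ` carrier G) F"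
proof -
  interpret G: po_group G by (rule G)
  interpret group_hom G F \<eta> by unfold_locales (rule pos_homD(1)[OF free_pos_hom])
  show ?thesis by (rule img_is_subgroup)
qed

text \<open>The generated l-subgroup belongs to the variety, so \<eta> extends to a map of
  \<open>F\<close> into it. Followed by the inclusion, this extension agrees with the identity on
  the image of \<eta>, hence everywhere, and so \<open>F\<close> has no further elements.\<close>

lemma lattice_closure_image: "lattice_closure F (\<eta> ` carrier G) = carrier F"
proof
  let ?K = "\<eta> ` carrier G"
  let ?S = "lattice_closure F ?K"
  have K: "?K \<subseteq> carrier F" using subgroup.subset[OF subgroup_image] .
  show SF: "?S \<subseteq> carrier F" using F.lattice_closure_closed[OF K] by blast
  let ?FS = "F\<lparr>carrier := ?S\<rparr>"
  have sub: "l_group ?FS" "(\<lambda>x. x) \<in> l_hom ?FS F"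
    using sub_l_group[OF free_l_group F.subgroup_lattice_closure[OF subgroup_image]]
    by (simp_all add: lattice_closure.join lattice_closure.meet)
  have V: "in_variety V ?FS"
    using in_variety_vimage[OF sub(1) free_variety sub(2)] by simp
  have p: "\<eta> \<in> pos_hom G ?FS"
    unfolding pos_hom_def hom_def using pos_homD[OF free_pos_hom] by (simp add: lattice_closure.base)
  have inj: "inj_on (\<lambda>x. {[Inr x]}) X" for X :: "'f set" by (simp add: inj_on_def)
  obtain h where h: "h \<in> l_hom F ?FS" "\<forall>g\<in>carrier G. h (\<eta> g) = \<eta> g"
    using free_extension(1)[OF V inj p] by blast
  have hF: "h \<in> l_hom F F" using l_hom_comp[OF h(1) sub(2)] by simp
  have id: "(\<lambda>x. x) \<in> l_hom F F" by (simp add: l_hom_def hom_def)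
  show "carrier F \<subseteq> ?S"
  proof
    fix x assume x: "x \<in> carrier F"
    have "h x = x"
      using free_extension(2)[OF free_variety inj free_pos_hom hF id _ _ x] h(2) by simp
    then show "x \<in> ?S" using l_homD(2)[OF h(1) x] by simp
  qed
qed

lemma conj_orthogonal_free:
  assumes "V \<noteq> All_Lgroups"
  shows "conj_orthogonal F"
  using assms free_variety conj_orthogonal_if_normal_prime_separated[OF free_l_group]
    conj_orthogonal_if_comm[OF free_l_group]
  by (cases V) (simp_all add: representable_iff abelian_l_group_def)

section \<open>Lifting orders on the group image to prime cones\<close>

context
  fixes K C
  assumes K: "K = \<eta> ` carrier G" and C: "C \<in> right_orders (F\<lparr>carrier := K\<rparr>)"
begin

interpretation K: subgroup K F unfolding K by (rule subgroup_image)
lemmas order_cone = right_orders_subgroupD[OF F.po_group_axioms K.subgroup_axioms C]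

definition cone_le :: "'f \<Rightarrow> 'f \<Rightarrow> bool" where
  "cone_le x y \<longleftrightarrow> y \<otimes> inv x \<in> C"

lemma cone_le_refl: "x \<in> K \<Longrightarrow> cone_le x x"
  using order_cone(6)[OF K.one_closed] F.ole_refl by (simp add: cone_le_def)

lemma cone_le_trans:
  assumes "x \<in> K" "y \<in> K" "z \<in> K" "cone_le x y" "cone_le y z"
  shows "cone_le x z"
proof -
  have "(z \<otimes> inv y) \<otimes> (y \<otimes> inv x) \<in> C"
    using assms order_cone(7) by (simp add: cone_le_def)
  also have "(z \<otimes> inv y) \<otimes> (y \<otimes> inv x) = z \<otimes> inv x"
    using assms K.mem_carrier by (simp add: F.m_assoc F.cancel_left_inv)
  finally show ?thesis by (simp add: cone_le_def)
qed

lemma cone_le_antisym: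
  assumes "x \<in> K" "y \<in> K" "cone_le x y" "cone_le y x"
  shows "x = y"
proof -
  have c: "x \<in> carrier F" "y \<in> carrier F" using assms K.mem_carrier by auto
  have "inv (y \<otimes> inv x) = x \<otimes> inv y" using c by (simp add: F.inv_mult_group)
  then have "y \<otimes> inv x = \<one>" using order_cone(5) assms by (simp add: cone_le_def)
  then have "y \<otimes> inv x \<otimes> x = x" using c by simp
  then show ?thesis using c by (simp add: F.m_assoc)
qed

lemma cone_le_total:
  assumes "x \<in> K" "y \<in> K"
  shows "cone_le x y \<or> cone_le y x"
  using order_cone(4)[of "y \<otimes> inv x"] assms K.mem_carrier
  by (simp add: cone_le_def F.inv_mult_group)

lemma cone_le_one: "x \<in> K \<Longrightarrow> cone_le \<one> x \<longleftrightarrow> x \<in> C"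
  using K.mem_carrier by (simp add: cone_le_def)

lemma cone_le_mult_right:
  assumes "x \<in> K" "y \<in> K" "k \<in> K"
  shows "cone_le (x \<otimes> k) (y \<otimes> k) \<longleftrightarrow> cone_le x y"
  using assms K.mem_carrier by (simp add: cone_le_def F.inv_mult_group F.m_assoc F.cancel_left_inv)

lemma cone_le_of_ole:
  assumes "x \<in> K" "y \<in> K" "x \<preceq> y"
  shows "cone_le x y"
  using order_cone(6)[of "y \<otimes> inv x"] assms K.mem_carrier by (simp add: cone_le_def F.le_mult_inv_iff)

lemma image_mem: "g \<in> carrier G \<Longrightarrow> \<eta> g \<in> K"
  by (simp add: K)

text \<open>A right order is realised by letting \<open>K\<close> act on the chain of its elements by right
  multiplication: \<open>k \<in> C\<close> iff \<open>k\<close> moves the identity upwards.\<close>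

lemma right_order_lift:
  assumes V: "V = All_Lgroups"
  shows "\<exists>P. prime_cone F P \<and> P \<inter> K = C"
proof -
  let ?A = "aut_ogroup K cone_le"
  interpret chain K cone_le
    by unfold_locales (fact cone_le_refl cone_le_antisym cone_le_trans cone_le_total)+
  have A: "l_group ?A" by (rule l_group_aut_ogroup)
  \<comment> \<open>An automorphism is encoded by its graph, a set of two-element lists, to meet the
    element type of the universal property.\<close>
  define e :: "('f \<Rightarrow> 'f) \<Rightarrow> ('g + 'f) list set" where "e f = (\<lambda>x. [Inr x, Inr (f x)]) ` K" for f
  have e: "inj_on e (carrier ?A)"
  proof (rule inj_onI)
    fix f g assume fg: "f \<in> carrier ?A" "g \<in> carrier ?A" "e f = e g"
    show "f = g"
    proof (rule extensionalityI)
      show "f \<in> extensional K" "g \<in> extensional K"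
        using fg by (auto simp: aut_ogroup_simps chain_auts_def PiE_iff)
      fix x assume "x \<in> K"
      then have "[Inr x, Inr (f x)] \<in> e g" using fg(3) by (auto simp: e_def)
      then show "f x = g x" by (auto simp: e_def)
    qed
  qed
  define p where "p g = (\<lambda>x\<in>K. x \<otimes> \<eta> g)" for g
  have "p \<in> pos_hom G ?A"
    unfolding pos_hom_def hom_def
  proof (intro CollectI conjI ballI impI funcsetI)
    fix g assume "g \<in> carrier G"
    then have k: "\<eta> g \<in> K" by (rule image_mem)
    show "p g \<in> carrier ?A"
      unfolding aut_ogroup_simps
    proof (rule chain_autsI)
      show "p g \<in> extensional K" by (simp add: p_def)
      show "p g x \<in> K" if "x \<in> K" for x using that k by (simp add: p_def)
      show "\<exists>x\<in>K. p g x = y" if "y \<in> K" for y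
        using that k K.mem_carrier
        by (intro bexI[of _ "y \<otimes> inv \<eta> g"]) (simp_all add: p_def F.m_assoc)
      show "x = y" if "x \<in> K" "y \<in> K" "p g x = p g y" for x y
        using that k K.mem_carrier by (simp add: p_def)
      show "cone_le (p g x) (p g y)" if "x \<in> K" "y \<in> K" "cone_le x y" for x y
        using that k by (simp add: p_def cone_le_mult_right)
    qed
  next
    fix g g' assume g: "g \<in> carrier G" "g' \<in> carrier G"
    have k: "\<eta> g \<in> K" "\<eta> g' \<in> K" using g image_mem by auto
    show "p (g \<otimes>\<^bsub>G\<^esub> g') = p g \<otimes>\<^bsub>?A\<^esub> p g'"
      unfolding aut_ogroup_simps p_def compose_def
      using k K.mem_carrier pos_homD(3)[OF free_pos_hom g]
      by (intro restrict_ext) (simp add: F.m_assoc)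
    assume "g \<preceq>\<^bsub>G\<^esub> g'"
    then have "\<eta> g \<preceq> \<eta> g'" using pos_homD(4)[OF free_pos_hom g] by simp
    then show "p g \<preceq>\<^bsub>?A\<^esub> p g'"
      unfolding aut_ogroup_simps p_def
      using k K.mem_carrier by (simp add: cone_le_of_ole F.mult_left_mono)
  qed
  moreover have "in_variety V ?A" using A V by simp
  ultimately obtain h where h: "h \<in> l_hom F ?A" "\<forall>g\<in>carrier G. h (\<eta> g) = p g"
    using free_extension(1)[OF _ e] by blast
  let ?P = "{x \<in> carrier F. h x \<in> {f \<in> carrier ?A. cone_le \<one> (f \<one>)}}"
  have "prime_cone F ?P"
    by (rule prime_cone_vimage(1)[OF free_l_group A h(1) prime_cone_aut_ogroup[OF K.one_closed]])
  moreover have "k \<in> ?P \<longleftrightarrow> k \<in> C" if k: "k \<in> K" for k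
  proof -
    obtain g where g: "g \<in> carrier G" "k = \<eta> g" using k K by blast
    have kc: "k \<in> carrier F" using k K.mem_carrier by blast
    \<comment> \<open>Right translation by \<open>k\<close> sends the identity to \<open>k\<close>,
      so the base point \<open>\<one>\<close> recovers \<open>C\<close>.\<close>
    have "h k \<one> = k" using h(2) g kc by (simp add: p_def)
    then show ?thesis using cone_le_one[OF k] kc l_homD(2)[OF h(1) kc] by simp
  qed
  then have "?P \<inter> K = C" using order_cone(1) by blast
  ultimately show ?thesis by blast
qed

text \<open>The automorphism group of a chain is in general neither representable nor Abelian.
  Normality offers a target inside the variety instead: \<open>K\<close>, ordered by
  \<open>C\<close>, is itself a totally ordered group. The pullback of its positive cone has trace
  \<open>C\<close>.\<close>

lemma order_lift:
  assumes V: "V \<noteq> All_Lgroups" and nrm: "normal_cone (F\<lparr>carrier := K\<rparr>) C"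
  shows "\<exists>P. prime_cone F P \<and> P \<inter> K = C"
proof -
  define T where "T = F\<lparr>carrier := K, ole := cone_le\<rparr>"
  have sel: "carrier T = K" "x \<otimes>\<^bsub>T\<^esub> y = x \<otimes> y" "\<one>\<^bsub>T\<^esub> = \<one>" "x \<preceq>\<^bsub>T\<^esub> y \<longleftrightarrow> cone_le x y" for x y
    by (simp_all add: T_def)
  have nC: "g \<otimes> x \<otimes> inv g \<in> C" if "x \<in> C" "g \<in> K" for x g
    using nrm that F.m_inv_consistent[OF K.subgroup_axioms that(2)] unfolding normal_cone_def by fastforce
  have grp: "group T"
  proof (rule groupI)
    fix x assume "x \<in> carrier T"
    then show "\<exists>y\<in>carrier T. y \<otimes>\<^bsub>T\<^esub> x = \<one>\<^bsub>T\<^esub>"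
      using K.mem_carrier by (intro bexI[of _ "inv x"]) (simp_all add: sel)
  qed (use K.mem_carrier in \<open>simp_all add: sel F.m_assoc\<close>)
  have po: "po_group T"
  proof (rule po_groupI[OF grp])
    fix a b s t assume "a \<in> carrier T" "b \<in> carrier T" "s \<in> carrier T" "t \<in> carrier T" and le: "a \<preceq>\<^bsub>T\<^esub> b"
    then have c: "a \<in> K" "b \<in> K" "s \<in> K" "t \<in> K" by (simp_all add: sel)
    \<comment> \<open>Right invariance holds for every right order; left invariance is normality of
      \<open>C\<close>.\<close>
    have "s \<otimes> (b \<otimes> inv a) \<otimes> inv s \<in> C"
      using nC le c by (simp add: sel cone_le_def)
    also have "s \<otimes> (b \<otimes> inv a) \<otimes> inv s = (s \<otimes> b) \<otimes> inv (s \<otimes> a)"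
      using c K.mem_carrier by (simp add: F.inv_mult_group F.m_assoc)
    finally have "cone_le (s \<otimes> a) (s \<otimes> b)" by (simp add: cone_le_def)
    then show "s \<otimes>\<^bsub>T\<^esub> a \<otimes>\<^bsub>T\<^esub> t \<preceq>\<^bsub>T\<^esub> s \<otimes>\<^bsub>T\<^esub> b \<otimes>\<^bsub>T\<^esub> t"
      using c by (simp add: sel cone_le_mult_right)
  next
    show "x \<preceq>\<^bsub>T\<^esub> x" if "x \<in> carrier T" for x using that cone_le_refl by (simp add: sel)
    show "x = y" if "x \<in> carrier T" "y \<in> carrier T" "x \<preceq>\<^bsub>T\<^esub> y" "y \<preceq>\<^bsub>T\<^esub> x" for x y
      using that cone_le_antisym[of x y] by (simp add: sel)
    show "x \<preceq>\<^bsub>T\<^esub> z" if "x \<in> carrier T" "y \<in> carrier T" "z \<in> carrier T" "x \<preceq>\<^bsub>T\<^esub> y" "y \<preceq>\<^bsub>T\<^esub> z" for x y z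
      using that cone_le_trans[of x y z] by (simp add: sel)
  qed
  have TO: "to_group T"
    by (rule to_groupI[OF po]) (simp add: sel cone_le_total)
  interpret T: to_group T by (rule TO)
  have L: "l_group T" by (rule T.l_group)
  interpret TL: l_group T by (rule L)
  have i: "inv\<^bsub>T\<^esub> x = inv x" if "x \<in> K" for x
    using that K.mem_carrier by (intro T.inv_equality) (simp_all add: sel)
  have CT: "C = {x \<in> carrier T. \<one>\<^bsub>T\<^esub> \<preceq>\<^bsub>T\<^esub> x}"
    using order_cone(1) cone_le_one by (auto simp: sel)
  have prime: "prime_cone T C"
    unfolding CT prime_cone_def total_cone_def
    using T.ole_total[OF T.one_closed] T.one_le_inv_iff
    by (auto simp: T.one_le_mult TL.inf_greatest TL.inf_closed)
  have normal: "normal_cone T C"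
    unfolding CT normal_cone_def by (simp add: T.one_le_conj)
  have "in_variety V T"
  proof (cases V)
    case All_Lgroups
    then show ?thesis using V by simp
  next
    case Representable_Lgroups
    \<comment> \<open>In a totally ordered group the positive cone is itself a normal prime cone, so
      it alone separates.\<close>
    have "normal_prime_separated T"
      unfolding normal_prime_separated_def using prime normal CT by blast
    then show ?thesis using Representable_Lgroups L by (simp add: representable_iff)
  next
    case Abelian_Lgroups
    then have "comm_group F" using free_variety by (simp add: abelian_l_group_def)
    then have "comm_group T"
      using K.mem_carrier comm_groupE(4)[of F] by (intro T.group_comm_groupI) (auto simp: sel)
    then show ?thesis using Abelian_Lgroups L by (simp add: abelian_l_group_def)
  qed
  moreover have "\<eta> \<in> pos_hom G T"
    unfolding pos_hom_def hom_def using pos_homD(3,4)[OF free_pos_hom] image_mem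
    by (simp add: sel cone_le_of_ole)
  moreover have "inj_on (\<lambda>x. {[Inr x]}) (carrier T)" by (simp add: inj_on_def)
  ultimately obtain h where h: "h \<in> l_hom F T" "\<forall>g\<in>carrier G. h (\<eta> g) = \<eta> g"
    using free_extension(1) by blast
  let ?P = "{x \<in> carrier F. h x \<in> C}"
  have "prime_cone F ?P" by (rule prime_cone_vimage(1)[OF free_l_group L h(1) prime])
  moreover have "k \<in> ?P \<longleftrightarrow> k \<in> C" if k: "k \<in> K" for k
  proof -
    obtain g where g: "g \<in> carrier G" "k = \<eta> g" using k K by blast
    then have "h k = k" using h(2) by simp
    then show ?thesis using k K.mem_carrier by simp
  qed
  then have "?P \<inter> K = C" using order_cone(1) by blast
  ultimately show ?thesis by blast
qed

end

end

theorem corollary6p2: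
  fixes G :: "'g ogroup" and F :: "'f ogroup" and \<eta> :: "'g \<Rightarrow> 'f" and V :: l_variety
  assumes "po_group G"
    and "free_l_group_over V G F \<eta>"
  shows "(V = All_Lgroups \<longrightarrow>
            min_space F homeomorphic_space right_order_space (group_image \<eta> G F)) \<and>
         (V = Representable_Lgroups \<or> V = Abelian_Lgroups \<longrightarrow>
            min_space F homeomorphic_space order_space (group_image \<eta> G F))"
proof -
  let ?K = "\<eta> ` carrier G"
  let ?FK = "F\<lparr>carrier := ?K\<rparr>"
  have KF: "group_image \<eta> G F = ?FK" by (simp add: group_image_def)
  have F: "l_group F" by (rule free_l_group[OF assms])
  interpret F: l_group F by (rule F)
  note sub = subgroup_image[OF assms] and gen = lattice_closure_image[OF assms]
  have po: "po_group ?FK" by (rule F.po_group_subgroup[OF sub])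
  have "min_space F homeomorphic_space right_order_space ?FK" if V: "V = All_Lgroups"
  proof -
    have lift: "\<exists>P. prime_cone F P \<and> P \<inter> ?K = C" if "C \<in> right_orders ?FK" for C
      using right_order_lift[OF assms HOL.refl that V] .
    have "min_space F homeomorphic_space
        subtopology (right_order_space ?FK) (trace_orders F ?K False)"
      by (rule min_space_homeomorphic_trace_orders[OF F sub gen _ lift]) simp_all
    \<comment> \<open>Without the normality condition the subspace is the whole space of right
      orders, so the subtopology disappears.\<close>
    moreover have "trace_orders F ?K False = topspace (right_order_space ?FK)"
      using topspace_right_order_space[OF F sub gen _ lift, of False] trace_orders_def[OF F sub gen _ lift, of False]
      by simp
    ultimately show ?thesis by simp
  qed
  moreover have "min_space F homeomorphic_space order_space ?FK" if V: "V \<noteq> All_Lgroups"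
  proof -
    have lift: "\<exists>P. prime_cone F P \<and> P \<inter> ?K = C"
      if "C \<in> right_orders ?FK" "True \<longrightarrow> normal_cone ?FK C" for C
      using order_lift[OF assms HOL.refl that(1) V] that(2) by simp
    have conj: "conj_orthogonal F" by (rule conj_orthogonal_free[OF assms V])
    have "min_space F homeomorphic_space
        subtopology (right_order_space ?FK) (trace_orders F ?K True)"
      by (rule min_space_homeomorphic_trace_orders[OF F sub gen conj lift]) simp_all
    moreover have "trace_orders F ?K True = orders ?FK"
      using mem_orders_iff[OF po] trace_orders_def[OF F sub gen conj lift, of True] by auto
    ultimately show ?thesis by (simp add: order_space_def)
  qed
  ultimately show ?thesis unfolding KF by auto
qed


end
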